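(* Let $\Omega\subseteq\mathbb{R}^n$ be open and bounded, and let $F\colon\mathcal{S}^n\times\Omega\to\mathbb{R}$ be elliptic at $0$. Suppose there is a strictly increasing function $\ell\colon[0,\infty)\to[0,\infty)$ such that $$F(X+\tau I,x)-F(X,x)\ge\ell(\tau)\qquad\text{for all }x\in\Omega,\ \tau\ge0,\ X\in\mathcal{S}^n.$$ Suppose further that for every compact $K\subseteq\Omega$ there is a modulus of continuity $\omega$ such that $$F(X,x)-F(Y,y)\le\omega\big(\alpha|x-y|^2+|x-y|\big)$$ whenever $\alpha>0$, $x,y\in K$, and $X,Y\in\mathcal{S}^n$ satisfy $$-\alpha\begin{bmatrix} I&0\\0&I\end{bmatrix}\le\begin{bmatrix} X&0\\0&-Y\end{bmatrix}\le\alpha\begin{bmatrix} I&-I\\-I&I\end{bmatrix}.$$ Then the comparison principle holds for the equation $F(\mathcal{H}w,x)=0$ in $\Omega$.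
   Context: $\mathcal{S}^n$ is the space of real symmetric $n\times n$ matrices with its usual partial order ($X\le Y$ iff $Y-X$ is positive semidefinite; likewise for $2n\times2n$ matrices); $\mathcal{H}w$ is the Hessian matrix of $w$. A modulus of continuity is a nondecreasing function $\omega\colon[0,\infty)\to[0,\infty)$ with $\omega(0)=0=\lim_{r\to0^+}\omega(r)$. $F$ is elliptic at $0$ if for all $x\in\Omega$ and $X\le Y$ in $\mathcal{S}^n$: $0\le F(X,x)$ implies $0\le F(Y,x)$, and $0<F(X,x)$ implies $0<F(Y,x)$. Viscosity solutions: $v\in USC(\overline\Omega)$ is a viscosity subsolution of $F(\mathcal{H}w,x)=0$ in $\Omega$ if, whenever $x_0\in\Omega$ and $\phi$ is a $C^2$ function near $x_0$ with $\phi(x_0)=v(x_0)$ and $\phi\ge v$ near $x_0$, then $F(\mathcal{H}\phi(x_0),x_0)\ge0$. $u\in LSC(\overline\Omega)$ is a viscosity supersolution if, whenever $\phi$ is $C^2$ near $x_0\in\Omega$ with $\phi(x_0)=u(x_0)$ and $\phi\le u$ near $x_0$, then $F(\mathcal{H}\phi(x_0),x_0)\le0$. ($USC$, $LSC$: real-valued upper/lower semicontinuous functions.) The comparison principle holds for the equation in $\Omega$ if: whenever $v\in USC(\overline\Omega)$ is a viscosity subsolution and $u\in LSC(\overline\Omega)$ is a viscosity supersolution in $\Omega$ with $v\le u$ on $\partial\Omega$, then $v\le u$ in $\Omega$. *)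

theory Defs
  imports "HOL-Analysis.Analysis"
begin

section \<open>Symmetric matrices and their order\<close>

definition symmetric_mat :: "real^'n^'n \<Rightarrow> bool" where
  "symmetric_mat A \<longleftrightarrow> transpose A = A"

definition pos_semidef :: "real^'n^'n \<Rightarrow> bool" where
  "pos_semidef A \<longleftrightarrow> symmetric_mat A \<and> (\<forall>x. 0 \<le> x \<bullet> (A *v x))"

text \<open>The order \<open>\<le>\<close> that the library puts on vectors is componentwise, hence the separate symbol.\<close>

definition loewner_le :: "real^'n^'n \<Rightarrow> real^'n^'n \<Rightarrow> bool" (infix \<open>\<preceq>\<close> 50) where
  "X \<preceq> Y \<longleftrightarrow> pos_semidef (Y - X)"

text \<open>The \<open>2n \<times> 2n\<close> matrix with rows of blocks \<open>A B\<close> and \<open>C D\<close>, indexed by the sum type.\<close>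

definition block_mat ::
    "real^'n^'n \<Rightarrow> real^'n^'n \<Rightarrow> real^'n^'n \<Rightarrow> real^'n^'n \<Rightarrow> real^('n + 'n)^('n + 'n)" where
  "block_mat A B C D = (\<chi> i j.
     case i of
       Inl a \<Rightarrow> (case j of Inl b \<Rightarrow> A $ a $ b | Inr b \<Rightarrow> B $ a $ b)
     | Inr a \<Rightarrow> (case j of Inl b \<Rightarrow> C $ a $ b | Inr b \<Rightarrow> D $ a $ b))"

section \<open>Semicontinuity and moduli of continuity\<close>

definition usc_on :: "'a::topological_space set \<Rightarrow> ('a \<Rightarrow> real) \<Rightarrow> bool" where
  "usc_on S v \<longleftrightarrow> (\<forall>x\<in>S. \<forall>c>v x. \<forall>\<^sub>F y in at x within S. v y < c)"

definition lsc_on :: "'a::topological_space set \<Rightarrow> ('a \<Rightarrow> real) \<Rightarrow> bool" where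
  "lsc_on S u \<longleftrightarrow> (\<forall>x\<in>S. \<forall>c<u x. \<forall>\<^sub>F y in at x within S. c < u y)"

text \<open>Functions \<open>[0,\<infinity>) \<rightarrow> [0,\<infinity>)\<close> are functions on \<open>real\<close> whose values at negative arguments are
  irrelevant.\<close>

definition modulus_of_continuity :: "(real \<Rightarrow> real) \<Rightarrow> bool" where
  "modulus_of_continuity \<omega> \<longleftrightarrow>
     (\<forall>r\<ge>0. 0 \<le> \<omega> r) \<and> mono_on {0..} \<omega> \<and> \<omega> 0 = 0 \<and> (\<omega> \<longlongrightarrow> 0) (at_right 0)"

section \<open>Hessians\<close>

definition gradient :: "(real^'n \<Rightarrow> real) \<Rightarrow> real^'n \<Rightarrow> real^'n" where
  "gradient \<phi> x = (\<chi> i. frechet_derivative \<phi> (at x) (axis i 1))"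

definition hessian :: "(real^'n \<Rightarrow> real) \<Rightarrow> real^'n \<Rightarrow> real^'n^'n" where
  "hessian \<phi> x = matrix (frechet_derivative (gradient \<phi>) (at x))"

definition C2_near :: "(real^'n \<Rightarrow> real) \<Rightarrow> real^'n \<Rightarrow> bool" where
  "C2_near \<phi> x0 \<longleftrightarrow> (\<exists>U. open U \<and> x0 \<in> U \<and>
     (\<forall>x\<in>U. \<phi> differentiable (at x)) \<and>
     (\<forall>x\<in>U. gradient \<phi> differentiable (at x)) \<and>
     continuous_on U (hessian \<phi>))"

section \<open>Viscosity solutions\<close>

text \<open>A function \<open>F\<close> on (symmetric matrices) \<open>\<times> \<Omega>\<close> is a total function that is only ever constrained
  and evaluated on that set; likewise for functions on the closure of \<open>\<Omega>\<close>. Hessians of \<open>C\<^sup>2\<close>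
  functions are symmetric.\<close>

definition elliptic_at_0 ::
    "(real^'n) set \<Rightarrow> (real^'n^'n \<Rightarrow> real^'n \<Rightarrow> real) \<Rightarrow> bool" where
  "elliptic_at_0 \<Omega> F \<longleftrightarrow>
     (\<forall>x\<in>\<Omega>. \<forall>X Y. symmetric_mat X \<longrightarrow> symmetric_mat Y \<longrightarrow> X \<preceq> Y \<longrightarrow>
        (0 \<le> F X x \<longrightarrow> 0 \<le> F Y x) \<and> (0 < F X x \<longrightarrow> 0 < F Y x))"

definition viscosity_subsolution ::
    "(real^'n) set \<Rightarrow> (real^'n^'n \<Rightarrow> real^'n \<Rightarrow> real) \<Rightarrow> (real^'n \<Rightarrow> real) \<Rightarrow> bool" where
  "viscosity_subsolution \<Omega> F v \<longleftrightarrow> usc_on (closure \<Omega>) v \<and>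
     (\<forall>x0\<in>\<Omega>. \<forall>\<phi>. C2_near \<phi> x0 \<longrightarrow> \<phi> x0 = v x0 \<longrightarrow> (\<forall>\<^sub>F x in nhds x0. v x \<le> \<phi> x) \<longrightarrow>
        0 \<le> F (hessian \<phi> x0) x0)"

definition viscosity_supersolution ::
    "(real^'n) set \<Rightarrow> (real^'n^'n \<Rightarrow> real^'n \<Rightarrow> real) \<Rightarrow> (real^'n \<Rightarrow> real) \<Rightarrow> bool" where
  "viscosity_supersolution \<Omega> F u \<longleftrightarrow> lsc_on (closure \<Omega>) u \<and>
     (\<forall>x0\<in>\<Omega>. \<forall>\<phi>. C2_near \<phi> x0 \<longrightarrow> \<phi> x0 = u x0 \<longrightarrow> (\<forall>\<^sub>F x in nhds x0. \<phi> x \<le> u x) \<longrightarrow>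
        F (hessian \<phi> x0) x0 \<le> 0)"

definition comparison_principle ::
    "(real^'n) set \<Rightarrow> (real^'n^'n \<Rightarrow> real^'n \<Rightarrow> real) \<Rightarrow> bool" where
  "comparison_principle \<Omega> F \<longleftrightarrow>
     (\<forall>v u. viscosity_subsolution \<Omega> F v \<longrightarrow> viscosity_supersolution \<Omega> F u \<longrightarrow>
        (\<forall>x\<in>frontier \<Omega>. v x \<le> u x) \<longrightarrow> (\<forall>x\<in>\<Omega>. v x \<le> u x))"

end

theory Submission
  imports Defs
begin

text \<open>
  If \<open>v - u\<close> has a positive maximum, the strict sub- and supersolutions \<open>v + \<eta>/2 (|x|\<^sup>2 - R\<^sup>2)\<close> and
  \<open>u - \<eta>/2 (|x|\<^sup>2 - R\<^sup>2)\<close> still do. The theorem on sums, applied with penalty \<open>\<alpha>/6 |x - y|\<^sup>2\<close>, gives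
  points \<open>z, z'\<close> and matrices \<open>X, Y\<close> that satisfy the block inequality exactly and are, up to an
  arbitrarily small multiple of the identity, Hessians of test functions at the points themselves and
  not only limits of such. The strictness absorbs this error, so that \<open>F(X,z) - F(Y,z') \<ge> 2 l(\<eta>/2)\<close> for
  all \<open>\<alpha>\<close>, whereas the modulus makes the left-hand side small.

  The theorem on sums comes from a global form of Jensen's lemma. For convex \<open>f\<close> the resolvent
  \<open>J = (I + \<partial>f)\<^sup>-\<^sup>1\<close> is nonexpansive, hence differentiable almost everywhere by Rademacher's theorem,
  and where \<open>f\<close> is touched from above by a paraboloid its derivative is injective; inverting it yields
  a second-order expansion of \<open>f\<close>. If \<open>x\<close> maximises \<open>w - p \<bullet> x\<close> with \<open>w = f - C/2 |x|\<^sup>2\<close>, then \<open>p\<close> is the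
  value of the Lipschitz map \<open>y - (1 + C) J y\<close> at the corresponding \<open>y\<close>, and this map sends the
  exceptional null set to a null set, which cannot contain all small \<open>p\<close>.
\<close>

section \<open>Lipschitz functions on the line are differentiable almost everywhere\<close>

text \<open>Continuity of \<open>F\<close> is not among the hypotheses, so inequalities for
  \<open>F\<close> cannot be carried over to limits of jets, which is what the usual theorem on sums
  supplies. Hence a different trade: the second-order expansions hold at the points themselves,
  while the points maximise only up to \<open>\<epsilon>\<close>, the price of the linear tilt
  \<open>p\<close> in Jensen's lemma. Sup-convolutions over a compact set are defined on the whole
  space and fall off quadratically, so nothing has to be localised and every small tilt has a
  maximiser. The factor 1/6 makes the constants of the block inequality come out exactly: a penalty
  \<beta>/2 |x - y|^2 leads to bounds with 3 \<beta>, and here \<beta> = \<alpha>/3. Each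
  perturbation has Hessian \<eta> I. One half of it pays for the remainder of the expansion, the
  other half is what \<open>l\<close> measures; this is the origin of \<eta>/2.\<close>

definition diff_quot :: "('a::real_vector \<Rightarrow> real) \<Rightarrow> 'a \<Rightarrow> 'a \<Rightarrow> real \<Rightarrow> real" where
  "diff_quot f v x t = (f (x + t *\<^sub>R v) - f x) / t"

text \<open>For Lipschitz \<open>f\<close> the union of these sets over rational
  \<open>p < q\<close> is exactly the set where the quotient has no limit at 0, so it suffices to
  treat one pair.\<close>

definition osc_set :: "('a::real_vector \<Rightarrow> real) \<Rightarrow> 'a \<Rightarrow> real \<Rightarrow> real \<Rightarrow> 'a set" where
  "osc_set f v p q = {x. (\<exists>\<^sub>F t in at 0. diff_quot f v x t < p) \<and> (\<exists>\<^sub>F t in at 0. q < diff_quot f v x t)}"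

text \<open>Used to show that oscillation sets are Borel: away from 0 the condition
  \<open>g t < p\<close> is open in \<open>t\<close>, so countably many rational \<open>t\<close>
  decide it.\<close>

lemma frequently_at_zero_Rats:
  fixes g :: "real \<Rightarrow> real"
  assumes "\<And>t. t \<noteq> 0 \<Longrightarrow> isCont g t"
  shows "(\<exists>\<^sub>F t in at 0. g t < p) \<longleftrightarrow> (\<forall>n. \<exists>t\<in>\<rat> \<inter> {t. t \<noteq> 0 \<and> \<bar>t\<bar> < inverse (Suc n)}. g t < p)"
proof
  assume L: "\<exists>\<^sub>F t in at 0. g t < p"
  show "\<forall>n. \<exists>t\<in>\<rat> \<inter> {t. t \<noteq> 0 \<and> \<bar>t\<bar> < inverse (Suc n)}. g t < p"
  proof
    fix n
    have "inverse (real (Suc n)) > 0" by simp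
    then obtain t where t: "t \<noteq> 0" "\<bar>t\<bar> < inverse (Suc n)" "g t < p"
      using L unfolding frequently_at by (metis dist_0_norm dist_commute real_norm_def)
    have "isCont g t" using assms t by auto
    then have "\<forall>\<^sub>F s in at t. g s < p" using t(3) by (simp add: isCont_def order_tendstoD(2))
    then have 1: "\<forall>\<^sub>F s in nhds t. g s < p" using t(3) by (simp add: eventually_nhds_conv_at)
    have 2: "\<forall>\<^sub>F s in nhds t. s \<in> {s. s \<noteq> 0 \<and> \<bar>s\<bar> < inverse (Suc n)}"
      by (rule eventually_nhds_in_open)
        (use t in \<open>auto intro!: open_Collect_conj open_Collect_neq open_Collect_less continuous_intros\<close>)
    obtain S where S: "open S" "t \<in> S" "\<And>s. s \<in> S \<Longrightarrow> g s < p \<and> s \<noteq> 0 \<and> \<bar>s\<bar> < inverse (Suc n)"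
      using eventually_conj[OF 1 2] unfolding eventually_nhds by auto
    obtain e where e: "e > 0" "ball t e \<subseteq> S" using S openE by blast
    obtain r where r: "r \<in> \<rat>" "t < r" "r < t + e" using Rats_dense_in_real[of t "t+e"] e by auto
    then have "r \<in> S" using e by (auto simp: dist_real_def)
    then show "\<exists>t\<in>\<rat> \<inter> {t. t \<noteq> 0 \<and> \<bar>t\<bar> < inverse (Suc n)}. g t < p" using S(3) r(1) by blast
  qed
next
  assume R: "\<forall>n. \<exists>t\<in>\<rat> \<inter> {t. t \<noteq> 0 \<and> \<bar>t\<bar> < inverse (Suc n)}. g t < p"
  show "\<exists>\<^sub>F t in at 0. g t < p"
    unfolding frequently_at
  proof (intro allI impI)
    fix d :: real assume "d > 0"
    then obtain n where "inverse (Suc n) < d" using reals_Archimedean by blast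
    with R[rule_format, of n] show "\<exists>x\<in>UNIV. x \<noteq> 0 \<and> dist x 0 < d \<and> g x < p"
      by (auto simp: dist_norm)
  qed
qed

lemma continuous_diff_quot:
  fixes f :: "'a::real_normed_vector \<Rightarrow> real"
  assumes "continuous_on UNIV f"
  shows "t \<noteq> 0 \<Longrightarrow> isCont (diff_quot f v x) t" "continuous_on UNIV (\<lambda>x. diff_quot f v x t)"
proof -
  have "isCont (\<lambda>t. f (x + t *\<^sub>R v)) t"
    by (rule isCont_o2[where f="\<lambda>t. x + t *\<^sub>R v"]) (use assms in \<open>auto simp: continuous_on_eq_continuous_at\<close>)
  then show "t \<noteq> 0 \<Longrightarrow> isCont (diff_quot f v x) t"
    unfolding diff_quot_def by (intro continuous_intros) auto
  show "continuous_on UNIV (\<lambda>x. diff_quot f v x t)"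
    unfolding diff_quot_def divide_inverse
    by (intro continuous_intros continuous_on_compose2[OF assms]) auto
qed

lemma diff_quot_measurable [measurable]:
  fixes f :: "'a::euclidean_space \<Rightarrow> real"
  assumes "continuous_on UNIV f"
  shows "(\<lambda>x. diff_quot f v x t) \<in> borel_measurable borel"
  using continuous_diff_quot(2)[OF assms] by (rule borel_measurable_continuous_onI)

lemma diff_quot_uminus: "diff_quot (\<lambda>x. - f x) v x t = - diff_quot f v x t"
  by (simp add: diff_quot_def divide_simps)

lemma osc_set_borel:
  fixes f :: "'a::euclidean_space \<Rightarrow> real"
  assumes f: "continuous_on UNIV f"
  shows "osc_set f v p q \<in> sets borel"
proof -
  have *: "{x. \<exists>\<^sub>F t in at 0. diff_quot f v x t < p} \<in> sets borel" if f: "continuous_on UNIV f" for f p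
  proof -
    note [measurable] = diff_quot_measurable[OF f]
    have count: "countable (\<rat> \<inter> {t::real. t \<noteq> 0 \<and> \<bar>t\<bar> < inverse (Suc n)})" for n
      by (rule countable_subset[OF _ countable_rat]) auto
    have "{x. \<exists>\<^sub>F t in at 0. diff_quot f v x t < p} =
       {x\<in>space borel. \<forall>n. \<exists>t\<in>\<rat> \<inter> {t. t \<noteq> 0 \<and> \<bar>t\<bar> < inverse (Suc n)}. diff_quot f v x t < p}"
      using frequently_at_zero_Rats[OF continuous_diff_quot(1)[OF f]] by simp
    also have "\<dots> \<in> sets borel"
      by (intro sets.sets_Collect_countable_All sets.sets_Collect_countable_Ex' count) measurable
    finally show ?thesis .
  qed
  have "osc_set f v p q = {x. \<exists>\<^sub>F t in at 0. diff_quot f v x t < p} \<inter>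
      {x. \<exists>\<^sub>F t in at 0. diff_quot (\<lambda>x. - f x) v x t < - q}"
    by (auto simp: osc_set_def diff_quot_uminus)
  also have "\<dots> \<in> sets borel" by (intro sets.Int * f continuous_intros)
  finally show ?thesis .
qed

lemma tendsto_if_not_oscillating:
  fixes g :: "real \<Rightarrow> real"
  assumes b: "\<And>t. \<bar>g t\<bar> \<le> K"
    and no: "\<And>p q. p \<in> \<rat> \<Longrightarrow> q \<in> \<rat> \<Longrightarrow> p < q \<Longrightarrow>
      \<not> ((\<exists>\<^sub>F t in at 0. g t < p) \<and> (\<exists>\<^sub>F t in at 0. q < g t))"
  shows "\<exists>l. (g \<longlongrightarrow> l) (at 0)"
proof -
  \<comment> \<open>In \<open>ereal\<close> both one-sided limits exist unconditionally; the bound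
    \<open>K\<close> brings their common value back to the reals.\<close>
  let ?g = "\<lambda>t. ereal (g t)"
  let ?I = "Liminf (at 0) ?g" and ?S = "Limsup (at 0) ?g"
  have le: "?I \<le> ?S" by (rule Liminf_le_Limsup) simp
  have eq: "?I = ?S"
  proof (rule ccontr)
    assume "?I \<noteq> ?S"
    then have "?I < ?S" using le by auto
    then obtain p where p: "?I < real_of_rat p" "real_of_rat p < ?S" using ereal_dense3 by blast
    then obtain q where q: "real_of_rat p < ereal (real_of_rat q)" "real_of_rat q < ?S" using ereal_dense3 by blast
    have 1: "\<exists>\<^sub>F t in at 0. g t < real_of_rat p"
    proof (rule ccontr)
      assume "\<not> ?thesis"
      then have "\<forall>\<^sub>F t in at 0. real_of_rat p \<le> g t" by (simp add: not_frequently not_less)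
      then have "real_of_rat p \<le> ?I" by (intro Liminf_bounded) auto
      then show False using p by auto
    qed
    have 2: "\<exists>\<^sub>F t in at 0. real_of_rat q < g t"
    proof (rule ccontr)
      assume "\<not> ?thesis"
      then have "\<forall>\<^sub>F t in at 0. g t \<le> real_of_rat q" by (simp add: not_frequently not_less)
      then have "?S \<le> real_of_rat q" by (intro Limsup_bounded) auto
      then show False using q by auto
    qed
    show False using no[of "real_of_rat p" "real_of_rat q"] 1 2 q(1) by simp
  qed
  have "?S \<le> ereal K" by (rule Limsup_bounded) (use b in \<open>auto simp: abs_le_iff\<close>)
  moreover have "ereal (- K) \<le> ?I" by (rule Liminf_bounded) (use b in \<open>auto simp: abs_le_iff minus_le_iff\<close>)
  ultimately obtain l where l: "?S = ereal l" using eq by (cases ?S) auto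
  have "(?g \<longlongrightarrow> ereal l) (at 0)" by (rule Liminf_eq_Limsup) (use l eq in auto)
  then show ?thesis by auto
qed

text \<open>Short intervals on which \<open>F\<close> grows by at most \<open>p\<close> times the
  length form a Vitali cover of \<open>E\<close>. A disjoint countable subfamily, chosen inside an
  open set barely larger than \<open>E\<close>, covers \<open>E\<close> up to a null set;
  monotonicity bounds the images of its members, and the Lipschitz condition keeps the image of the
  null set null.\<close>

lemma measure_image_le_of_diff_quot_le:
  fixes F :: "real \<Rightarrow> real"
  assumes mono: "mono F" and lip: "L-lipschitz_on UNIV F" and p: "0 \<le> p"
    and E: "E \<in> lmeasurable" and FE: "F ` E \<in> lmeasurable"
    and quot: "\<And>x d. x \<in> E \<Longrightarrow> d > 0 \<Longrightarrow> \<exists>h. h \<noteq> 0 \<and> \<bar>h\<bar> < d \<and> (F (x + h) - F x) / h \<le> p"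
  shows "measure lebesgue (F ` E) \<le> p * measure lebesgue E"
proof -
  have "measure lebesgue (F ` E) \<le> p * (measure lebesgue E + e)" if "e > 0" for e
  proof -
    obtain T where T: "open T" "E \<subseteq> T" "(T - E) \<in> lmeasurable" "emeasure lebesgue (T - E) < ennreal e"
      using sets_lebesgue_outer_open[of E e] E \<open>e > 0\<close> by (auto simp: fmeasurable_def)
    have "T = E \<union> (T - E)" using T by auto
    then have Tm: "T \<in> lmeasurable" using E T by (metis fmeasurable.Un)
    have "measure lebesgue T = measure lebesgue E + measure lebesgue (T - E)"
      using measure_Un2[OF E Tm] T(2) by (simp add: Un_absorb1)
    moreover have "measure lebesgue (T - E) < e"
      using T(3,4) \<open>e > 0\<close> by (simp add: emeasure_eq_measure2 ennreal_less_iff)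
    ultimately have mT: "measure lebesgue T \<le> measure lebesgue E + e" by simp
    define K where "K = {(c::real,r::real). 0 < r \<and> cball c r \<subseteq> T \<and> F (c + r) - F (c - r) \<le> p * (2 * r)}"
    obtain C where C: "countable C" "C \<subseteq> K"
      "pairwise (\<lambda>i j. disjnt (cball (fst i) (snd i)) (cball (fst j) (snd j))) C"
      "negligible (E - (\<Union>i\<in>C. cball (fst i) (snd i)))"
    proof (rule Vitali_covering_theorem_cballs[of K snd E fst])
      show "0 < snd i" if "i \<in> K" for i using that by (auto simp: K_def)
      fix x d :: real assume x: "x \<in> E" and d: "0 < d"
      obtain d0 where d0: "d0 > 0" "ball x d0 \<subseteq> T" using T x openE by blast
      obtain h where h: "h \<noteq> 0" "\<bar>h\<bar> < min d d0" "(F (x + h) - F x) / h \<le> p"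
        using quot[OF x, of "min d d0"] d d0 by auto
      \<comment> \<open>As a ball, this is the interval with end points \<open>x\<close> and
        \<open>x + h\<close>, whatever the sign of \<open>h\<close>.\<close>
      let ?c = "x + h/2" and ?r = "\<bar>h\<bar>/2"
      have "cball ?c ?r \<subseteq> ball x d0"
      proof
        fix y assume "y \<in> cball ?c ?r"
        then have "\<bar>y - (x + h/2)\<bar> \<le> \<bar>h\<bar>/2" by (simp add: dist_real_def abs_minus_commute)
        then have "\<bar>y - x\<bar> \<le> \<bar>h\<bar>" by (auto simp: abs_if split: if_splits)
        then show "y \<in> ball x d0" using h by (simp add: dist_real_def abs_minus_commute)
      qed
      moreover have "F (?c + ?r) - F (?c - ?r) \<le> p * (2 * ?r)"
      proof (cases "h > 0")
        case True
        then have eqs: "?c + ?r = x + h" "?c - ?r = x" by (simp_all add: field_simps)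
        show ?thesis unfolding eqs using h(3) True by (simp add: field_simps)
      next
        case False
        then have eqs: "?c + ?r = x" "?c - ?r = x + h" and "h < 0" using h by (simp_all add: field_simps)
        then show ?thesis unfolding eqs using h(3) by (simp add: field_simps)
      qed
      ultimately have "(?c, ?r) \<in> K" using d0 h by (auto simp: K_def)
      moreover have "x \<in> cball ?c ?r" by (auto simp: dist_real_def)
      moreover have "?r < d" using h by auto
      ultimately show "\<exists>i. i \<in> K \<and> x \<in> cball (fst i) (snd i) \<and> snd i < d"
        by (intro exI[of _ "(?c, ?r)"]) auto
    qed
    define N where "N = E - (\<Union>i\<in>C. cball (fst i) (snd i))"
    have N: "negligible (F ` N)"
    proof (rule negligible_locally_Lipschitz_image)
      show "negligible N" using C by (simp add: N_def)
      fix x assume "x \<in> N"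
      show "\<exists>T B. open T \<and> x \<in> T \<and> (\<forall>y\<in>N \<inter> T. norm (F y - F x) \<le> B * norm (y - x))"
        using lipschitz_onD[OF lip] by (intro exI[of _ UNIV] exI[of _ L]) (auto simp: dist_norm)
    qed simp
    define I where "I i = {F (fst i - snd i)..F (fst i + snd i)}" for i
    have r: "0 < snd i" "cball (fst i) (snd i) \<subseteq> T" "F (fst i + snd i) - F (fst i - snd i) \<le> p * (2 * snd i)"
      if "i \<in> C" for i using subsetD[OF C(2) that] unfolding K_def by (cases i; simp)+
    have bd: "measure lebesgue (\<Union>i\<in>D. I i) \<le> p * (measure lebesgue E + e)" if D: "D \<subseteq> C" "finite D" for D
    proof -
      have "measure lebesgue (\<Union>i\<in>D. I i) \<le> (\<Sum>i\<in>D. measure lebesgue (I i))"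
        by (rule measure_UNION_le) (use D in \<open>auto simp: I_def\<close>)
      also have "\<dots> \<le> (\<Sum>i\<in>D. p * measure lebesgue (cball (fst i) (snd i)))"
      proof (rule sum_mono)
        fix i assume i: "i \<in> D"
        then have "F (fst i - snd i) \<le> F (fst i + snd i)" using r[of i] D by (intro monoD[OF mono]) auto
        then show "measure lebesgue (I i) \<le> p * measure lebesgue (cball (fst i) (snd i))"
          using r[of i] D i by (auto simp: I_def cball_eq_atLeastAtMost)
      qed
      also have "\<dots> = p * measure lebesgue (\<Union>i\<in>D. cball (fst i) (snd i))"
        unfolding measure_UNION'[OF D(2) lmeasurable_cball pairwise_subset[OF C(3) D(1)]]
        by (rule sum_distrib_left[symmetric])
      also have "\<dots> \<le> p * measure lebesgue T"
      proof (intro mult_left_mono measure_mono_fmeasurable Tm p)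
        show "(\<Union>i\<in>D. cball (fst i) (snd i)) \<subseteq> T" using r(2) D(1) by blast
        show "(\<Union>i\<in>D. cball (fst i) (snd i)) \<in> sets lebesgue" using D(2) by (intro sets.finite_UN) auto
      qed
      also have "\<dots> \<le> p * (measure lebesgue E + e)" using mT p by (simp add: mult_left_mono)
      finally show ?thesis .
    qed
    have Im: "(\<Union>i\<in>C. I i) \<in> lmeasurable" and Ib: "measure lebesgue (\<Union>i\<in>C. I i) \<le> p * (measure lebesgue E + e)"
      using fmeasurable_UN_bound[OF C(1) _ bd] measure_UN_bound[OF C(1) _ bd] by (auto simp: I_def)
    have "F ` E \<subseteq> (\<Union>i\<in>C. I i) \<union> F ` N"
    proof
      fix y assume "y \<in> F ` E"
      then obtain x where x: "x \<in> E" "y = F x" by auto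
      show "y \<in> (\<Union>i\<in>C. I i) \<union> F ` N"
      proof (cases "x \<in> N")
        case False
        then obtain i where i: "i \<in> C" "x \<in> cball (fst i) (snd i)" using x by (auto simp: N_def)
        then have "fst i - snd i \<le> x" "x \<le> fst i + snd i" by (auto simp: cball_eq_atLeastAtMost)
        then have "y \<in> I i" using x monoD[OF mono] by (auto simp: I_def)
        then show ?thesis using i by auto
      qed (use x in auto)
    qed
    then have "measure lebesgue (F ` E) \<le> measure lebesgue ((\<Union>i\<in>C. I i) \<union> F ` N)"
      using FE N Im by (intro measure_mono_fmeasurable) (auto intro: fmeasurable.Un negligible_imp_measurable fmeasurableD)
    also have "\<dots> = measure lebesgue (\<Union>i\<in>C. I i)"
      using N Im by (intro measure_Un_null_set) (auto simp: negligible_iff_null_sets)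
    finally show ?thesis using Ib by simp
  qed note * = this
  show ?thesis
  proof (rule field_le_epsilon)
    fix e :: real assume e: "e > 0"
    \<comment> \<open>The divisor is \<open>p + 1\<close> because \<open>p\<close> may be 0.\<close>
    have "measure lebesgue (F ` E) \<le> p * (measure lebesgue E + e / (p + 1))" using e p by (intro *) auto
    also have "\<dots> \<le> p * measure lebesgue E + e" using p e by (simp add: field_simps)
    finally show "measure lebesgue (F ` E) \<le> p * measure lebesgue E + e" .
  qed
qed

text \<open>Adding a linear function makes \<open>f\<close> increasing and bi-Lipschitz. The previous lemma, applied to this
  \<open>F\<close> and to its inverse, bounds \<open>|F(E)|\<close> above by \<open>P |E|\<close> and below by \<open>Q |E|\<close> with \<open>P < Q\<close>.\<close>

lemma negligible_osc_set_bounded: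
  fixes f :: "real \<Rightarrow> real"
  assumes lip: "L-lipschitz_on UNIV f" and pq: "p < q"
  shows "negligible (osc_set f 1 p q \<inter> cball 0 r)"
proof (cases "osc_set f 1 p q \<inter> cball 0 r = {}")
  case False
  define E where "E = osc_set f 1 p q \<inter> cball 0 r"
  have L: "0 \<le> L" using lip by (rule lipschitz_on_nonneg)
  \<comment> \<open>The slopes of \<open>f\<close> lie between \<open>- L\<close> and
    \<open>L\<close>, so those of \<open>F\<close> lie between 1 and
    \<open>2 * L + 1\<close>.\<close>
  define F where "F x = f x + (L + 1) * x" for x
  have fd: "\<bar>f x - f y\<bar> \<le> L * \<bar>x - y\<bar>" for x y
    using lipschitz_onD[OF lip, of x y] by (simp add: dist_real_def)
  have Fup: "\<bar>F x - F y\<bar> \<le> (2 * L + 1) * \<bar>x - y\<bar>" for x y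
  proof -
    have "\<bar>F x - F y\<bar> \<le> \<bar>f x - f y\<bar> + \<bar>(L + 1) * (x - y)\<bar>"
      unfolding F_def by (simp add: algebra_simps abs_if)
    also have "\<dots> \<le> L * \<bar>x - y\<bar> + (L + 1) * \<bar>x - y\<bar>"
      using fd[of x y] L by (simp add: abs_mult)
    finally show ?thesis by (simp add: algebra_simps)
  qed
  have Flow: "y - x \<le> F y - F x" if "x \<le> y" for x y
    using fd[of x y] that L by (simp add: F_def algebra_simps abs_if split: if_splits)
  have Flow': "\<bar>x - y\<bar> \<le> \<bar>F x - F y\<bar>" for x y
    using Flow[of x y] Flow[of y x] by (cases "x \<le> y") auto
  have mono: "mono F" using Flow by (auto intro!: monoI) (metis diff_ge_0_iff_ge order_trans)
  have Flip: "(2 * L + 1)-lipschitz_on UNIV F" using Fup L by (auto intro!: lipschitz_onI simp: dist_real_def)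
  then have Fcont: "continuous_on UNIV F" by (rule lipschitz_on_continuous_on)
  have inj: "inj F" using Flow' by (intro injI) (metis abs_zero abs_le_zero_iff eq_iff_diff_eq_0)
  have surj: "\<exists>x. F x = y" for y
  proof -
    let ?s = "\<bar>y - F 0\<bar>"
    have "F (- ?s) \<le> y" "y \<le> F ?s" using Flow[of 0 ?s] Flow[of "- ?s" 0] by auto
    then show ?thesis using IVT'[of F "- ?s" y ?s] continuous_on_subset[OF Fcont] by auto
  qed
  define G where "G = inv F"
  have GF: "G (F x) = x" for x using inj by (simp add: G_def)
  have FG: "F (G y) = y" for y using surj by (metis G_def f_inv_into_f rangeI)
  have Glip: "1-lipschitz_on UNIV G"
    using Flow'[of "G _" "G _"] by (auto intro!: lipschitz_onI simp: dist_real_def FG)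
  have Gmono: "mono G"
  proof (rule monoI, rule ccontr)
    fix x y :: real assume "x \<le> y" "\<not> G x \<le> G y"
    then show False using Flow[of "G y" "G x"] by (simp add: FG)
  qed
  have Eb: "E \<in> sets borel" unfolding E_def
    by (intro sets.Int osc_set_borel lipschitz_on_continuous_on[OF lip]) auto
  then have Em: "E \<in> lmeasurable"
    by (intro bounded_set_imp_lmeasurable) (auto simp: E_def)
  have GFE: "F ` E = G -` E" by (auto simp: GF image_iff) (metis FG)
  have "G \<in> borel_measurable borel"
    by (intro borel_measurable_continuous_onI lipschitz_on_continuous_on[OF Glip])
  then have "F ` E \<in> sets borel" using Eb unfolding GFE by (metis measurable_sets_borel)
  moreover have "bounded (F ` E)"
    by (rule bounded_uniformly_continuous_image)
       (auto simp: E_def intro: lipschitz_on_uniformly_continuous[OF lipschitz_on_subset[OF Flip]])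
  ultimately have FEm: "F ` E \<in> lmeasurable"
    by (intro bounded_set_imp_lmeasurable) auto
  have quot: "(F (x + h) - F x) / h = diff_quot f 1 x h + (L + 1)" if "h \<noteq> 0" for x h
    using that by (simp add: diff_quot_def F_def field_simps)
  have quot1: "1 \<le> (F (x + h) - F x) / h" if "h \<noteq> 0" for x h
    using Flow[of x "x+h"] Flow[of "x + h" x] that by (cases "h > 0") (auto simp: field_simps)
  define P Q where "P = p + (L + 1)" and "Q = q + (L + 1)"
  have 1: "\<exists>h. h \<noteq> 0 \<and> \<bar>h\<bar> < d \<and> (F (x + h) - F x) / h \<le> P" if "x \<in> E" "d > 0" for x d
  proof -
    have "\<exists>\<^sub>F t in at 0. diff_quot f 1 x t < p" using that by (auto simp: E_def osc_set_def)
    then obtain h where "h \<noteq> 0" "\<bar>h\<bar> < d" "diff_quot f 1 x h < p"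
      using \<open>d > 0\<close> unfolding frequently_at by (metis dist_0_norm dist_commute real_norm_def)
    then show ?thesis using quot[of h x] by (auto simp: P_def)
  qed
  have 2: "\<exists>h. h \<noteq> 0 \<and> \<bar>h\<bar> < d \<and> (F (x + h) - F x) / h > Q" if "x \<in> E" "d > 0" for x d
  proof -
    have "\<exists>\<^sub>F t in at 0. q < diff_quot f 1 x t" using that by (auto simp: E_def osc_set_def)
    then obtain h where "h \<noteq> 0" "\<bar>h\<bar> < d" "q < diff_quot f 1 x h"
      using \<open>d > 0\<close> unfolding frequently_at by (metis dist_0_norm dist_commute real_norm_def)
    then show ?thesis using quot[of h x] by (auto simp: Q_def)
  qed
  \<comment> \<open>The reason for splitting off the empty case: a point of \<open>E\<close> has a
    quotient of \<open>F\<close> that is at least 1 and at most \<open>P\<close>, so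
    \<open>P\<close> and \<open>Q\<close> are positive.\<close>
  obtain x where "x \<in> E" using False unfolding E_def by blast
  from 1[OF this, of 1] obtain h where "h \<noteq> 0" "(F (x + h) - F x) / h \<le> P" by auto
  then have P: "P \<ge> 1" using quot1[of h x] by simp
  have PQ: "P < Q" using pq by (simp add: P_def Q_def)
  have m1: "measure lebesgue (F ` E) \<le> P * measure lebesgue E"
    by (rule measure_image_le_of_diff_quot_le[OF mono Flip _ Em FEm 1]) (use P in auto)
  have GE: "G ` (F ` E) = E" by (simp add: image_image GF)
  have "measure lebesgue (G ` (F ` E)) \<le> (1 / Q) * measure lebesgue (F ` E)"
  proof (rule measure_image_le_of_diff_quot_le[OF Gmono Glip _ FEm])
    show "0 \<le> 1 / Q" using P PQ by simp
    show "G ` (F ` E) \<in> lmeasurable" using GE Em by simp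
    fix y d :: real assume "y \<in> F ` E" and d: "0 < d"
    then obtain x where x: "x \<in> E" "y = F x" by auto
    obtain h where h: "h \<noteq> 0" "\<bar>h\<bar> < d / (2 * L + 1)" "(F (x + h) - F x) / h > Q"
      using 2[OF x(1), of "d / (2 * L + 1)"] d L by auto
    \<comment> \<open>Moving \<open>y\<close> by \<open>?k\<close> moves \<open>G y\<close> by
      \<open>h\<close>, so the quotient of \<open>G\<close> is the reciprocal of that of
      \<open>F\<close>. The divisor \<open>2 * L + 1\<close> in the choice of \<open>h\<close> keeps
      \<open>?k\<close> below \<open>d\<close>.\<close>
    let ?k = "F (x + h) - F x"
    have "?k \<noteq> 0" using h(1) inj by (simp add: inj_eq)
    moreover have "\<bar>?k\<bar> < d"
    proof -
      have "\<bar>?k\<bar> \<le> (2 * L + 1) * \<bar>h\<bar>" using Fup[of "x+h" x] by simp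
      also have "\<dots> < d" using h(2) L by (simp add: field_simps)
      finally show ?thesis .
    qed
    moreover have "(G (y + ?k) - G y) / ?k \<le> 1 / Q"
    proof -
      have "(G (y + ?k) - G y) / ?k = 1 / (?k / h)" using x by (simp add: GF)
      also have "\<dots> \<le> 1 / Q" using h(3) P PQ by (intro divide_left_mono mult_pos_pos) linarith+
      finally show ?thesis .
    qed
    ultimately show "\<exists>k. k \<noteq> 0 \<and> \<bar>k\<bar> < d \<and> (G (y + k) - G y) / k \<le> 1 / Q" by blast
  qed
  then have "Q * measure lebesgue E \<le> measure lebesgue (F ` E)"
    using P PQ by (simp add: GE field_simps)
  with m1 have "(Q - P) * measure lebesgue E \<le> 0" by (simp add: algebra_simps)
  then have "measure lebesgue E \<le> 0" using PQ by (simp add: mult_le_0_iff)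
  then have "measure lebesgue E = 0" by (simp add: measure_le_0_iff)
  then show ?thesis using Em by (simp add: negligible_iff_measure0 E_def)
qed simp

lemma negligible_osc_set:
  fixes f :: "real \<Rightarrow> real"
  assumes "L-lipschitz_on UNIV f" and "p < q"
  shows "negligible (osc_set f 1 p q)"
proof -
  have "osc_set f 1 p q = (\<Union>n::nat. osc_set f 1 p q \<inter> cball 0 n)"
    using real_arch_simple by (auto simp: dist_norm)
  also have "negligible \<dots>"
    by (intro negligible_Union_nat negligible_osc_set_bounded[OF assms])
  finally show ?thesis .
qed

section \<open>Rademacher's theorem\<close>

lemma diff_quot_line: "diff_quot (\<lambda>t. f (x + t *\<^sub>R v)) 1 s t = diff_quot f v (x + s *\<^sub>R v) t"
  by (simp add: diff_quot_def algebra_simps)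

text \<open>Averaging the translates of the set along \<open>t v\<close>, \<open>t \<in> [0,1]\<close>, reduces to lines in the direction
  of \<open>v\<close> without rotating coordinates.\<close>

lemma null_osc_set:
  fixes f :: "'a::euclidean_space \<Rightarrow> real"
  assumes lip: "L-lipschitz_on UNIV f" and pq: "p < q"
  shows "osc_set f v p q \<in> null_sets lborel"
proof -
  define N where "N = osc_set f v p q"
  have N[measurable]: "N \<in> sets borel"
    unfolding N_def by (intro osc_set_borel lipschitz_on_continuous_on[OF lip])
  have line: "(\<integral>\<^sup>+t. indicator {0..1} t * indicator N (x + t *\<^sub>R v) \<partial>lborel) = 0" for x
  proof -
    let ?g = "\<lambda>t. f (x + t *\<^sub>R v)"
    have "(L * norm v)-lipschitz_on UNIV ?g"
    proof (rule lipschitz_onI)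
      fix s t :: real
      have "dist (?g s) (?g t) \<le> L * dist (x + s *\<^sub>R v) (x + t *\<^sub>R v)"
        by (rule lipschitz_onD[OF lip]) auto
      also have "dist (x + s *\<^sub>R v) (x + t *\<^sub>R v) = norm v * dist s t"
        by (simp add: dist_norm flip: scaleR_diff_left)
      finally show "dist (?g s) (?g t) \<le> L * norm v * dist s t" by (simp add: mult_ac)
    qed (use lipschitz_on_nonneg[OF lip] in simp)
    then have "negligible (osc_set ?g 1 p q)" by (rule negligible_osc_set[OF _ pq])
    moreover have "osc_set ?g 1 p q = {t. x + t *\<^sub>R v \<in> N}"
      by (simp add: osc_set_def N_def diff_quot_line)
    ultimately have "negligible {t. x + t *\<^sub>R v \<in> N}" by simp
    then have "AE t in lebesgue. x + t *\<^sub>R v \<notin> N"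
      by (simp add: negligible_iff_null_sets eventually_ae_filter) blast
    then have "AE t in lborel. x + t *\<^sub>R v \<notin> N" by (subst (asm) AE_completion_iff)
    then have "AE t in lborel. indicator {0..1} t * indicator N (x + t *\<^sub>R v) = (0::ennreal)"
      by eventually_elim simp
    then show ?thesis by (subst nn_integral_0_iff_AE) auto
  qed
  have shift: "(\<integral>\<^sup>+x. indicator N (x + c) \<partial>lborel) = emeasure lborel N" for c
  proof -
    have "emeasure lborel N = (\<integral>\<^sup>+x. indicator N x \<partial>distr lborel borel ((+) c))"
      by (simp add: lborel_distr_plus)
    also have "\<dots> = (\<integral>\<^sup>+x. indicator N (c + x) \<partial>lborel)"
      by (subst nn_integral_distr) auto
    finally show ?thesis by (simp add: add.commute)
  qed
  have "emeasure lborel N = (\<integral>\<^sup>+t. indicator {0..1} t * emeasure lborel N \<partial>(lborel::real measure))"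
    by (subst nn_integral_multc) auto
  also have "\<dots> = (\<integral>\<^sup>+t. (\<integral>\<^sup>+x. indicator {0..1} t * indicator N (x + t *\<^sub>R v) \<partial>lborel) \<partial>lborel)"
    by (intro nn_integral_cong) (subst nn_integral_cmult, auto simp: shift)
  also have "\<dots> = (\<integral>\<^sup>+x. (\<integral>\<^sup>+t. indicator {0..1} t * indicator N (x + t *\<^sub>R v) \<partial>lborel) \<partial>lborel)"
    by (rule lborel_pair.Fubini') measurable
  also have "\<dots> = 0" by (simp add: line)
  finally show ?thesis by (simp add: null_sets_def N_def[symmetric])
qed

section \<open>Directional derivatives: existence and linearity almost everywhere\<close>

lemma abs_diff_quot_le:
  assumes "L-lipschitz_on UNIV f"
  shows "\<bar>diff_quot f v x t\<bar> \<le> L * norm v"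
proof (cases "t = 0")
  \<comment> \<open>Division by zero makes the quotient 0 at \<open>t = 0\<close>.\<close>
  case True
  then show ?thesis using lipschitz_on_nonneg[OF assms] by (simp add: diff_quot_def)
next
  case False
  have "\<bar>f (x + t *\<^sub>R v) - f x\<bar> \<le> L * (\<bar>t\<bar> * norm v)"
    using lipschitz_onD[OF assms, of "x + t *\<^sub>R v" x] by (simp add: dist_norm)
  then show ?thesis using False by (simp add: diff_quot_def abs_divide field_simps)
qed

lemma AE_diff_quot_converges:
  fixes f :: "'a::euclidean_space \<Rightarrow> real"
  assumes lip: "L-lipschitz_on UNIV f"
  shows "AE x in lborel. \<exists>l. (diff_quot f v x \<longlongrightarrow> l) (at 0)"
proof -
  have "AE x in lborel. \<forall>p\<in>\<rat>. \<forall>q\<in>\<rat>. p < q \<longrightarrow> x \<notin> osc_set f v p q"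
    unfolding AE_ball_countable[OF countable_rat]
    using null_osc_set[OF lip] by (auto intro: AE_not_in)
  then show ?thesis
  proof eventually_elim
    fix x assume "\<forall>p\<in>\<rat>. \<forall>q\<in>\<rat>. p < q \<longrightarrow> x \<notin> osc_set f v p q"
    then show "\<exists>l. (diff_quot f v x \<longlongrightarrow> l) (at 0)"
      by (intro tendsto_if_not_oscillating[where K="L * norm v"] abs_diff_quot_le[OF lip])
        (auto simp: osc_set_def)
  qed
qed

text \<open>The limit runs along a sequence to make measurability immediate. Where the full limit
  exists this is the directional derivative; where the sequence diverges the value is
  unspecified.\<close>

definition dir_deriv :: "('a::real_vector \<Rightarrow> real) \<Rightarrow> 'a \<Rightarrow> 'a \<Rightarrow> real" where
  "dir_deriv f v x = lim (\<lambda>n. diff_quot f v x (inverse (Suc n)))"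

lemma diff_quot_sequence_tendsto:
  assumes "(diff_quot f v x \<longlongrightarrow> l) (at 0)"
  shows "(\<lambda>n. diff_quot f v x (inverse (Suc n))) \<longlonglongrightarrow> l"
proof -
  have "filterlim (\<lambda>n. inverse (real (Suc n))) (at 0) sequentially"
    using LIMSEQ_inverse_real_of_nat by (auto simp: filterlim_at)
  then show ?thesis by (rule filterlim_compose[OF assms])
qed

lemma dir_deriv_eqI:
  assumes "(diff_quot f v x \<longlongrightarrow> l) (at 0)"
  shows "dir_deriv f v x = l"
  unfolding dir_deriv_def by (rule limI[OF diff_quot_sequence_tendsto[OF assms]])

lemma AE_dir_deriv:
  fixes f :: "'a::euclidean_space \<Rightarrow> real"
  assumes lip: "L-lipschitz_on UNIV f"
  shows "AE x in lborel. (diff_quot f v x \<longlongrightarrow> dir_deriv f v x) (at 0)"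
  using AE_diff_quot_converges[OF lip, of v] by eventually_elim (metis dir_deriv_eqI)

lemma dir_deriv_measurable:
  fixes f :: "'a::euclidean_space \<Rightarrow> real"
  assumes "continuous_on UNIV f"
  shows "dir_deriv f v \<in> borel_measurable borel"
proof -
  note [measurable] = diff_quot_measurable[OF assms]
  show ?thesis unfolding dir_deriv_def by measurable
qed

text \<open>The function \<open>h\<close>, which is 1 + g/(C + 1), is a nonnegative density whose
  measure agrees with Lebesgue measure on boxes, hence everywhere; uniqueness of densities gives
  \<open>h x = 1\<close> almost everywhere. With \<open>C + 1\<close> the denominator is positive
  even if \<open>C\<close> is 0.\<close>

lemma AE_eq_zero_if_integral_box_eq_zero:
  fixes g :: "'a::euclidean_space \<Rightarrow> real"
  assumes g[measurable]: "g \<in> borel_measurable borel" and C: "\<And>x. \<bar>g x\<bar> \<le> C"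
    and int: "\<And>a b. (\<integral>x. indicator (box a b) x * g x \<partial>lborel) = 0"
  shows "AE x in lborel. g x = 0"
proof -
  have C0: "C \<ge> 0" using C[of undefined] by linarith
  define h where "h x = (C + 1 + g x) / (C + 1)" for x
  have h0: "h x \<ge> 0" for x using C[of x] C0 by (auto simp: h_def abs_le_iff)
  have hm[measurable]: "h \<in> borel_measurable borel" unfolding h_def by measurable
  have "lborel = density lborel (\<lambda>x. ennreal (h x))"
  proof (rule lborel_eqI)
    fix l u :: 'a assume lu: "\<And>b. b \<in> Basis \<Longrightarrow> l \<bullet> b \<le> u \<bullet> b"
    have i1: "integrable lborel (indicator (box l u) :: 'a \<Rightarrow> real)"
      using emeasure_lborel_box_finite[of l u] by (simp add: integrable_indicator_iff)
    have i2: "integrable lborel (\<lambda>x. indicator (box l u) x * g x)"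
      by (rule Bochner_Integration.integrable_bound[OF integrable_mult_right[OF i1, of C]])
        (use C C0 in \<open>auto simp: indicator_def abs_of_nonneg\<close>)
    have eq: "indicator (box l u) x * h x = indicator (box l u) x + (1 / (C + 1)) * (indicator (box l u) x * g x)" for x
      using C0 by (simp add: h_def field_simps)
    have i3: "integrable lborel (\<lambda>x. indicator (box l u) x * h x)"
      unfolding eq by (intro Bochner_Integration.integrable_add i1 integrable_mult_right i2)
    have "emeasure (density lborel (\<lambda>x. ennreal (h x))) (box l u)
      = (\<integral>\<^sup>+x. ennreal (indicator (box l u) x * h x) \<partial>lborel)"
      by (subst emeasure_density) (auto intro!: nn_integral_cong simp: indicator_def)
    also have "\<dots> = ennreal (\<integral>x. indicator (box l u) x * h x \<partial>lborel)"
      by (rule nn_integral_eq_integral[OF i3]) (use h0 in \<open>auto simp: indicator_def\<close>)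
    also have "(\<integral>x. indicator (box l u) x * h x \<partial>lborel) = measure lborel (box l u)"
      unfolding eq using int[of l u] by (subst Bochner_Integration.integral_add) (use i1 i2 in auto)
    also have "ennreal \<dots> = (\<Prod>b\<in>Basis. (u - l) \<bullet> b)"
      using lu by (simp add: measure_lborel_box)
    finally show "emeasure (density lborel (\<lambda>x. ennreal (h x))) (box l u) = (\<Prod>b\<in>Basis. (u - l) \<bullet> b)" .
  qed simp
  then have "density lborel (\<lambda>x. ennreal (h x)) = density lborel (\<lambda>_. 1)"
    by (simp add: density_1)
  then have "AE x in lborel. ennreal (h x) = 1"
    by (subst (asm) sigma_finite_measure.density_unique_iff[OF sigma_finite_lborel]) auto
  then show ?thesis
    by eventually_elim (use C0 in \<open>auto simp: h_def ennreal_eq_1 field_simps\<close>)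
qed

text \<open>Convergence can fail only on the frontier of the box, which is null because the box is
  convex.\<close>

lemma AE_indicator_box_translate:
  fixes a b v :: "'a::euclidean_space"
  shows "AE x in lborel. (\<lambda>n. indicator (box a b) (x - inverse (Suc n) *\<^sub>R v)) \<longlonglongrightarrow> (indicator (box a b) x :: real)"
proof -
  have "frontier (box a b) \<in> null_sets lebesgue"
    using negligible_convex_frontier[OF convex_box(2), of a b] by (simp add: negligible_iff_null_sets)
  then have "AE x in lebesgue. x \<notin> frontier (box a b)" by (rule AE_not_in)
  then have "AE x in lborel. x \<notin> frontier (box a b)" by (subst (asm) AE_completion_iff)
  then show ?thesis
  proof eventually_elim
    fix x assume x: "x \<notin> frontier (box a b)"
    have lim: "(\<lambda>n. x - inverse (Suc n) *\<^sub>R v) \<longlonglongrightarrow> x - 0 *\<^sub>R v"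
      by (intro tendsto_intros LIMSEQ_inverse_real_of_nat)
    have "\<forall>\<^sub>F n in sequentially. indicator (box a b) (x - inverse (Suc n) *\<^sub>R v) = (indicator (box a b) x :: real)"
    proof (cases "x \<in> box a b")
      case True
      then have "\<forall>\<^sub>F n in sequentially. x - inverse (Suc n) *\<^sub>R v \<in> box a b"
        using lim by (intro topological_tendstoD) auto
      then show ?thesis by eventually_elim (use True in simp)
    next
      case False
      then have "x \<in> - closure (box a b)" using x by (auto simp: frontier_def interior_open[OF open_box])
      then have "\<forall>\<^sub>F n in sequentially. x - inverse (Suc n) *\<^sub>R v \<in> - closure (box a b)"
        using lim by (intro topological_tendstoD) auto
      then show ?thesis by eventually_elim (use False closure_subset in \<open>auto simp: indicator_def\<close>)
    qed
    then show "(\<lambda>n. indicator (box a b) (x - inverse (Suc n) *\<^sub>R v)) \<longlonglongrightarrow> (indicator (box a b) x :: real)"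
      by (rule tendsto_eventually)
  qed
qed

text \<open>At a moving base point the quotients need not converge pointwise. A change of variables
  moves the translation to the indicator of the box; the base point is then fixed and dominated
  convergence applies.\<close>

lemma integral_diff_quot_translate_tendsto:
  fixes f :: "'a::euclidean_space \<Rightarrow> real"
  assumes lip: "L-lipschitz_on UNIV f"
  defines "t \<equiv> \<lambda>n. inverse (real (Suc n))"
  shows "(\<lambda>n. \<integral>x. indicator (box a b) x * diff_quot f w (x + t n *\<^sub>R v) (t n) \<partial>lborel)
    \<longlonglongrightarrow> (\<integral>x. indicator (box a b) x * dir_deriv f w x \<partial>lborel)"
    and "integrable lborel (\<lambda>x. indicator (box a b) x * diff_quot f w (x + t n *\<^sub>R v) (t n))"
    and "integrable lborel (\<lambda>x. indicator (box a b) x * dir_deriv f w x)"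
proof -
  have cont: "continuous_on UNIV f" by (rule lipschitz_on_continuous_on[OF lip])
  note [measurable] = diff_quot_measurable[OF cont] dir_deriv_measurable[OF cont]
  have L: "0 \<le> L" using lip by (rule lipschitz_on_nonneg)
  have t01: "0 \<le> t n" "t n \<le> 1" for n by (auto simp: t_def field_simps)
  obtain R where R: "box a b \<subseteq> cball 0 R"
    using bounded_box[of a b] unfolding bounded_iff by (auto simp: subset_iff)
  \<comment> \<open>As \<open>t n \<le> 1\<close>, all the translated boxes lie in this one
    ball.\<close>
  let ?dom = "\<lambda>x::'a. L * norm w * indicator (cball 0 (R + norm v)) x"
  have idom: "integrable lborel ?dom"
    using emeasure_lborel_cball_finite[of "0::'a" "R + norm v"]
    by (intro integrable_mult_right) (simp add: integrable_indicator_iff)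
  have bound: "norm (indicator (box a b) (x - s *\<^sub>R v) * c) \<le> ?dom x"
    if "0 \<le> s" "s \<le> 1" "\<bar>c\<bar> \<le> L * norm w" for x s and c :: real
  proof (cases "x - s *\<^sub>R v \<in> box a b")
    case True
    then have "norm (x - s *\<^sub>R v) \<le> R" using R by auto
    then have "norm x \<le> R + norm (s *\<^sub>R v)" using norm_triangle_ineq[of "x - s *\<^sub>R v" "s *\<^sub>R v"] by simp
    also have "\<dots> \<le> R + norm v" using that by (simp add: mult_left_le_one_le)
    finally show ?thesis using True that by simp
  qed (use L in simp)
  have shift: "(\<integral>x. indicator (box a b) x * diff_quot f w (x + t n *\<^sub>R v) (t n) \<partial>lborel)
    = (\<integral>x. indicator (box a b) (x - t n *\<^sub>R v) * diff_quot f w x (t n) \<partial>lborel)" for n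
  proof -
    have "(\<integral>x. indicator (box a b) (x - t n *\<^sub>R v) * diff_quot f w x (t n) \<partial>lborel) =
      (\<integral>x. indicator (box a b) (x - t n *\<^sub>R v) * diff_quot f w x (t n) \<partial>distr lborel borel ((+) (t n *\<^sub>R v)))"
      by (simp add: lborel_distr_plus)
    also have "\<dots> = (\<integral>x. indicator (box a b) x * diff_quot f w (x + t n *\<^sub>R v) (t n) \<partial>lborel)"
      by (subst integral_distr) (auto simp: add.commute)
    finally show ?thesis by simp
  qed
  show "integrable lborel (\<lambda>x. indicator (box a b) x * diff_quot f w (x + t n *\<^sub>R v) (t n))"
    by (rule Bochner_Integration.integrable_bound[OF idom])
      (use bound[of 0] abs_diff_quot_le[OF lip] L in auto)
  have AEd: "AE x in lborel. (\<lambda>n. diff_quot f w x (t n)) \<longlonglongrightarrow> dir_deriv f w x"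
    using AE_dir_deriv[OF lip, of w] unfolding t_def by eventually_elim (rule diff_quot_sequence_tendsto)
  have lim: "AE x in lborel. (\<lambda>n. indicator (box a b) (x - t n *\<^sub>R v) * diff_quot f w x (t n))
       \<longlonglongrightarrow> indicator (box a b) x * dir_deriv f w x"
    using AEd AE_indicator_box_translate[of a b v] unfolding t_def
    by eventually_elim (intro tendsto_mult)
  have dc: "(\<lambda>x. indicator (box a b) x * dir_deriv f w x) \<in> borel_measurable lborel"
    "\<And>n. (\<lambda>x. indicator (box a b) (x - t n *\<^sub>R v) * diff_quot f w x (t n)) \<in> borel_measurable lborel"
    by measurable
  have bd: "AE x in lborel. norm (indicator (box a b) (x - t n *\<^sub>R v) * diff_quot f w x (t n)) \<le> ?dom x" for n
    using bound[OF t01 abs_diff_quot_le[OF lip]] by auto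
  show "integrable lborel (\<lambda>x. indicator (box a b) x * dir_deriv f w x)"
    by (rule integrable_dominated_convergence[OF dc idom lim bd])
  show "(\<lambda>n. \<integral>x. indicator (box a b) x * diff_quot f w (x + t n *\<^sub>R v) (t n) \<partial>lborel)
    \<longlonglongrightarrow> (\<integral>x. indicator (box a b) x * dir_deriv f w x \<partial>lborel)"
    unfolding shift by (rule integral_dominated_convergence[OF dc idom lim bd])
qed

lemma abs_dir_deriv_le:
  assumes lip: "L-lipschitz_on UNIV f" and "(diff_quot f v x \<longlongrightarrow> dir_deriv f v x) (at 0)"
  shows "\<bar>dir_deriv f v x\<bar> \<le> L * norm v"
  by (rule tendsto_upperbound[OF tendsto_rabs[OF assms(2)]]) (use abs_diff_quot_le[OF lip] in auto)

text \<open>The difference quotient in the direction \<open>v + w\<close> at \<open>x\<close> is the sum of the one in the direction \<open>w\<close> at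
  the translated point \<open>x + t v\<close> and of the one in the direction \<open>v\<close> at \<open>x\<close>; integrated over a box, the
  translation disappears in the limit.\<close>

lemma AE_dir_deriv_add:
  fixes f :: "'a::euclidean_space \<Rightarrow> real"
  assumes lip: "L-lipschitz_on UNIV f"
  shows "AE x in lborel. dir_deriv f (v + w) x = dir_deriv f v x + dir_deriv f w x"
proof -
  have cont: "continuous_on UNIV f" by (rule lipschitz_on_continuous_on[OF lip])
  note [measurable] = dir_deriv_measurable[OF cont]
  define C where "C = L * norm (v + w) + L * norm v + L * norm w"
  define g0 where "g0 x = dir_deriv f (v + w) x - dir_deriv f v x - dir_deriv f w x" for x
  \<comment> \<open>The box criterion asks for a bound everywhere, but \<open>g0\<close> is known to
    be bounded by \<open>C\<close> only almost everywhere.\<close>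
  define g where "g x = (if \<bar>g0 x\<bar> \<le> C then g0 x else 0)" for x
  have [measurable]: "g0 \<in> borel_measurable borel" unfolding g0_def by measurable
  have [measurable]: "g \<in> borel_measurable borel" unfolding g_def by measurable
  have g0g: "AE x in lborel. g0 x = g x"
    using AE_dir_deriv[OF lip, of "v + w"] AE_dir_deriv[OF lip, of v] AE_dir_deriv[OF lip, of w]
  proof eventually_elim
    fix x
    assume "(diff_quot f (v + w) x \<longlongrightarrow> dir_deriv f (v + w) x) (at 0)"
      "(diff_quot f v x \<longlongrightarrow> dir_deriv f v x) (at 0)" "(diff_quot f w x \<longlongrightarrow> dir_deriv f w x) (at 0)"
    note this[THEN abs_dir_deriv_le[OF lip]]
    then show "g0 x = g x" by (auto simp: g_def g0_def C_def)
  qed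
  have "AE x in lborel. g x = 0"
  proof (rule AE_eq_zero_if_integral_box_eq_zero)
    show "\<bar>g x\<bar> \<le> C" for x
      using lipschitz_on_nonneg[OF lip] by (auto simp: g_def C_def)
    fix a b :: 'a
    let ?I = "indicator (box a b) :: 'a \<Rightarrow> real"
    define t where "t n = inverse (real (Suc n))" for n
    have t: "t n \<noteq> 0" for n by (simp add: t_def)
    note [simp] = integral_diff_quot_translate_tendsto(2,3)[OF lip, folded t_def]
    note [simp] = integral_diff_quot_translate_tendsto(2)[OF lip, of _ _ _ _ 0, folded t_def, simplified]
    have "diff_quot f (v + w) x (t n) = diff_quot f w (x + t n *\<^sub>R v) (t n) + diff_quot f v x (t n)" for x n
      by (simp add: diff_quot_def scaleR_add_right add.assoc diff_divide_distrib)
    then have "(\<integral>x. ?I x * diff_quot f (v + w) x (t n) \<partial>lborel) =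
        (\<integral>x. ?I x * diff_quot f w (x + t n *\<^sub>R v) (t n) + ?I x * diff_quot f v x (t n) \<partial>lborel)" for n
      by (simp add: distrib_left)
    also have "\<dots> n = (\<integral>x. ?I x * diff_quot f w (x + t n *\<^sub>R v) (t n) \<partial>lborel) +
        (\<integral>x. ?I x * diff_quot f v x (t n) \<partial>lborel)" for n
      by (rule Bochner_Integration.integral_add) simp_all
    finally have eq: "(\<integral>x. ?I x * diff_quot f (v + w) x (t n) \<partial>lborel) =
      (\<integral>x. ?I x * diff_quot f w (x + t n *\<^sub>R v) (t n) \<partial>lborel) + (\<integral>x. ?I x * diff_quot f v x (t n) \<partial>lborel)" for n .
    have l1: "(\<lambda>n. \<integral>x. ?I x * diff_quot f u x (t n) \<partial>lborel) \<longlonglongrightarrow> (\<integral>x. ?I x * dir_deriv f u x \<partial>lborel)" for u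
      using integral_diff_quot_translate_tendsto(1)[OF lip, of a b u 0] by (simp add: t_def)
    have l2: "(\<lambda>n. (\<integral>x. ?I x * diff_quot f w (x + t n *\<^sub>R v) (t n) \<partial>lborel) + (\<integral>x. ?I x * diff_quot f v x (t n) \<partial>lborel))
       \<longlonglongrightarrow> (\<integral>x. ?I x * dir_deriv f w x \<partial>lborel) + (\<integral>x. ?I x * dir_deriv f v x \<partial>lborel)"
      using integral_diff_quot_translate_tendsto(1)[OF lip, of a b w v] by (intro tendsto_add l1) (simp add: t_def)
    have "(\<integral>x. ?I x * dir_deriv f (v + w) x \<partial>lborel) =
       (\<integral>x. ?I x * dir_deriv f w x \<partial>lborel) + (\<integral>x. ?I x * dir_deriv f v x \<partial>lborel)"
      by (rule LIMSEQ_unique[OF l1]) (use l2 in \<open>simp add: eq\<close>)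
    moreover have "(\<integral>x. ?I x * g0 x \<partial>lborel) = (\<integral>x. ?I x * dir_deriv f (v + w) x \<partial>lborel)
       - (\<integral>x. ?I x * dir_deriv f v x \<partial>lborel) - (\<integral>x. ?I x * dir_deriv f w x \<partial>lborel)"
      unfolding g0_def right_diff_distrib by (simp add: Bochner_Integration.integral_diff)
    moreover have "(\<integral>x. ?I x * g x \<partial>lborel) = (\<integral>x. ?I x * g0 x \<partial>lborel)"
      by (rule integral_cong_AE) (use g0g in auto)
    ultimately show "(\<integral>x. ?I x * g x \<partial>lborel) = 0" by simp
  qed simp
  with g0g show ?thesis by eventually_elim (simp add: g0_def)
qed

lemma diff_quot_tendsto_scaleR:
  assumes "(diff_quot f v x \<longlongrightarrow> l) (at 0)"
  shows "(diff_quot f (c *\<^sub>R v) x \<longlongrightarrow> c * l) (at 0)"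
proof (cases "c = 0")
  case True
  then show ?thesis by (simp add: diff_quot_def[abs_def])
next
  case False
  have "filterlim (\<lambda>t::real. t * c) (at 0) (at 0)"
    using False by (auto simp: filterlim_at eventually_at_filter intro!: tendsto_eq_intros)
  then have "((\<lambda>t. c * diff_quot f v x (t * c)) \<longlongrightarrow> c * l) (at 0)"
    by (intro tendsto_mult tendsto_const filterlim_compose[OF assms])
  moreover have "c * diff_quot f v x (t * c) = diff_quot f (c *\<^sub>R v) x t" for t
    using False by (simp add: diff_quot_def)
  ultimately show ?thesis by simp
qed

text \<open>Additivity holds almost everywhere for each of the finitely many partial sums of the
  basis expansion. The right-hand side is linear in \<open>v\<close> at every \<open>x\<close>,
  which lets one null set serve countably many directions afterwards.\<close>

lemma AE_diff_quot_linear: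
  fixes f :: "'a::euclidean_space \<Rightarrow> real"
  assumes lip: "L-lipschitz_on UNIV f"
  shows "AE x in lborel. (diff_quot f v x \<longlongrightarrow> (\<Sum>b\<in>Basis. (v \<bullet> b) * dir_deriv f b x)) (at 0)"
proof -
  have "AE x in lborel. (diff_quot f (\<Sum>b\<in>B. (v \<bullet> b) *\<^sub>R b) x \<longlongrightarrow> (\<Sum>b\<in>B. (v \<bullet> b) * dir_deriv f b x)) (at 0)"
    if "finite B" for B :: "'a set"
    using that
  proof induction
    case empty
    then show ?case by (simp add: diff_quot_def[abs_def])
  next
    case (insert b B)
    let ?u = "\<Sum>b\<in>B. (v \<bullet> b) *\<^sub>R b" and ?w = "(v \<bullet> b) *\<^sub>R b"
    show ?case
      using insert.IH AE_dir_deriv[OF lip, of b] AE_dir_deriv[OF lip, of "?w + ?u"] AE_dir_deriv_add[OF lip, of ?w ?u]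
    proof eventually_elim
      fix x
      assume 1: "(diff_quot f ?u x \<longlongrightarrow> (\<Sum>b\<in>B. (v \<bullet> b) * dir_deriv f b x)) (at 0)"
        and 2: "(diff_quot f b x \<longlongrightarrow> dir_deriv f b x) (at 0)"
        and 3: "(diff_quot f (?w + ?u) x \<longlongrightarrow> dir_deriv f (?w + ?u) x) (at 0)"
        and 4: "dir_deriv f (?w + ?u) x = dir_deriv f ?w x + dir_deriv f ?u x"
      show "(diff_quot f (\<Sum>b\<in>insert b B. (v \<bullet> b) *\<^sub>R b) x \<longlongrightarrow> (\<Sum>b\<in>insert b B. (v \<bullet> b) * dir_deriv f b x)) (at 0)"
        using 3 insert.hyps dir_deriv_eqI[OF 1] dir_deriv_eqI[OF diff_quot_tendsto_scaleR[OF 2]] by (simp add: 4)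
    qed
  qed
  from this[OF finite_Basis] show ?thesis by (simp add: euclidean_representation)
qed

text \<open>Outside one null set the directional limits exist, and are linear, along a countable
  dense set of directions. Finitely many of these form a net of the unit ball, which makes the limit
  uniform over the net; the Lipschitz bound carries it to all directions.\<close>

theorem rademacher:
  fixes f :: "'a::euclidean_space \<Rightarrow> real"
  assumes lip: "L-lipschitz_on UNIV f"
  shows "AE x in lborel. f differentiable (at x)"
proof -
  obtain D :: "'a set" where D: "countable D" "\<And>X. open X \<Longrightarrow> X \<noteq> {} \<Longrightarrow> \<exists>d\<in>D. d \<in> X"
    using countable_dense_setE by metis
  have "AE x in lborel. \<forall>v\<in>D. (diff_quot f v x \<longlongrightarrow> (\<Sum>b\<in>Basis. (v \<bullet> b) * dir_deriv f b x)) (at 0)"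
    using AE_diff_quot_linear[OF lip] by (subst AE_ball_countable[OF D(1)]) auto
  then show ?thesis
  proof eventually_elim
    fix x
    assume lim: "\<forall>v\<in>D. (diff_quot f v x \<longlongrightarrow> (\<Sum>b\<in>Basis. (v \<bullet> b) * dir_deriv f b x)) (at 0)"
    define A where "A v = (\<Sum>b\<in>Basis. (v \<bullet> b) * dir_deriv f b x)" for v
    have linA: "linear A"
      by (rule linearI) (auto simp: A_def inner_add_left distrib_right sum.distrib sum_distrib_left mult.assoc)
    obtain M where M: "M > 0" "\<And>v. \<bar>A v\<bar> \<le> M * norm v"
      using linear_bounded_pos[OF linA] by auto
    have L: "0 \<le> L" using lip by (rule lipschitz_on_nonneg)
    have "(f has_derivative A) (at x)"
      unfolding has_derivative_at_alt
    proof (intro conjI allI impI)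
      show "bounded_linear A" using linA linear_conv_bounded_linear by blast
      fix e :: real assume e: "e > 0"
      \<comment> \<open>Replacing a unit direction by a net point at distance \<open>d\<close> costs
        \<open>L * d\<close> in \<open>f\<close> and \<open>M * d\<close> in \<open>A\<close>,
        together \<open>e / 2\<close>.\<close>
      define d where "d = e / (2 * (L + M))"
      have d: "d > 0" "(L + M) * d = e / 2" using e L M(1) by (auto simp: d_def field_simps)
      have "compact (cball (0::'a) 1)" by simp
      moreover have "cball 0 1 \<subseteq> (\<Union>v\<in>D. ball v d)"
      proof
        fix u :: 'a
        obtain v where "v \<in> D" "v \<in> ball u d" using D(2)[of "ball u d"] d by auto
        then show "u \<in> (\<Union>v\<in>D. ball v d)" by (auto simp: dist_commute)
      qed
      ultimately obtain C where C: "C \<subseteq> D" "finite C" "cball 0 1 \<subseteq> (\<Union>v\<in>C. ball v d)"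
        using compactE_image[of "cball (0::'a) 1" D "\<lambda>v. ball v d"] by auto
      have "\<forall>\<^sub>F t in at 0. \<forall>v\<in>C. dist (diff_quot f v x t) (A v) < e / 2"
        using lim C(1) e unfolding A_def
        by (intro eventually_ball_finite C(2) ballI tendstoD) auto
      then obtain r where r: "r > 0" "\<And>t v. t \<noteq> 0 \<Longrightarrow> \<bar>t\<bar> < r \<Longrightarrow> v \<in> C \<Longrightarrow> \<bar>diff_quot f v x t - A v\<bar> < e / 2"
        unfolding eventually_at by (auto simp: dist_real_def)
      show "\<exists>d>0. \<forall>y. norm (y - x) < d \<longrightarrow> norm (f y - f x - A (y - x)) \<le> e * norm (y - x)"
      proof (intro exI[of _ r] conjI allI impI r(1))
        fix y assume y: "norm (y - x) < r"
        show "norm (f y - f x - A (y - x)) \<le> e * norm (y - x)"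
        proof (cases "y = x")
          case True
          then show ?thesis using linear_0[OF linA] by simp
        next
          case False
          define t where "t = norm (y - x)"
          define u where "u = (1 / t) *\<^sub>R (y - x)"
          have t: "t > 0" "t < r" using False y by (auto simp: t_def)
          have yx: "y = x + t *\<^sub>R u" using t by (simp add: u_def)
          have "u \<in> cball 0 1" using t by (simp add: u_def t_def)
          then obtain v where v: "v \<in> C" "norm (u - v) < d" using C(3) by (auto simp: dist_norm norm_minus_commute)
          have 1: "\<bar>f y - f (x + t *\<^sub>R v)\<bar> \<le> L * (t * d)"
          proof -
            have "\<bar>f y - f (x + t *\<^sub>R v)\<bar> \<le> L * norm (t *\<^sub>R (u - v))"
              using lipschitz_onD[OF lip, of y "x + t *\<^sub>R v"] by (simp add: yx dist_norm algebra_simps)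
            also have "\<dots> \<le> L * (t * d)" using v t L by (intro mult_left_mono) auto
            finally show ?thesis .
          qed
          have 2: "\<bar>f (x + t *\<^sub>R v) - f x - t * A v\<bar> \<le> t * (e / 2)"
          proof -
            have "f (x + t *\<^sub>R v) - f x - t * A v = t * (diff_quot f v x t - A v)"
              using t by (simp add: diff_quot_def field_simps)
            then show ?thesis using r(2)[of t v] t v by (simp add: abs_mult)
          qed
          have 3: "\<bar>t * A v - A (y - x)\<bar> \<le> M * (t * d)"
          proof -
            have "t * A v - A (y - x) = A (t *\<^sub>R (v - u))"
              using linA by (simp add: yx linear_diff linear_scale right_diff_distrib scaleR_diff_right)
            also have "\<bar>\<dots>\<bar> \<le> M * norm (t *\<^sub>R (v - u))" by (rule M(2))
            also have "\<dots> \<le> M * (t * d)" using v t M by (intro mult_left_mono) (auto simp: norm_minus_commute)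
            finally show ?thesis .
          qed
          have "\<bar>f y - f x - A (y - x)\<bar> \<le> L * (t * d) + t * (e / 2) + M * (t * d)"
            using 1 2 3 by linarith
          also have "\<dots> = t * ((L + M) * d + e / 2)" by (simp add: algebra_simps)
          also have "\<dots> = e * norm (y - x)" using d by (simp add: t_def)
          finally show ?thesis by simp
        qed
      qed
    qed
    then show "f differentiable (at x)" unfolding differentiable_def by blast
  qed
qed

section \<open>Jensen's lemma\<close>

definition subgradient :: "('a::real_inner \<Rightarrow> real) \<Rightarrow> 'a \<Rightarrow> 'a \<Rightarrow> bool" where
  "subgradient f x q \<longleftrightarrow> (\<forall>z. f x + q \<bullet> (z - x) \<le> f z)"

lemma subgradientD: "subgradient f x q \<Longrightarrow> f x + q \<bullet> (z - x) \<le> f z"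
  by (simp add: subgradient_def)

section \<open>Convex functions on the whole space and their resolvents\<close>

lemma quadratic_dominates:
  fixes a b c :: real
  assumes "a > 0"
  obtains R where "R \<ge> 1" "\<And>n. n \<ge> R \<Longrightarrow> b * n + c \<le> a * n\<^sup>2"
proof
  let ?R = "max 1 ((\<bar>b\<bar> + \<bar>c\<bar>) / a)"
  show "?R \<ge> 1" by simp
  fix n assume n: "n \<ge> ?R"
  then have n1: "n \<ge> 1" "\<bar>b\<bar> + \<bar>c\<bar> \<le> a * n" using assms by (auto simp: field_simps)
  have "b * n + c \<le> \<bar>b\<bar> * n + \<bar>c\<bar> * n"
    using n1 by (intro add_mono mult_right_mono) (auto intro: order_trans[of _ "\<bar>c\<bar>"] simp: mult_le_cancel_left1)
  also have "\<dots> = (\<bar>b\<bar> + \<bar>c\<bar>) * n" by (simp add: distrib_right)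
  also have "\<dots> \<le> (a * n) * n" using n1 by (intro mult_right_mono) auto
  finally show "b * n + c \<le> a * n\<^sup>2" by (simp add: power2_eq_square)
qed

lemma attains_inf_of_coercive:
  fixes g :: "'a::euclidean_space \<Rightarrow> real"
  assumes cont: "continuous_on UNIV g" and R: "R \<ge> 0" "\<And>z. norm z \<ge> R \<Longrightarrow> g 0 \<le> g z"
  obtains x where "\<And>z. g x \<le> g z"
proof -
  have "\<exists>x\<in>cball 0 R. \<forall>z\<in>cball 0 R. g x \<le> g z"
    by (rule continuous_attains_inf) (use R continuous_on_subset[OF cont] in auto)
  then obtain x where x: "\<And>z. norm z \<le> R \<Longrightarrow> g x \<le> g z" by (metis mem_cball_0)
  have "g x \<le> g z" for z
    using x[of z] x[of 0] R(2)[of z] R(1) by (cases "norm z \<le> R") (auto intro: order_trans)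
  then show thesis by (rule that)
qed

text \<open>Beyond the unit ball, z/|z| lies on the segment from 0 to \<open>z\<close>. As
  \<open>f\<close> is bounded below on the ball, convexity prevents it from falling faster than
  linearly.\<close>

lemma convex_on_linear_lower_bound:
  fixes f :: "'a::euclidean_space \<Rightarrow> real"
  assumes f: "convex_on UNIV f"
  obtains c where "c \<ge> 0" "\<And>z. - c * (1 + norm z) \<le> f z"
proof -
  have cont: "continuous_on UNIV f" by (rule convex_on_continuous[OF open_UNIV f])
  have "\<exists>x\<in>cball 0 1. \<forall>z\<in>cball 0 1. f x \<le> f z"
    by (rule continuous_attains_inf) (use continuous_on_subset[OF cont] in auto)
  then obtain m where m: "\<And>z. norm z \<le> 1 \<Longrightarrow> m \<le> f z" by (metis mem_cball_0)
  define c where "c = \<bar>m\<bar> + \<bar>f 0\<bar>"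
  have "- c * (1 + norm z) \<le> f z" for z
  proof (cases "norm z \<le> 1")
    case True
    have "0 \<le> \<bar>m\<bar> * norm z" "0 \<le> \<bar>f 0\<bar> * norm z" "0 \<le> \<bar>f 0\<bar>" "- \<bar>m\<bar> \<le> m" by auto
    moreover have "- c * (1 + norm z) = - \<bar>m\<bar> - \<bar>f 0\<bar> - \<bar>m\<bar> * norm z - \<bar>f 0\<bar> * norm z"
      by (simp add: c_def algebra_simps)
    ultimately show ?thesis using m[OF True] by linarith
  next
    case False
    define n where "n = norm z"
    have n: "n > 1" using False by (simp add: n_def)
    have "f ((1 - 1/n) *\<^sub>R 0 + (1/n) *\<^sub>R z) \<le> (1 - 1/n) * f 0 + (1/n) * f z"
      by (rule convex_onD[OF f]) (use n in auto)
    moreover have "m \<le> f ((1 - 1/n) *\<^sub>R 0 + (1/n) *\<^sub>R z)" by (rule m) (use n in \<open>simp add: n_def\<close>)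
    ultimately have "m \<le> (1 - 1/n) * f 0 + (1/n) * f z" by simp
    then have "n * m \<le> n * ((1 - 1/n) * f 0 + (1/n) * f z)" using n by (intro mult_left_mono) auto
    also have "\<dots> = (n - 1) * f 0 + f z" using n by (simp add: field_simps)
    finally have 1: "n * m - (n - 1) * f 0 \<le> f z" by simp
    have 2: "- (n * \<bar>m\<bar>) \<le> n * m" using mult_left_mono[of "- \<bar>m\<bar>" m n] n by auto
    have "(n - 1) * f 0 \<le> (n - 1) * \<bar>f 0\<bar>" using n by (intro mult_left_mono) auto
    also have "\<dots> \<le> n * \<bar>f 0\<bar>" by (intro mult_right_mono) auto
    finally have "(n - 1) * f 0 \<le> n * \<bar>f 0\<bar>" .
    with 1 2 have "- (n * c) \<le> f z" by (simp add: c_def algebra_simps)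
    moreover have "0 \<le> c" by (simp add: c_def)
    ultimately show ?thesis by (simp add: n_def algebra_simps)
  qed
  then show thesis using that[of c] by (simp add: c_def)
qed

lemma norm_add_scaleR_power2:
  "(norm (d + t *\<^sub>R k))\<^sup>2 = (norm d)\<^sup>2 + 2 * t * (d \<bullet> k) + t\<^sup>2 * (norm k)\<^sup>2"
  unfolding power2_norm_eq_inner by (simp add: inner_add inner_commute power2_eq_square algebra_simps)

text \<open>The point is a minimiser of f + |. - y|^2/2. Comparing it with
  \<open>x + t *\<^sub>R (z - x)\<close>, dividing by \<open>t\<close> and letting \<open>t\<close>
  tend to 0 gives the subgradient inequality.\<close>

lemma resolvent_exists:
  fixes f :: "'a::euclidean_space \<Rightarrow> real" and y :: 'a
  assumes f: "convex_on UNIV f"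
  shows "\<exists>x. subgradient f x (y - x)"
proof -
  have cont: "continuous_on UNIV f" by (rule convex_on_continuous[OF open_UNIV f])
  obtain c where c: "c \<ge> 0" "\<And>z. - c * (1 + norm z) \<le> f z" by (rule convex_on_linear_lower_bound[OF f]) blast
  define g where "g z = f z + (norm (z - y))\<^sup>2 / 2" for z
  obtain R where R: "R \<ge> 1" "\<And>n. n \<ge> R \<Longrightarrow> (c + norm y) * n + (g 0 + c) \<le> 1/2 * n\<^sup>2"
    by (rule quadratic_dominates[of "1/2" "c + norm y" "g 0 + c"]) auto
  obtain x where x: "\<And>z. g x \<le> g z"
  proof (rule attains_inf_of_coercive[of g R])
    show "continuous_on UNIV g" unfolding g_def by (intro continuous_intros cont) auto
    fix z :: 'a assume z: "norm z \<ge> R"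
    have "(norm z)\<^sup>2 - 2 * (norm y * norm z) \<le> (norm (z - y))\<^sup>2"
    proof -
      have "(norm (z - y))\<^sup>2 = (norm z)\<^sup>2 - 2 * (z \<bullet> y) + y \<bullet> y"
        by (simp add: power2_norm_eq_inner inner_diff inner_commute)
      then show ?thesis using norm_cauchy_schwarz[of z y] inner_ge_zero[of y] by (simp only: mult.commute[of "norm y"])
    qed
    then show "g 0 \<le> g z" using R(2)[OF z] c(2)[of z] by (simp add: g_def algebra_simps)
  qed (use R in auto)
  have "f x + (y - x) \<bullet> (z - x) \<le> f z" for z
  proof (rule field_le_epsilon)
    fix e :: real assume e: "e > 0"
    \<comment> \<open>Small enough for the quadratic term that survives division by \<open>t\<close>
      to stay below \<open>e\<close>.\<close>
    define t where "t = min 1 (e / ((norm (z - x))\<^sup>2 + 1))"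
    have t: "0 < t" "t \<le> 1" using e by (auto simp: t_def add_nonneg_pos)
    have "t * (norm (z - x))\<^sup>2 \<le> e / ((norm (z - x))\<^sup>2 + 1) * (norm (z - x))\<^sup>2"
      by (intro mult_right_mono) (auto simp: t_def)
    also have "\<dots> \<le> e"
      using e by (simp add: divide_le_eq add_nonneg_pos)
    finally have te: "t * (norm (z - x))\<^sup>2 \<le> e" .
    have "g x \<le> g (x + t *\<^sub>R (z - x))" by (rule x)
    moreover have "f (x + t *\<^sub>R (z - x)) \<le> (1 - t) * f x + t * f z"
      using convex_onD[OF f, of t x z] t by (simp add: algebra_simps)
    moreover have "(norm (x + t *\<^sub>R (z - x) - y))\<^sup>2 = (norm (x - y))\<^sup>2 + 2 * t * ((x - y) \<bullet> (z - x)) + t\<^sup>2 * (norm (z - x))\<^sup>2"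
      using norm_add_scaleR_power2[of "x - y" t "z - x"] by (simp add: algebra_simps)
    ultimately have "0 \<le> t * (f z - f x) + t * ((x - y) \<bullet> (z - x)) + t\<^sup>2 * (norm (z - x))\<^sup>2 / 2"
      by (simp add: g_def algebra_simps)
    also have "\<dots> = t * (f z - f x + (x - y) \<bullet> (z - x) + t * (norm (z - x))\<^sup>2 / 2)"
      by (simp add: algebra_simps power2_eq_square)
    finally have "0 \<le> f z - f x + (x - y) \<bullet> (z - x) + t * (norm (z - x))\<^sup>2 / 2"
      using t by (simp add: zero_le_mult_iff)
    then show "f x + (y - x) \<bullet> (z - x) \<le> f z + e" using te e by (simp add: inner_diff algebra_simps)
  qed
  then show ?thesis by (auto simp: subgradient_def)
qed

text \<open>Adding the two subgradient inequalities shows that subgradients are monotone;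
  Cauchy-Schwarz does the rest. In particular \<open>x + q\<close> determines \<open>x\<close>, so
  the resolvent is single-valued.\<close>

lemma subgradient_nonexpansive:
  assumes "subgradient f x q" "subgradient f x' q'"
  shows "norm (x - x') \<le> norm ((x + q) - (x' + q'))"
proof -
  have mono: "0 \<le> (q - q') \<bullet> (x - x')"
    using subgradientD[OF assms(1), of x'] subgradientD[OF assms(2), of x] by (simp add: inner_diff algebra_simps)
  have "(norm (x - x'))\<^sup>2 \<le> ((x + q) - (x' + q')) \<bullet> (x - x')"
    using mono by (simp add: power2_norm_eq_inner inner_diff inner_add algebra_simps)
  also have "\<dots> \<le> norm ((x + q) - (x' + q')) * norm (x - x')" by (rule norm_cauchy_schwarz)
  finally show ?thesis by (cases "x = x'") (auto simp: power2_eq_square)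
qed

lemma AE_lipschitz_differentiable:
  fixes J :: "'a::euclidean_space \<Rightarrow> 'b::euclidean_space"
  assumes lip: "L-lipschitz_on UNIV J"
  shows "AE y in lborel. J differentiable (at y)"
proof -
  have "AE y in lborel. \<forall>b\<in>Basis. (\<lambda>y. J y \<bullet> b) differentiable (at y)"
  proof (subst AE_ball_countable, simp add: countable_finite, rule ballI)
    fix b :: 'b assume b: "b \<in> Basis"
    have "L-lipschitz_on UNIV (\<lambda>y. J y \<bullet> b)"
    proof (rule lipschitz_onI)
      fix x y
      have "dist (J x \<bullet> b) (J y \<bullet> b) = \<bar>(J x - J y) \<bullet> b\<bar>" by (simp add: dist_real_def inner_diff_left)
      also have "\<dots> \<le> norm (J x - J y)" using b by (rule Basis_le_norm)
      also have "\<dots> \<le> L * dist x y" using lipschitz_onD[OF lip, of x y] by (simp add: dist_norm)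
      finally show "dist (J x \<bullet> b) (J y \<bullet> b) \<le> L * dist x y" .
    qed (use lipschitz_on_nonneg[OF lip] in simp)
    then show "AE y in lborel. (\<lambda>y. J y \<bullet> b) differentiable (at y)" by (rule rademacher)
  qed
  then show ?thesis by (subst differentiable_componentwise_within) simp
qed

text \<open>Extrapolation backwards: with k = z - x, the point \<open>x\<close> lies between x - t k
  and \<open>z\<close>, so convexity bounds \<open>f z\<close> from below by values that the
  paraboloid controls at x - t k. The quadratic error is of order t^2 and vanishes after division by
  \<open>t\<close>.\<close>

lemma subgradient_of_touching:
  assumes f: "convex_on UNIV f" and touch: "\<And>h. f (x + h) \<le> f x + q \<bullet> h + C / 2 * (norm h)\<^sup>2"
  shows "subgradient f x q"
  unfolding subgradient_def
proof
  fix z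
  define k where "k = z - x"
  have z: "z = x + k" by (simp add: k_def)
  show "f x + q \<bullet> (z - x) \<le> f z"
  proof (rule field_le_epsilon)
    fix e :: real assume e: "e > 0"
    define t where "t = e / (\<bar>C / 2 * (norm k)\<^sup>2\<bar> + 1)"
    have t: "t > 0" using e by (simp add: t_def add_nonneg_pos)
    have "t * (C / 2 * (norm k)\<^sup>2) \<le> t * (\<bar>C / 2 * (norm k)\<^sup>2\<bar> + 1)" using t by (intro mult_left_mono) auto
    also have "\<dots> = e" by (simp add: t_def)
    finally have te: "t * (C / 2 * (norm k)\<^sup>2) \<le> e" .
    have "x = (1 - t / (1 + t)) *\<^sub>R (x + (- t) *\<^sub>R k) + (t / (1 + t)) *\<^sub>R z"
    proof -
      have "(1 - t / (1 + t)) = 1 / (1 + t)" using t by (simp add: field_simps)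
      then have "(1 - t / (1 + t)) *\<^sub>R (x + (- t) *\<^sub>R k) + (t / (1 + t)) *\<^sub>R z = (1 / (1 + t)) *\<^sub>R ((x - t *\<^sub>R k) + t *\<^sub>R (x + k))"
        by (simp add: z scaleR_add_right scaleR_diff_right)
      also have "\<dots> = (1 / (1 + t)) *\<^sub>R ((1 + t) *\<^sub>R x)" by (simp add: algebra_simps)
      also have "\<dots> = x" using t by simp
      finally show ?thesis by simp
    qed
    then have "f x \<le> (1 - t / (1 + t)) * f (x + (- t) *\<^sub>R k) + (t / (1 + t)) * f z"
      using convex_onD[OF f, of "t / (1 + t)" "x + (- t) *\<^sub>R k" z] t by simp
    then have "(1 + t) * f x \<le> (1 + t) * ((1 - t / (1 + t)) * f (x + (- t) *\<^sub>R k) + (t / (1 + t)) * f z)"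
      using t by (intro mult_left_mono) auto
    also have "\<dots> = f (x + (- t) *\<^sub>R k) + t * f z"
    proof -
      have "(1 + t) * (1 - t / (1 + t)) = 1" "(1 + t) * (t / (1 + t)) = t" using t by (simp_all add: field_simps)
      then show ?thesis by (simp only: distrib_left mult.assoc[symmetric] mult_1_left)
    qed
    also have "\<dots> \<le> f x - t * (q \<bullet> k) + t * (t * (C / 2 * (norm k)\<^sup>2)) + t * f z"
      using touch[of "(- t) *\<^sub>R k"] by (simp add: power_mult_distrib power2_eq_square mult_ac)
    also have "\<dots> \<le> f x - t * (q \<bullet> k) + t * e + t * f z" using te t by (intro add_mono mult_left_mono) auto
    finally have "t * (f x + q \<bullet> k) \<le> t * (f z + e)" by (simp add: algebra_simps)
    then show "f x + q \<bullet> (z - x) \<le> f z + e" using t by (simp add: k_def)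
  qed
qed

text \<open>Start at \<open>x + h\<close> and move by \<open>k\<close>, of length \<open>s\<close>,
  in the direction of \<open>q' - q\<close>: the subgradient inequality forces \<open>f\<close>
  above its tangent at \<open>x\<close> by \<open>s * n\<close>, while the paraboloid allows at most
  C/2 (|h| + s)^2. The choice s = |h| gives the factor 2.\<close>

lemma subgradient_near_touching:
  assumes f: "subgradient f x q" and touch: "\<And>h. f (x + h) \<le> f x + q \<bullet> h + C / 2 * (norm h)\<^sup>2" and C: "C \<ge> 0"
    and q': "subgradient f (x + h) q'"
  shows "norm (q' - q) \<le> 2 * C * norm h"
proof (cases "q' = q")
  case False
  define n where "n = norm (q' - q)"
  have n: "n > 0" using False by (simp add: n_def)
  have main: "s * n \<le> C / 2 * (norm h + s)\<^sup>2" if s: "s > 0" for s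
  proof -
    define k where "k = (s / n) *\<^sub>R (q' - q)"
    have nk: "norm k = s" using n s by (simp add: k_def n_def)
    have ip: "(q' - q) \<bullet> k = s * n" using n by (simp add: k_def power2_norm_eq_inner[symmetric] n_def power2_eq_square)
    have "f x + q \<bullet> h \<le> f (x + h)" using subgradientD[OF f, of "x + h"] by simp
    moreover have "f (x + h) + q' \<bullet> k \<le> f (x + (h + k))" using subgradientD[OF q', of "x + (h + k)"] by (simp add: add.assoc[symmetric])
    ultimately have "(q' - q) \<bullet> k \<le> C / 2 * (norm (h + k))\<^sup>2"
      using touch[of "h + k"] by (simp add: inner_diff inner_add algebra_simps)
    also have "\<dots> \<le> C / 2 * (norm h + s)\<^sup>2"
      using C norm_triangle_ineq[of h k] nk by (intro mult_left_mono power_mono) auto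
    finally show ?thesis by (simp add: ip)
  qed
  show ?thesis
  proof (cases "h = 0")
    case False
    then have "norm h * n \<le> norm h * (2 * C * norm h)" using main[of "norm h"] by (simp add: power2_eq_square algebra_simps)
    then show ?thesis using False by (simp add: n_def)
  next
    \<comment> \<open>For \<open>h = 0\<close> a step of length |h| says nothing. A step
      proportional to \<open>n\<close> contradicts \<open>n > 0\<close>, so the subgradient at
      \<open>x\<close> is unique.\<close>
    case True
    have C1: "C + 1 \<noteq> 0" using C by linarith
    have "n / (C + 1) * n \<le> C / 2 * (n / (C + 1))\<^sup>2" using main[of "n / (C + 1)"] n C True by simp
    also have "\<dots> = (n / (C + 1) * n) * (C / (2 * (C + 1)))" using C1 by (simp add: power2_eq_square field_simps)
    finally have "1 \<le> C / (2 * (C + 1))" using n C mult_le_cancel_left1[of "n / (C + 1) * n" "C / (2 * (C + 1))"] by simp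
    then show ?thesis using C by (simp add: field_simps)
  qed
qed (use C in simp)

text \<open>Over \<open>N\<close> equal steps the linear terms add up to \<open>K\<close> and the
  quadratic ones to \<open>M / N\<close>. This replaces integrating a derivative along a segment
  when only subgradients are at hand.\<close>

lemma abs_diff_le_of_quadratic_increments:
  fixes g :: "real \<Rightarrow> real"
  assumes inc: "\<And>s t. s \<in> {0..1} \<Longrightarrow> t \<in> {0..1} \<Longrightarrow> g t \<le> g s + K * \<bar>s - t\<bar> + M * (s - t)\<^sup>2"
  shows "\<bar>g 1 - g 0\<bar> \<le> K"
proof (rule field_le_epsilon)
  fix e :: real assume e: "e > 0"
  obtain N :: nat where N: "N > 0" "\<bar>M\<bar> / N < e"
  proof -
    obtain N :: nat where "\<bar>M\<bar> / e < N" using reals_Archimedean2 by blast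
    then show thesis using that[of "Suc N"] e by (auto simp: field_simps)
  qed
  have step: "\<bar>g (real (Suc i) / N) - g (real i / N)\<bar> \<le> K / N + M / (real N)\<^sup>2" if "i < N" for i
  proof -
    have m: "real (Suc i) / N \<in> {0..1}" "real i / N \<in> {0..1}" using that by auto
    have d: "real (Suc i) / N - real i / N = 1 / N" by (simp add: diff_divide_distrib[symmetric])
    have d': "real i / N - real (Suc i) / N = - (1 / N)" by (simp add: diff_divide_distrib[symmetric])
    show ?thesis using inc[OF m] inc[OF m(2,1)] N(1) unfolding d d' by (simp add: power_divide abs_le_iff)
  qed
  have "\<bar>g 1 - g 0\<bar> = \<bar>\<Sum>i<N. g (real (Suc i) / N) - g (real i / N)\<bar>"
    using N(1) by (subst sum_lessThan_telescope) simp
  also have "\<dots> \<le> (\<Sum>i<N. \<bar>g (real (Suc i) / N) - g (real i / N)\<bar>)" by (rule sum_abs)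
  also have "\<dots> \<le> (\<Sum>i<N. K / N + M / (real N)\<^sup>2)" by (intro sum_mono step) auto
  also have "\<dots> = K + M / N" using N(1) by (simp add: field_simps power2_eq_square)
  also have "\<dots> \<le> K + \<bar>M\<bar> / N" using N(1) by (simp add: divide_right_mono)
  finally show "\<bar>g 1 - g 0\<bar> \<le> K + e" using N(2) by simp
qed

text \<open>A kernel vector \<open>v\<close> would make \<open>J\<close> move y0 + t v by only o(t),
  against the lower bound on its displacement.\<close>

lemma inj_derivative_of_expanding:
  fixes J :: "'a::euclidean_space \<Rightarrow> 'a"
  assumes A: "(J has_derivative A) (at y0)" and exp: "\<And>y. norm (y - y0) \<le> c * norm (J y - J y0)"
    and c: "c \<ge> 0"
  shows "inj A"
proof -
  have linA: "linear A" using A by (rule has_derivative_linear)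
  have "v = 0" if Av: "A v = 0" for v
  proof (rule ccontr)
    assume v: "v \<noteq> 0"
    define e where "e = 1 / (2 * (c + 1))"
    have e: "e > 0" "c * e < 1" using c by (auto simp: e_def field_simps)
    obtain d where d: "d > 0" "\<And>y. norm (y - y0) < d \<Longrightarrow> norm (J y - J y0 - A (y - y0)) \<le> e * norm (y - y0)"
      using A e(1) unfolding has_derivative_at_alt by metis
    define t where "t = d / (2 * norm v)"
    have t: "t > 0" "t * norm v < d" using d(1) v by (auto simp: t_def)
    have "norm (J (y0 + t *\<^sub>R v) - J y0) \<le> e * (t * norm v)"
      using d(2)[of "y0 + t *\<^sub>R v"] t linA by (simp add: linear_scale Av)
    then have "t * norm v \<le> c * (e * (t * norm v))"
      using exp[of "y0 + t *\<^sub>R v"] t c by (simp add: order_trans[OF _ mult_left_mono])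
    also have "\<dots> = (c * e) * (t * norm v)" by simp
    also have "\<dots> < 1 * (t * norm v)" using e t v by (intro mult_strict_right_mono) auto
    finally show False by simp
  qed
  then show ?thesis using linA by (simp add: linear_injective_0)
qed

text \<open>If \<open>p\<close> is a subgradient at \<open>x + h\<close>, then \<open>J\<close>
  sends \<open>x + h + p\<close> to \<open>x + h\<close>. Inverting the derivative \<open>A\<close>
  of \<open>J\<close> at \<open>x + q\<close> therefore expands the subgradients to first order, p =
  q + B h + o(|h|), with \<open>B\<close> the inverse of \<open>A\<close> minus the identity.
  Summation along the segment turns this into the expansion of \<open>f\<close>.\<close>

lemma second_order_expansion_at_touching_point:
  fixes f :: "'a::euclidean_space \<Rightarrow> real" and J :: "'a \<Rightarrow> 'a"
  assumes f: "convex_on UNIV f"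
    and J: "\<And>y. subgradient f (J y) (y - J y)"
    and Jy0: "J (x + q) = x" and diff: "J differentiable (at (x + q))"
    and touch: "\<And>h. f (x + h) \<le> f x + q \<bullet> h + C / 2 * (norm h)\<^sup>2" and C: "C \<ge> 0"
  obtains B where "linear B"
    "\<And>e. e > 0 \<Longrightarrow> \<exists>d>0. \<forall>h. norm h < d \<longrightarrow> \<bar>f (x + h) - f x - q \<bullet> h - (B h \<bullet> h) / 2\<bar> \<le> e * (norm h)\<^sup>2"
proof -
  define y0 where "y0 = x + q"
  have sub: "subgradient f x q" by (rule subgradient_of_touching[OF f touch])
  have J_eq: "J (z + p) = z" if "subgradient f z p" for z p
    using subgradient_nonexpansive[OF that J[of "z + p"]] by simp
  obtain A where A: "(J has_derivative A) (at y0)" using diff by (auto simp: differentiable_def y0_def)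
  have linA: "linear A" using A by (rule has_derivative_linear)
  have near: "norm (p - q) \<le> 2 * C * norm h" if "subgradient f (x + h) p" for h p
    by (rule subgradient_near_touching[OF sub touch C that])
  define c where "c = 1 + 2 * C"
  have c: "c \<ge> 1" using C by (simp add: c_def)
  \<comment> \<open>As y = J y + (y - J y), the linear growth of subgradients bounds the
    displacement of \<open>y\<close> by that of \<open>J y\<close>.\<close>
  have exp: "norm (y - y0) \<le> c * norm (J y - J y0)" for y
  proof -
    have "subgradient f (x + (J y - x)) (y - J y)" using J[of y] by simp
    note near[OF this]
    moreover have "norm (y - y0) \<le> norm (J y - x) + norm (y - J y - q)"
      using norm_triangle_ineq[of "J y - x" "y - J y - q"] by (simp add: y0_def algebra_simps)
    ultimately show ?thesis by (simp add: c_def Jy0 y0_def[symmetric] algebra_simps)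
      (use Jy0 in \<open>simp add: y0_def algebra_simps\<close>)
  qed
  have "inj A" by (rule inj_derivative_of_expanding[OF A exp]) (use c in simp)
  then obtain A' where A': "linear A'" "\<And>v. A' (A v) = v" "\<And>v. A (A' v) = v"
    using linear_injective_isomorphism[OF linA] by metis
  obtain M where M: "M > 0" "\<And>v. norm (A' v) \<le> M * norm v"
    using linear_bounded_pos[OF A'(1)] by auto
  define B where "B h = A' h - h" for h
  have linB: "linear B" unfolding B_def by (intro linear_compose_sub A'(1) linear_id[unfolded id_def])
  have Jcont: "continuous_on UNIV J"
  proof (rule lipschitz_on_continuous_on[of 1], rule lipschitz_onI)
    show "dist (J y) (J z) \<le> 1 * dist y z" for y z
      using subgradient_nonexpansive[OF J[of y] J[of z]] by (simp add: dist_norm)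
  qed simp
  \<comment> \<open>The open mapping argument supplies a subgradient at every point near
    \<open>x\<close>, since every value of \<open>J\<close> has one.\<close>
  have "J y0 \<in> interior (J ` UNIV)"
    by (rule sussmann_open_mapping[of UNIV J y0 A A' UNIV])
      (use Jcont A A' in \<open>auto simp: o_def linear_conv_bounded_linear\<close>)
  then obtain r0 where r0: "r0 > 0" "ball x r0 \<subseteq> range J"
    using Jy0 unfolding mem_interior y0_def by auto
  have ex: "\<exists>p. subgradient f (x + h) p" if "norm h < r0" for h
  proof -
    have "x + h \<in> range J" using r0(2) that by (auto simp: dist_norm)
    then show ?thesis using J by (metis imageE)
  qed
  have grad: "\<exists>d>0. \<forall>h p. norm h < d \<longrightarrow> subgradient f (x + h) p \<longrightarrow> norm (p - q - B h) \<le> e * norm h" if e: "e > 0" for e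
  proof -
    \<comment> \<open>Passing from \<open>y - y0\<close> to \<open>h\<close> costs the factor
      \<open>c\<close>, applying \<open>A'\<close> the factor \<open>M\<close>.\<close>
    define e' where "e' = e / (M * c)"
    have e': "e' > 0" "M * (e' * c) = e" using e M(1) c by (auto simp: e'_def)
    obtain d where d: "d > 0" "\<And>y. norm (y - y0) < d \<Longrightarrow> norm (J y - J y0 - A (y - y0)) \<le> e' * norm (y - y0)"
      using A e'(1) unfolding has_derivative_at_alt by metis
    show ?thesis
    proof (intro exI[of _ "d / c"] conjI allI impI)
      show "d / c > 0" using d c by simp
      fix h p assume h: "norm h < d / c" and p: "subgradient f (x + h) p"
      define y where "y = x + h + p"
      have Jy: "J y = x + h" unfolding y_def by (rule J_eq[OF p])
      have yy0: "norm (y - y0) \<le> c * norm h" using exp[of y] Jy Jy0 by (simp add: y0_def)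
      also have "\<dots> < d" using h c by (simp add: field_simps)
      finally have "norm (h - A (y - y0)) \<le> e' * norm (y - y0)" using d(2)[of y] Jy Jy0 by (simp add: y0_def)
      also have "\<dots> \<le> e' * (c * norm h)" using yy0 e' by (intro mult_left_mono) auto
      finally have *: "norm (h - A (y - y0)) \<le> e' * (c * norm h)" .
      \<comment> \<open>Since \<open>y - y0 = h + (p - q)\<close>, both sides equal
        \<open>(y - y0) - A' h\<close>.\<close>
      have "p - q - B h = - A' (h - A (y - y0))"
        by (simp add: linear_diff[OF A'(1)] A' B_def y_def y0_def algebra_simps)
      then have "norm (p - q - B h) \<le> M * norm (h - A (y - y0))" using M(2) by simp
      also have "\<dots> \<le> M * (e' * (c * norm h))" using * M(1) by (intro mult_left_mono) auto
      also have "\<dots> = (M * (e' * c)) * norm h" by simp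
      finally show "norm (p - q - B h) \<le> e * norm h" by (simp add: e')
    qed
  qed
  show thesis
  proof (rule that[OF linB])
    fix e :: real assume e: "e > 0"
    obtain d where d: "d > 0" "\<And>h p. norm h < d \<Longrightarrow> subgradient f (x + h) p \<Longrightarrow> norm (p - q - B h) \<le> e * norm h"
      using grad[OF e] by blast
    show "\<exists>d>0. \<forall>h. norm h < d \<longrightarrow> \<bar>f (x + h) - f x - q \<bullet> h - (B h \<bullet> h) / 2\<bar> \<le> e * (norm h)\<^sup>2"
    proof (intro exI[of _ "min d r0"] conjI allI impI)
      show "min d r0 > 0" using d r0 by simp
      fix h :: 'a assume h: "norm h < min d r0"
      define b where "b = B h \<bullet> h"
      define g where "g t = f (x + t *\<^sub>R h) - t * (q \<bullet> h) - t\<^sup>2 / 2 * b" for t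
      have "\<bar>g 1 - g 0\<bar> \<le> e * (norm h)\<^sup>2"
      proof (rule abs_diff_le_of_quadratic_increments[where M="\<bar>b\<bar> / 2"])
        fix s t :: real assume st: "s \<in> {0..1}" "t \<in> {0..1}"
        have th: "norm (t *\<^sub>R h) \<le> norm h" using st by (simp add: mult_left_le_one_le)
        obtain p where p: "subgradient f (x + t *\<^sub>R h) p" using ex[of "t *\<^sub>R h"] th h by auto
        have "norm (p - q - B (t *\<^sub>R h)) \<le> e * norm (t *\<^sub>R h)" using d(2)[OF _ p] th h by auto
        also have "\<dots> \<le> e * norm h" using th e by (intro mult_left_mono) auto
        finally have pq: "norm (p - q - t *\<^sub>R B h) \<le> e * norm h" by (simp add: linear_scale[OF linB])
        have "\<bar>(p - q - t *\<^sub>R B h) \<bullet> h\<bar> \<le> norm (p - q - t *\<^sub>R B h) * norm h" by (rule Cauchy_Schwarz_ineq2)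
        also have "\<dots> \<le> e * (norm h)\<^sup>2" using pq by (simp add: power2_eq_square mult.assoc[symmetric] mult_right_mono)
        finally have 1: "\<bar>p \<bullet> h - q \<bullet> h - t * b\<bar> \<le> e * (norm h)\<^sup>2" by (simp add: inner_diff b_def)
        \<comment> \<open>The subgradient at parameter \<open>t\<close> bounds
          \<open>g t - g s\<close> for \<open>s\<close> on either side of \<open>t\<close>;
          exchanging the two parameters gives the opposite bound.\<close>
        have "f (x + t *\<^sub>R h) + (s - t) * (p \<bullet> h) \<le> f (x + s *\<^sub>R h)"
          using subgradientD[OF p, of "x + s *\<^sub>R h"] by (simp add: scaleR_diff_left[symmetric])
        then have "g t - g s \<le> - (s - t) * (p \<bullet> h - q \<bullet> h) + (s\<^sup>2 - t\<^sup>2) / 2 * b"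
          by (simp add: g_def algebra_simps diff_divide_distrib)
        also have "\<dots> = - (s - t) * (p \<bullet> h - q \<bullet> h - t * b) + (s - t)\<^sup>2 * (b / 2)"
          by (simp add: power2_eq_square field_simps)
        also have "\<dots> \<le> \<bar>s - t\<bar> * \<bar>p \<bullet> h - q \<bullet> h - t * b\<bar> + (s - t)\<^sup>2 * (\<bar>b\<bar> / 2)"
        proof (intro add_mono mult_left_mono)
          show "- (s - t) * (p \<bullet> h - q \<bullet> h - t * b) \<le> \<bar>s - t\<bar> * \<bar>p \<bullet> h - q \<bullet> h - t * b\<bar>"
            by (metis abs_ge_self abs_minus_cancel abs_mult)
        qed auto
        also have "\<dots> \<le> \<bar>s - t\<bar> * (e * (norm h)\<^sup>2) + (s - t)\<^sup>2 * (\<bar>b\<bar> / 2)"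
          using 1 by (intro add_mono mult_left_mono) auto
        finally show "g t \<le> g s + e * (norm h)\<^sup>2 * \<bar>s - t\<bar> + \<bar>b\<bar> / 2 * (s - t)\<^sup>2" by (simp add: mult_ac)
      qed
      then show "\<bar>f (x + h) - f x - q \<bullet> h - (B h \<bullet> h) / 2\<bar> \<le> e * (norm h)\<^sup>2"
        by (simp add: g_def b_def algebra_simps)
    qed
  qed
qed

theorem jensen_alexandrov:
  fixes w :: "'a::euclidean_space \<Rightarrow> real"
  assumes semiconvex: "convex_on UNIV (\<lambda>x. w x + C / 2 * (norm x)\<^sup>2)" and C: "C \<ge> 0" and r: "r > 0"
    and max: "\<And>p. norm p < r \<Longrightarrow> \<exists>x. \<forall>z. w z - p \<bullet> z \<le> w x - p \<bullet> x"
  obtains p x B where "norm p < r" "\<And>z. w z - p \<bullet> z \<le> w x - p \<bullet> x" "linear B"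
    "\<And>e. e > 0 \<Longrightarrow> \<exists>d>0. \<forall>h. norm h < d \<longrightarrow> \<bar>w (x + h) - w x - p \<bullet> h - (B h \<bullet> h) / 2\<bar> \<le> e * (norm h)\<^sup>2"
proof -
  define f where "f x = w x + C / 2 * (norm x)\<^sup>2" for x
  have f: "convex_on UNIV f" using semiconvex by (simp add: f_def[abs_def])
  obtain J where J: "\<And>y. subgradient f (J y) (y - J y)" using resolvent_exists[OF f] by metis
  have J_eq: "J (z + p) = z" if "subgradient f z p" for z p
    using subgradient_nonexpansive[OF that J[of "z + p"]] by simp
  have Jlip: "1-lipschitz_on UNIV J"
    using subgradient_nonexpansive[OF J J] by (auto intro!: lipschitz_onI simp: dist_norm)
  define N where "N = {y. \<not> J differentiable (at y)}"
  \<comment> \<open>If \<open>x\<close> maximises the function tilted by \<open>p\<close> and y = x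
    + p + C x, then J y = x, so \<open>T y = p\<close>.\<close>
  define T where "T y = y - (1 + C) *\<^sub>R J y" for y
  have "AE y in lebesgue. y \<notin> N"
    unfolding N_def using AE_lipschitz_differentiable[OF Jlip] by (simp add: AE_completion)
  then obtain N' where "N' \<in> null_sets lebesgue" "N \<subseteq> N'"
    unfolding eventually_ae_filter by auto
  then have "negligible N" using negligible_subset by (auto simp: negligible_iff_null_sets)
  then have "negligible (T ` N)"
  proof (rule negligible_locally_Lipschitz_image[OF order_refl])
    fix x assume "x \<in> N"
    have "norm (T y - T x) \<le> (2 + C) * norm (y - x)" for y
    proof -
      have "T y - T x = (y - x) - (1 + C) *\<^sub>R (J y - J x)" by (simp add: T_def algebra_simps)
      then have "norm (T y - T x) \<le> norm (y - x) + norm ((1 + C) *\<^sub>R (J y - J x))"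
        by (metis norm_triangle_ineq4)
      also have "norm ((1 + C) *\<^sub>R (J y - J x)) \<le> (1 + C) * norm (y - x)"
        using lipschitz_onD[OF Jlip, of y x] C by (simp add: dist_norm mult_left_mono)
      finally show ?thesis by (simp add: algebra_simps)
    qed
    then show "\<exists>U B. open U \<and> x \<in> U \<and> (\<forall>y\<in>N \<inter> U. norm (T y - T x) \<le> B * norm (y - x))"
      by (intro exI[of _ UNIV] exI[of _ "2 + C"]) auto
  qed
  moreover have "\<not> negligible (ball (0::'a) r)" using r by (intro open_not_negligible) auto
  ultimately obtain p where p: "p \<in> ball 0 r" "p \<notin> T ` N" using negligible_subset by blast
  then have pr: "norm p < r" by simp
  obtain x where x: "\<And>z. w z - p \<bullet> z \<le> w x - p \<bullet> x" using max[OF pr] by blast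
  \<comment> \<open>The slope \<open>p\<close> of \<open>w\<close> at the maximum plus the gradient
    of C/2 |x|^2.\<close>
  define q where "q = p + C *\<^sub>R x"
  have touch: "f (x + h) \<le> f x + q \<bullet> h + C / 2 * (norm h)\<^sup>2" for h
    using x[of "x + h"] by (simp add: f_def q_def power2_norm_eq_inner inner_add inner_commute algebra_simps)
  have sub: "subgradient f x q" by (rule subgradient_of_touching[OF f touch])
  have Jy0: "J (x + q) = x" by (rule J_eq[OF sub])
  have "T (x + q) = (x + q) - (1 + C) *\<^sub>R x" by (simp only: T_def Jy0)
  then have "T (x + q) = p" by (simp add: q_def algebra_simps)
  then have "J differentiable (at (x + q))" using p(2) by (auto simp: N_def)
  then obtain B where B: "linear B"
    "\<And>e. e > 0 \<Longrightarrow> \<exists>d>0. \<forall>h. norm h < d \<longrightarrow> \<bar>f (x + h) - f x - q \<bullet> h - (B h \<bullet> h) / 2\<bar> \<le> e * (norm h)\<^sup>2"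
    using second_order_expansion_at_touching_point[OF f J Jy0 _ touch C] by blast
  have "linear (\<lambda>h. B h - C *\<^sub>R h)"
    by (intro linear_compose_sub B(1) linear_scaleR)
  moreover have "f (x + h) - f x - q \<bullet> h - (B h \<bullet> h) / 2 = w (x + h) - w x - p \<bullet> h - ((B h - C *\<^sub>R h) \<bullet> h) / 2" for h
    by (simp add: f_def q_def power2_norm_eq_inner inner_add inner_diff inner_commute field_simps)
  ultimately show thesis using that[OF pr x, of "\<lambda>h. B h - C *\<^sub>R h"] B(2) by simp
qed

section \<open>The theorem on sums\<close>

lemma usc_on_attains_sup:
  assumes S: "compact S" "S \<noteq> {}" and f: "usc_on S f"
  shows "\<exists>x\<in>S. \<forall>y\<in>S. f y \<le> f x"
proof (rule ccontr)
  assume "\<not> ?thesis"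
  then obtain m where m: "\<And>x. x \<in> S \<Longrightarrow> m x \<in> S \<and> f x < f (m x)" by (metis not_le)
  have "\<exists>U. open U \<and> x \<in> U \<and> (\<forall>z\<in>U \<inter> S. f z < f (m x))" if x: "x \<in> S" for x
  proof -
    have "\<forall>\<^sub>F z in at x within S. f z < f (m x)" using f m[OF x] x by (auto simp: usc_on_def)
    then obtain U where "open U" "x \<in> U" "\<forall>z\<in>U. z \<noteq> x \<longrightarrow> z \<in> S \<longrightarrow> f z < f (m x)"
      unfolding eventually_at_topological by blast
    then show ?thesis using m[OF x] by (intro exI[of _ U]) auto
  qed
  then obtain U where U: "\<And>x. x \<in> S \<Longrightarrow> open (U x) \<and> x \<in> U x \<and> (\<forall>z\<in>U x \<inter> S. f z < f (m x))" by metis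
  obtain C where C: "C \<subseteq> S" "finite C" "S \<subseteq> (\<Union>x\<in>C. U x)"
    using compactE_image[OF S(1), of S U] U by blast
  have "C \<noteq> {}" using C S(2) by auto
  have "\<exists>c\<in>C. \<forall>d\<in>C. f (m d) \<le> f (m c)"
    using Max_in[of "(\<lambda>c. f (m c)) ` C"] Max_ge[of "(\<lambda>c. f (m c)) ` C"] C(2) \<open>C \<noteq> {}\<close> by fastforce
  then obtain c where c: "c \<in> C" "\<And>d. d \<in> C \<Longrightarrow> f (m d) \<le> f (m c)" by auto
  \<comment> \<open>The best of the finitely many improvements lies in some \<open>U d\<close>, and
    there \<open>m d\<close> improves on it.\<close>
  have "m c \<in> S" using c C m by blast
  then obtain d where d: "d \<in> C" "m c \<in> U d" using C(3) by auto
  then have "f (m c) < f (m d)" using U[of d] C(1) \<open>m c \<in> S\<close> by auto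
  with c(2)[OF d(1)] show False by simp
qed

lemma usc_on_add_continuous:
  fixes f g :: "'a::topological_space \<Rightarrow> real"
  assumes f: "usc_on S f" and g: "continuous_on S g"
  shows "usc_on S (\<lambda>x. f x + g x)"
  unfolding usc_on_def
proof (intro ballI allI impI)
  fix x c assume x: "x \<in> S" and c: "f x + g x < c"
  define e where "e = (c - (f x + g x)) / 2"
  have e: "e > 0" using c by (simp add: e_def)
  have "\<forall>\<^sub>F y in at x within S. f y < f x + e" using f x e by (auto simp: usc_on_def)
  moreover have "\<forall>\<^sub>F y in at x within S. g y < g x + e"
    using g x e by (auto simp: continuous_on intro: order_tendstoD(2))
  ultimately show "\<forall>\<^sub>F y in at x within S. f y + g y < c"
    by eventually_elim (simp add: e_def field_simps)
qed

lemma usc_on_uminus_iff: "usc_on S (\<lambda>x. - f x) \<longleftrightarrow> lsc_on S f"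
proof
  assume L: "usc_on S (\<lambda>x. - f x)"
  show "lsc_on S f" unfolding lsc_on_def
  proof (intro ballI allI impI)
    fix x c assume x: "x \<in> S" and "c < f x"
    then have "- f x < - c" by simp
    with x have "\<forall>\<^sub>F y in at x within S. - f y < - c" using L unfolding usc_on_def by blast
    then show "\<forall>\<^sub>F y in at x within S. c < f y" by simp
  qed
next
  assume L: "lsc_on S f"
  show "usc_on S (\<lambda>x. - f x)" unfolding usc_on_def
  proof (intro ballI allI impI)
    fix x c assume x: "x \<in> S" and "- f x < c"
    then have "- c < f x" by simp
    with x have "\<forall>\<^sub>F y in at x within S. - c < f y" using L unfolding lsc_on_def by blast
    then show "\<forall>\<^sub>F y in at x within S. - f y < c" by eventually_elim simp
  qed
qed

text \<open>The function \<open>a\<close> is the supremum over \<open>Z\<close> of v z - \<alpha>/2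
  |x - z|^2, and \<open>\<zeta>\<close> selects a maximiser. After adding \<alpha>/2 |x|^2 each
  competitor is affine in \<open>x\<close>, whence the semiconvexity; the quadratic decay comes from
  \<open>Z\<close> being bounded.\<close>

lemma sup_convolution:
  fixes v :: "'a::euclidean_space \<Rightarrow> real"
  assumes Z: "compact Z" "Z \<noteq> {}" and v: "usc_on Z v" and \<alpha>: "\<alpha> > 0"
  obtains a \<zeta> c where "\<And>x. \<zeta> x \<in> Z" "\<And>x. a x = v (\<zeta> x) - \<alpha> / 2 * (norm (x - \<zeta> x))\<^sup>2"
    "\<And>x z. z \<in> Z \<Longrightarrow> v z - \<alpha> / 2 * (norm (x - z))\<^sup>2 \<le> a x"
    "convex_on UNIV (\<lambda>x. a x + \<alpha> / 2 * (norm x)\<^sup>2)"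
    "\<And>x. a x \<le> c - \<alpha> / 4 * (norm x)\<^sup>2"
proof -
  define k where "k x z = v z - \<alpha> / 2 * (norm (x - z))\<^sup>2" for x z
  have "\<exists>z\<in>Z. \<forall>y\<in>Z. k x y \<le> k x z" for x
    unfolding k_def diff_conv_add_uminus[of "v _"]
    by (intro usc_on_attains_sup usc_on_add_continuous Z v continuous_intros)
  then obtain \<zeta> where \<zeta>: "\<And>x. \<zeta> x \<in> Z" "\<And>x z. z \<in> Z \<Longrightarrow> k x z \<le> k x (\<zeta> x)" by metis
  define a where "a x = k x (\<zeta> x)" for x
  have aff: "k x z + \<alpha> / 2 * (norm x)\<^sup>2 = (v z - \<alpha> / 2 * (norm z)\<^sup>2) + \<alpha> * (x \<bullet> z)" for x z
    by (simp add: k_def power2_norm_eq_inner inner_diff inner_commute algebra_simps)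
  have cvx: "convex_on UNIV (\<lambda>x. a x + \<alpha> / 2 * (norm x)\<^sup>2)"
  proof (rule convex_onI)
    fix t :: real and x y :: 'a assume t: "0 < t" "t < 1"
    let ?z = "\<zeta> ((1 - t) *\<^sub>R x + t *\<^sub>R y)"
    have "a ((1 - t) *\<^sub>R x + t *\<^sub>R y) + \<alpha> / 2 * (norm ((1 - t) *\<^sub>R x + t *\<^sub>R y))\<^sup>2
       = (1 - t) * (k x ?z + \<alpha> / 2 * (norm x)\<^sup>2) + t * (k y ?z + \<alpha> / 2 * (norm y)\<^sup>2)"
    proof -
      have "K + \<alpha> * ((1 - t) * r + t * s) = (1 - t) * (K + \<alpha> * r) + t * (K + \<alpha> * s)" for K r s
        by (simp add: algebra_simps)
      then show ?thesis unfolding a_def aff by (simp only: inner_add_left inner_scaleR_left)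
    qed
    also have "\<dots> \<le> (1 - t) * (a x + \<alpha> / 2 * (norm x)\<^sup>2) + t * (a y + \<alpha> / 2 * (norm y)\<^sup>2)"
      using \<zeta> t by (intro add_mono[OF mult_left_mono mult_left_mono]) (auto simp: a_def)
    finally show "a ((1 - t) *\<^sub>R x + t *\<^sub>R y) + \<alpha> / 2 * (norm ((1 - t) *\<^sub>R x + t *\<^sub>R y))\<^sup>2
       \<le> (1 - t) * (a x + \<alpha> / 2 * (norm x)\<^sup>2) + t * (a y + \<alpha> / 2 * (norm y)\<^sup>2)" .
  qed simp
  obtain z1 where z1: "\<And>z. z \<in> Z \<Longrightarrow> v z \<le> v z1" using usc_on_attains_sup[OF Z v] by blast
  obtain R where R: "\<And>z. z \<in> Z \<Longrightarrow> norm z \<le> R" using compact_imp_bounded[OF Z(1)] by (auto simp: bounded_iff)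
  have upper: "a x \<le> (v z1 + \<alpha> / 2 * R\<^sup>2) - \<alpha> / 4 * (norm x)\<^sup>2" for x
  proof -
    let ?z = "\<zeta> x"
    have "(norm ?z)\<^sup>2 \<le> R\<^sup>2" using R[OF \<zeta>(1)] by (intro power_mono) auto
    moreover have "(norm x)\<^sup>2 / 2 - (norm ?z)\<^sup>2 \<le> (norm (x - ?z))\<^sup>2"
    proof -
      \<comment> \<open>The identity shows why half of the coefficient \<alpha>/2 survives in the
        decay.\<close>
      have "(norm (x - ?z))\<^sup>2 - ((norm x)\<^sup>2 / 2 - (norm ?z)\<^sup>2) = (norm (x - 2 *\<^sub>R ?z))\<^sup>2 / 2"
        by (simp add: power2_norm_eq_inner inner_diff inner_commute field_simps)
      then show ?thesis by (smt (verit) zero_le_power2 divide_nonneg_nonneg)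
    qed
    ultimately have "(norm x)\<^sup>2 / 2 - R\<^sup>2 \<le> (norm (x - ?z))\<^sup>2" by linarith
    then have "\<alpha> / 2 * ((norm x)\<^sup>2 / 2 - R\<^sup>2) \<le> \<alpha> / 2 * (norm (x - ?z))\<^sup>2" using \<alpha> by (intro mult_left_mono) auto
    then show ?thesis using z1[OF \<zeta>(1)[of x]] by (simp add: a_def k_def algebra_simps)
  qed
  show thesis by (rule that[OF \<zeta>(1) _ _ cvx upper]) (use \<zeta> in \<open>auto simp: a_def k_def\<close>)
qed

lemma convex_on_norm_power2:
  assumes "c \<ge> 0"
  shows "convex_on UNIV (\<lambda>x::'a::real_inner. c * (norm x)\<^sup>2)"
proof (rule convex_onI)
  fix t :: real and x y :: 'a assume t: "0 < t" "t < 1"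
  have "(1 - t) * (c * (norm x)\<^sup>2) + t * (c * (norm y)\<^sup>2) - c * (norm ((1 - t) *\<^sub>R x + t *\<^sub>R y))\<^sup>2
    = c * (t * (1 - t)) * (norm (x - y))\<^sup>2"
    unfolding power2_norm_eq_inner by (simp add: inner_add inner_diff inner_commute) algebra
  moreover have "\<dots> \<ge> 0" using assms t by simp
  ultimately show "c * (norm ((1 - t) *\<^sub>R x + t *\<^sub>R y))\<^sup>2 \<le> (1 - t) * (c * (norm x)\<^sup>2) + t * (c * (norm y)\<^sup>2)"
    by linarith
qed simp

lemma convex_on_compose_linear:
  assumes f: "convex_on UNIV f" and L: "linear L"
  shows "convex_on UNIV (\<lambda>x. f (L x))"
proof (rule convex_onI)
  fix t :: real and x y assume t: "0 < t" "t < 1"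
  then show "f (L ((1 - t) *\<^sub>R x + t *\<^sub>R y)) \<le> (1 - t) * f (L x) + t * f (L y)"
    using convex_onD[OF f, of t "L x" "L y"] by (simp add: linear_add[OF L] linear_scale[OF L])
qed simp

text \<open>Adding the bounds at t h and - t h removes the linear part; dividing by t^2 leaves
  \<open>q h\<close> below an arbitrarily small multiple of |h|^2.\<close>

lemma nonpos_of_second_order_bound:
  fixes l q :: "'a::real_normed_vector \<Rightarrow> real"
  assumes l: "linear l" and q: "\<And>t h. q (t *\<^sub>R h) = t\<^sup>2 * q h"
    and bd: "\<And>e. e > 0 \<Longrightarrow> \<exists>d>0. \<forall>h. norm h < d \<longrightarrow> l h + q h \<le> e * (norm h)\<^sup>2"
  shows "q h \<le> 0"
proof (rule field_le_epsilon)
  fix e :: real assume e: "e > 0"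
  define e' where "e' = e / ((norm h)\<^sup>2 + 1)"
  have e': "e' > 0" "e' * (norm h)\<^sup>2 \<le> e" using e by (auto simp: e'_def add_nonneg_pos divide_le_eq)
  obtain d where d: "d > 0" "\<And>h. norm h < d \<Longrightarrow> l h + q h \<le> e' * (norm h)\<^sup>2" using bd[OF e'(1)] by blast
  define t where "t = d / (norm h + 1)"
  have t: "t > 0" using d by (simp add: t_def add_nonneg_pos)
  have "t * norm h < d" using d(1) by (simp add: t_def pos_divide_less_eq add_nonneg_pos add_pos_nonneg)
  then have n: "norm (t *\<^sub>R h) < d" "norm ((- t) *\<^sub>R h) < d" using t by auto
  have "t\<^sup>2 * q h \<le> t\<^sup>2 * (e' * (norm h)\<^sup>2)"
    using d(2)[OF n(1)] d(2)[OF n(2)] unfolding q linear_scale[OF l] by (simp add: power_mult_distrib algebra_simps)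
  then have "q h \<le> e' * (norm h)\<^sup>2" using t by simp
  then show "q h \<le> 0 + e" using e' by simp
qed

lemma norm_add_add_power2_le:
  fixes a b c :: "'a::real_inner"
  shows "(norm (a + b + c))\<^sup>2 \<le> 3 * ((norm a)\<^sup>2 + (norm b)\<^sup>2 + (norm c)\<^sup>2)"
proof -
  have "3 * ((norm a)\<^sup>2 + (norm b)\<^sup>2 + (norm c)\<^sup>2) - (norm (a + b + c))\<^sup>2
    = (norm (a - b))\<^sup>2 + (norm (b - c))\<^sup>2 + (norm (a - c))\<^sup>2"
    unfolding power2_norm_eq_inner by (simp add: inner_add inner_diff inner_commute)
  then show ?thesis by (smt (verit) zero_le_power2)
qed

text \<open>In the application \<open>u\<close> stands for minus the supersolution. The near maximum
  may lie on the boundary of \<open>Z\<close>, so the expansions speak only of increments that stay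
  in \<open>Z\<close>; the linear maps enter only through their quadratic forms and need not be
  symmetric.\<close>

theorem theorem_on_sums:
  fixes v u :: "'a::euclidean_space \<Rightarrow> real"
  assumes Z: "compact Z" "Z \<noteq> {}" and v: "usc_on Z v" and u: "usc_on Z u" and \<alpha>: "\<alpha> > 0" and \<epsilon>: "\<epsilon> > 0"
  obtains z z' m m' X X' where "z \<in> Z" "z' \<in> Z" "linear X" "linear X'"
    "\<And>s s'. s \<in> Z \<Longrightarrow> s' \<in> Z \<Longrightarrow>
       v s + u s' - \<alpha> / 6 * (norm (s - s'))\<^sup>2 \<le> v z + u z' - \<alpha> / 6 * (norm (z - z'))\<^sup>2 + \<epsilon>"
    "\<And>e. e > 0 \<Longrightarrow> \<exists>d>0. \<forall>h. norm h < d \<longrightarrow> z + h \<in> Z \<longrightarrow> v (z + h) \<le> v z + m \<bullet> h + (X h \<bullet> h) / 2 + e * (norm h)\<^sup>2"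
    "\<And>e. e > 0 \<Longrightarrow> \<exists>d>0. \<forall>h. norm h < d \<longrightarrow> z' + h \<in> Z \<longrightarrow> u (z' + h) \<le> u z' + m' \<bullet> h + (X' h \<bullet> h) / 2 + e * (norm h)\<^sup>2"
    "\<And>h h'. X h \<bullet> h + X' h' \<bullet> h' \<le> \<alpha> * (norm (h - h'))\<^sup>2"
    "\<And>h. - \<alpha> * (norm h)\<^sup>2 \<le> X h \<bullet> h" "\<And>h. - \<alpha> * (norm h)\<^sup>2 \<le> X' h \<bullet> h"
proof -
  obtain a \<zeta> ca where a: "\<And>x. \<zeta> x \<in> Z" "\<And>x. a x = v (\<zeta> x) - \<alpha> / 2 * (norm (x - \<zeta> x))\<^sup>2"
    "\<And>x z. z \<in> Z \<Longrightarrow> v z - \<alpha> / 2 * (norm (x - z))\<^sup>2 \<le> a x"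
    "convex_on UNIV (\<lambda>x. a x + \<alpha> / 2 * (norm x)\<^sup>2)"
    "\<And>x. a x \<le> ca - \<alpha> / 4 * (norm x)\<^sup>2"
    by (rule sup_convolution[OF Z v \<alpha>]) blast
  obtain b \<eta> cb where b: "\<And>x. \<eta> x \<in> Z" "\<And>x. b x = u (\<eta> x) - \<alpha> / 2 * (norm (x - \<eta> x))\<^sup>2"
    "\<And>x z. z \<in> Z \<Longrightarrow> u z - \<alpha> / 2 * (norm (x - z))\<^sup>2 \<le> b x"
    "convex_on UNIV (\<lambda>x. b x + \<alpha> / 2 * (norm x)\<^sup>2)"
    "\<And>x. b x \<le> cb - \<alpha> / 4 * (norm x)\<^sup>2"
    by (rule sup_convolution[OF Z u \<alpha>]) blast
  obtain R where R: "\<And>z. z \<in> Z \<Longrightarrow> norm z \<le> R" using compact_imp_bounded[OF Z(1)] by (auto simp: bounded_iff)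
  have R0: "R \<ge> 0" using R Z(2) norm_ge_zero order_trans by blast
  define w where "w \<xi> = a (fst \<xi>) + b (snd \<xi>) - \<alpha> / 2 * (norm (fst \<xi> - snd \<xi>))\<^sup>2" for \<xi> :: "'a \<times> 'a"
  have norm2: "(norm \<xi>)\<^sup>2 = (norm (fst \<xi>))\<^sup>2 + (norm (snd \<xi>))\<^sup>2" for \<xi> :: "'a \<times> 'a"
    by (simp add: norm_prod_def)
  \<comment> \<open>The sup-convolutions of \<open>v\<close> and \<open>u\<close> with \<open>\<alpha>/2\<close> and the coupling \<open>\<alpha>/2\<close> act as three springs in
    series, so maximising \<open>w\<close> amounts to maximising \<open>v + u\<close> with penalty \<open>\<alpha>/6\<close>.\<close>
  have wcvx: "convex_on UNIV (\<lambda>\<xi>. w \<xi> + (3 * \<alpha>) / 2 * (norm \<xi>)\<^sup>2)"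
  proof -
    \<comment> \<open>One \<alpha>/2 makes \<open>a\<close> and \<open>b\<close> convex. A further
      \<alpha> compensates the coupling, by |x - y|^2 + |x + y|^2 = 2 |x|^2 + 2 |y|^2.\<close>
    have eq: "w \<xi> + (3 * \<alpha>) / 2 * (norm \<xi>)\<^sup>2 = (a (fst \<xi>) + \<alpha> / 2 * (norm (fst \<xi>))\<^sup>2)
        + (b (snd \<xi>) + \<alpha> / 2 * (norm (snd \<xi>))\<^sup>2) + \<alpha> / 2 * (norm (fst \<xi> + snd \<xi>))\<^sup>2" for \<xi>
      unfolding w_def norm2 power2_norm_eq_inner by (simp add: inner_add inner_diff inner_commute field_simps)
    show ?thesis unfolding eq
    proof (rule convex_on_add[OF convex_on_add])
      show "convex_on UNIV (\<lambda>\<xi>. a (fst \<xi>) + \<alpha> / 2 * (norm (fst \<xi>))\<^sup>2)"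
        by (rule convex_on_compose_linear[OF a(4) linear_fst])
      show "convex_on UNIV (\<lambda>\<xi>. b (snd \<xi>) + \<alpha> / 2 * (norm (snd \<xi>))\<^sup>2)"
        by (rule convex_on_compose_linear[OF b(4) linear_snd])
      have "linear (\<lambda>\<xi>::'a \<times> 'a. fst \<xi> + snd \<xi>)" by (intro linear_compose_add linear_fst linear_snd)
      from convex_on_compose_linear[OF convex_on_norm_power2 this, of "\<alpha> / 2"]
      show "convex_on UNIV (\<lambda>\<xi>::'a \<times> 'a. \<alpha> / 2 * (norm (fst \<xi> + snd \<xi>))\<^sup>2)" using \<alpha> by simp
    qed
  qed
  have wcont: "continuous_on UNIV w"
  proof -
    have "continuous_on UNIV (\<lambda>\<xi>. (w \<xi> + (3 * \<alpha>) / 2 * (norm \<xi>)\<^sup>2) - (3 * \<alpha>) / 2 * (norm \<xi>)\<^sup>2)"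
      by (intro continuous_on_diff convex_on_continuous[OF open_UNIV wcvx] continuous_intros)
    then show ?thesis by simp
  qed
  have wupper: "w \<xi> \<le> (ca + cb) - \<alpha> / 4 * (norm \<xi>)\<^sup>2" for \<xi>
  proof -
    have "0 \<le> \<alpha> / 2 * (norm (fst \<xi> - snd \<xi>))\<^sup>2" using \<alpha> by simp
    moreover have "\<alpha> / 4 * (norm \<xi>)\<^sup>2 = \<alpha> / 4 * (norm (fst \<xi>))\<^sup>2 + \<alpha> / 4 * (norm (snd \<xi>))\<^sup>2"
      by (simp add: norm2 distrib_left)
    ultimately show ?thesis using a(5)[of "fst \<xi>"] b(5)[of "snd \<xi>"] unfolding w_def by linarith
  qed
  \<comment> \<open>Outside the ball of radius \<open>S\<close> every tilt of norm below 1 leaves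
    \<open>w\<close> below its value at 0, so maximisers stay inside.\<close>
  obtain S where S: "S \<ge> 1" "\<And>n. n \<ge> S \<Longrightarrow> 1 * n + (ca + cb - w 0 + 1) \<le> \<alpha> / 4 * n\<^sup>2"
    by (rule quadratic_dominates[of "\<alpha> / 4" 1 "ca + cb - w 0 + 1"]) (use \<alpha> in auto)
  have far: "w \<xi> - p \<bullet> \<xi> < w 0" if "norm p < 1" "norm \<xi> \<ge> S" for p \<xi>
  proof -
    have "- (p \<bullet> \<xi>) \<le> norm p * norm \<xi>" using Cauchy_Schwarz_ineq2[of p \<xi>] by linarith
    also have "\<dots> \<le> 1 * norm \<xi>" using that by (intro mult_right_mono) auto
    finally show ?thesis using wupper[of \<xi>] S(2)[OF that(2)] by linarith
  qed
  \<comment> \<open>The maximiser has norm below \<open>S\<close>, the competitors below norm at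
    most \<open>2 * R\<close>; hence the tilt changes their comparison by at most
    \<open>\<epsilon>\<close>.\<close>
  define r where "r = min 1 (\<epsilon> / (S + 2 * R + 1))"
  have r: "r > 0" "r \<le> 1" using \<epsilon> S(1) R0 by (auto simp: r_def)
  have r\<epsilon>: "r * (S + 2 * R) \<le> \<epsilon>"
  proof -
    have "r * (S + 2 * R) \<le> \<epsilon> / (S + 2 * R + 1) * (S + 2 * R)"
      using S(1) R0 by (intro mult_right_mono) (auto simp: r_def)
    also have "\<dots> \<le> \<epsilon>" using \<epsilon> S(1) R0 by (simp add: divide_le_eq)
    finally show ?thesis .
  qed
  have ex_max: "\<exists>x. \<forall>z. w z - p \<bullet> z \<le> w x - p \<bullet> x" if p: "norm p < r" for p
  proof -
    obtain x where "\<And>z. - (w x - p \<bullet> x) \<le> - (w z - p \<bullet> z)"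
    proof (rule attains_inf_of_coercive[of "\<lambda>z. - (w z - p \<bullet> z)" S])
      show "continuous_on UNIV (\<lambda>z. - (w z - p \<bullet> z))" by (intro continuous_intros wcont)
      show "- (w 0 - p \<bullet> 0) \<le> - (w z - p \<bullet> z)" if "norm z \<ge> S" for z
        using far[OF _ that, of p] p r by simp
    qed (use S in auto)
    then show ?thesis unfolding neg_le_iff_le by blast
  qed
  obtain p \<xi> B where p: "norm p < r" and \<xi>: "\<And>z. w z - p \<bullet> z \<le> w \<xi> - p \<bullet> \<xi>" and B: "linear B"
    and exp: "\<And>e. e > 0 \<Longrightarrow> \<exists>d>0. \<forall>h. norm h < d \<longrightarrow> \<bar>w (\<xi> + h) - w \<xi> - p \<bullet> h - (B h \<bullet> h) / 2\<bar> \<le> e * (norm h)\<^sup>2"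
  proof (rule jensen_alexandrov[OF wcvx _ r(1) ex_max], goal_cases)
    case 1
    then show ?case using \<alpha> by simp
  next
    case (2 p)
    then show ?case by simp
  next
    case (3 p x B)
    show ?case by (rule that[OF 3(2-)])
  qed
  define x y where "x = fst \<xi>" and "y = snd \<xi>"
  have \<xi>xy: "\<xi> = (x, y)" by (simp add: x_def y_def)
  define z z' where "z = \<zeta> x" and "z' = \<eta> y"
  have \<xi>S: "norm \<xi> < S" using \<xi>[of 0] far[of p \<xi>] p r by force
  have near_max: "v s + u s' - \<alpha> / 6 * (norm (s - s'))\<^sup>2 \<le> v z + u z' - \<alpha> / 6 * (norm (z - z'))\<^sup>2 + \<epsilon>"
    if s: "s \<in> Z" "s' \<in> Z" for s s'
  proof -
    \<comment> \<open>Cutting the segment into thirds is optimal for three equal springs: 3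
      (\<alpha>/2) (d/3)^2 = \<alpha>/6 d^2 with d = |s - s'|.\<close>
    define s1 s2 where "s1 = s + (1/3) *\<^sub>R (s' - s)" and "s2 = s + (2/3) *\<^sub>R (s' - s)"
    have "norm (s1, s2) \<le> 2 * R"
    proof -
      have "norm ((1 - 1/3) *\<^sub>R s + (1/3) *\<^sub>R s') \<le> (1 - 1/3) * norm s + (1/3) * norm s'"
        by (rule order_trans[OF norm_triangle_ineq]) simp
      moreover have "norm ((1 - 2/3) *\<^sub>R s + (2/3) *\<^sub>R s') \<le> (1 - 2/3) * norm s + (2/3) * norm s'"
        by (rule order_trans[OF norm_triangle_ineq]) simp
      moreover have "s1 = (1 - 1/3) *\<^sub>R s + (1/3) *\<^sub>R s'" "s2 = (1 - 2/3) *\<^sub>R s + (2/3) *\<^sub>R s'"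
        unfolding s1_def s2_def scaleR_diff_right scaleR_diff_left by simp_all
      ultimately have "norm s1 \<le> R" "norm s2 \<le> R" using R[OF s(1)] R[OF s(2)] by auto
      then show ?thesis using norm_Pair_le[of s1 s2] by linarith
    qed
    then have "norm ((s1, s2) - \<xi>) \<le> S + 2 * R" using \<xi>S norm_triangle_ineq4[of "(s1, s2)" \<xi>] by linarith
    then have "p \<bullet> ((s1, s2) - \<xi>) \<le> r * (S + 2 * R)"
      using norm_cauchy_schwarz[of p "(s1, s2) - \<xi>"] p r S(1) R0
      by (smt (verit) mult_mono norm_ge_zero)
    then have 1: "w (s1, s2) \<le> w \<xi> + \<epsilon>" using \<xi>[of "(s1, s2)"] r\<epsilon> by (simp add: inner_diff_right)
    have n: "norm (s1 - s) = norm (s - s') / 3" "norm (s2 - s') = norm (s - s') / 3" "norm (s1 - s2) = norm (s - s') / 3"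
    proof -
      have "s1 - s = (1/3) *\<^sub>R (s' - s)" by (simp add: s1_def)
      then show "norm (s1 - s) = norm (s - s') / 3" by (simp add: norm_minus_commute)
      have "s2 - s' = (1/3) *\<^sub>R (s - s')"
      proof -
        have "s2 - s' = (2/3) *\<^sub>R (s' - s) - 1 *\<^sub>R (s' - s)" by (simp add: s2_def)
        also have "\<dots> = (- 1/3) *\<^sub>R (s' - s)" unfolding scaleR_diff_left[symmetric] by simp
        finally show ?thesis by (simp add: algebra_simps)
      qed
      then show "norm (s2 - s') = norm (s - s') / 3" by simp
      have "s1 - s2 = (1/3) *\<^sub>R (s' - s) - (2/3) *\<^sub>R (s' - s)" by (simp add: s1_def s2_def)
      also have "\<dots> = (- 1/3) *\<^sub>R (s' - s)" unfolding scaleR_diff_left[symmetric] by simp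
      finally show "norm (s1 - s2) = norm (s - s') / 3" by (simp add: norm_minus_commute)
    qed
    have 2: "v s + u s' - \<alpha> / 6 * (norm (s - s'))\<^sup>2 \<le> w (s1, s2)"
      using a(3)[OF s(1), of s1] b(3)[OF s(2), of s2] unfolding w_def fst_conv snd_conv n
      by (simp add: power_divide field_simps)
    \<comment> \<open>Conversely, any chain z, x, y, z' costs at least \<alpha>/6 |z -
      z'|^2.\<close>
    have 3: "w \<xi> \<le> v z + u z' - \<alpha> / 6 * (norm (z - z'))\<^sup>2"
    proof -
      have "(norm (z - z'))\<^sup>2 \<le> 3 * ((norm (z - x))\<^sup>2 + (norm (x - y))\<^sup>2 + (norm (y - z'))\<^sup>2)"
        using norm_add_add_power2_le[of "z - x" "x - y" "y - z'"] by simp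
      then have "\<alpha> / 6 * (norm (z - z'))\<^sup>2 \<le> \<alpha> / 6 * (3 * ((norm (z - x))\<^sup>2 + (norm (x - y))\<^sup>2 + (norm (y - z'))\<^sup>2))"
        using \<alpha> by (intro mult_left_mono) auto
      then show ?thesis unfolding \<xi>xy w_def fst_conv snd_conv a(2)[of x] b(2)[of y] z_def[symmetric] z'_def[symmetric]
        by (simp add: norm_minus_commute[of z x] algebra_simps)
    qed
    show ?thesis using 1 2 3 by linarith
  qed
  \<comment> \<open>Gradients and Hessians of \<open>a\<close> and \<open>b\<close>: those of
    \<open>w\<close> in one variable, with the contribution of the coupling - \<alpha>/2 |x - y|^2
    taken out again.\<close>
  define m m' where "m = fst p + \<alpha> *\<^sub>R (x - y)" and "m' = snd p - \<alpha> *\<^sub>R (x - y)"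
  define X X' where "X h = fst (B (h, 0)) + \<alpha> *\<^sub>R h" and "X' h = snd (B (0, h)) + \<alpha> *\<^sub>R h" for h
  have linX: "linear X"
    using B unfolding X_def by (intro linear_compose_add linear_scaleR)
      (auto intro!: linearI simp: linear_add[symmetric] linear_scale[symmetric] fst_add[symmetric] fst_scaleR[symmetric])
  have linX': "linear X'"
    using B unfolding X'_def by (intro linear_compose_add linear_scaleR)
      (auto intro!: linearI simp: linear_add[symmetric] linear_scale[symmetric] snd_add[symmetric] snd_scaleR[symmetric])
  have expa: "\<exists>d>0. \<forall>h. norm h < d \<longrightarrow> \<bar>a (x + h) - a x - m \<bullet> h - (X h \<bullet> h) / 2\<bar> \<le> e * (norm h)\<^sup>2" if e: "e > 0" for e
  proof -
    obtain d where d: "d > 0" "\<And>h. norm h < d \<Longrightarrow> \<bar>w (\<xi> + h) - w \<xi> - p \<bullet> h - (B h \<bullet> h) / 2\<bar> \<le> e * (norm h)\<^sup>2"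
      using exp[OF e] by blast
    have "w (\<xi> + (h, 0)) - w \<xi> - p \<bullet> (h, 0) - (B (h, 0) \<bullet> (h, 0)) / 2 = a (x + h) - a x - m \<bullet> h - (X h \<bullet> h) / 2" for h
    proof -
      have sq: "(norm (x + h - y))\<^sup>2 = (norm (x - y))\<^sup>2 + 2 * ((x - y) \<bullet> h) + (norm h)\<^sup>2"
        using norm_add_scaleR_power2[of "x - y" 1 h] by (simp add: algebra_simps)
      have "\<alpha> / 2 * (norm (x + h - y))\<^sup>2 = \<alpha> / 2 * (norm (x - y))\<^sup>2 + \<alpha> * ((x - y) \<bullet> h) + \<alpha> / 2 * (norm h)\<^sup>2"
        unfolding sq by (simp add: algebra_simps)
      moreover have "w (\<xi> + (h, 0)) = a (x + h) + b y - \<alpha> / 2 * (norm (x + h - y))\<^sup>2"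
        "w \<xi> = a x + b y - \<alpha> / 2 * (norm (x - y))\<^sup>2"
        "p \<bullet> (h, 0) = fst p \<bullet> h" "B (h, 0) \<bullet> (h, 0) = fst (B (h, 0)) \<bullet> h"
        by (simp_all add: \<xi>xy w_def inner_prod_def)
      moreover have "m \<bullet> h = fst p \<bullet> h + \<alpha> * ((x - y) \<bullet> h)"
        "X h \<bullet> h = fst (B (h, 0)) \<bullet> h + \<alpha> * (norm h)\<^sup>2"
        by (simp_all add: m_def X_def inner_add_left power2_norm_eq_inner)
      ultimately show ?thesis by linarith
    qed
    then show ?thesis using d(1) d(2)[of "(_, 0)"] by (intro exI[of _ d]) (simp add: norm_Pair)
  qed
  have expb: "\<exists>d>0. \<forall>h. norm h < d \<longrightarrow> \<bar>b (y + h) - b y - m' \<bullet> h - (X' h \<bullet> h) / 2\<bar> \<le> e * (norm h)\<^sup>2" if e: "e > 0" for e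
  proof -
    obtain d where d: "d > 0" "\<And>h. norm h < d \<Longrightarrow> \<bar>w (\<xi> + h) - w \<xi> - p \<bullet> h - (B h \<bullet> h) / 2\<bar> \<le> e * (norm h)\<^sup>2"
      using exp[OF e] by blast
    have "w (\<xi> + (0, h)) - w \<xi> - p \<bullet> (0, h) - (B (0, h) \<bullet> (0, h)) / 2 = b (y + h) - b y - m' \<bullet> h - (X' h \<bullet> h) / 2" for h
    proof -
      have sq: "(norm (x - (y + h)))\<^sup>2 = (norm (x - y))\<^sup>2 - 2 * ((x - y) \<bullet> h) + (norm h)\<^sup>2"
        using norm_add_scaleR_power2[of "x - y" "-1" h] by (simp add: algebra_simps)
      have "\<alpha> / 2 * (norm (x - (y + h)))\<^sup>2 = \<alpha> / 2 * (norm (x - y))\<^sup>2 - \<alpha> * ((x - y) \<bullet> h) + \<alpha> / 2 * (norm h)\<^sup>2"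
        unfolding sq by (simp add: algebra_simps)
      moreover have "w (\<xi> + (0, h)) = a x + b (y + h) - \<alpha> / 2 * (norm (x - (y + h)))\<^sup>2"
        "w \<xi> = a x + b y - \<alpha> / 2 * (norm (x - y))\<^sup>2"
        "p \<bullet> (0, h) = snd p \<bullet> h" "B (0, h) \<bullet> (0, h) = snd (B (0, h)) \<bullet> h"
        by (simp_all add: \<xi>xy w_def inner_prod_def)
      moreover have "m' \<bullet> h = snd p \<bullet> h - \<alpha> * ((x - y) \<bullet> h)"
        "X' h \<bullet> h = snd (B (0, h)) \<bullet> h + \<alpha> * (norm h)\<^sup>2"
        by (simp_all add: m'_def X'_def inner_add_left inner_diff_left power2_norm_eq_inner)
      ultimately show ?thesis by linarith
    qed
    then show ?thesis using d(1) d(2)[of "(0, _)"] by (intro exI[of _ d]) (simp add: norm_Pair)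
  qed
  \<comment> \<open>Moving \<open>x0\<close> and \<open>\<zeta>0\<close> together keeps their
    distance: \<open>v0 (\<zeta>0 + h)\<close> minus the constant penalty is at most
    \<open>a0 (x0 + h)\<close>, with equality at \<open>h = 0\<close>. So \<open>v0\<close> inherits
    the expansion with the same \<open>m0\<close> and \<open>X0\<close>.\<close>
  have jet: "\<exists>d>0. \<forall>h. norm h < d \<longrightarrow> \<zeta>0 + h \<in> Z \<longrightarrow> v0 (\<zeta>0 + h) \<le> v0 \<zeta>0 + m0 \<bullet> h + (X0 h \<bullet> h) / 2 + e * (norm h)\<^sup>2"
    if ex: "\<exists>d>0. \<forall>h. norm h < d \<longrightarrow> \<bar>a0 (x0 + h) - a0 x0 - m0 \<bullet> h - (X0 h \<bullet> h) / 2\<bar> \<le> e * (norm h)\<^sup>2"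
      and a0: "a0 x0 = v0 \<zeta>0 - \<alpha> / 2 * (norm (x0 - \<zeta>0))\<^sup>2" "\<And>x z. z \<in> Z \<Longrightarrow> v0 z - \<alpha> / 2 * (norm (x - z))\<^sup>2 \<le> a0 x"
    for v0 a0 :: "'a \<Rightarrow> real" and m0 \<zeta>0 x0 X0 e
  proof -
    obtain d where d: "d > 0" "\<And>h. norm h < d \<Longrightarrow> \<bar>a0 (x0 + h) - a0 x0 - m0 \<bullet> h - (X0 h \<bullet> h) / 2\<bar> \<le> e * (norm h)\<^sup>2"
      using ex by blast
    show ?thesis
    proof (intro exI[of _ d] conjI allI impI d(1))
      fix h :: 'a assume h: "norm h < d" "\<zeta>0 + h \<in> Z"
      have "v0 (\<zeta>0 + h) - \<alpha> / 2 * (norm (x0 - \<zeta>0))\<^sup>2 \<le> a0 (x0 + h)" using a0(2)[OF h(2), of "x0 + h"] by simp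
      then show "v0 (\<zeta>0 + h) \<le> v0 \<zeta>0 + m0 \<bullet> h + (X0 h \<bullet> h) / 2 + e * (norm h)\<^sup>2"
        using d(2)[OF h(1)] a0(1) by linarith
    qed
  qed
  \<comment> \<open>Now \<open>\<zeta>0\<close> is held fixed: its competitor is a paraboloid of
    Hessian - \<alpha> I that touches \<open>a0\<close> from below at \<open>x0\<close>.\<close>
  have low: "- \<alpha> * (norm h)\<^sup>2 \<le> X0 h \<bullet> h"
    if ex: "\<And>e. e > 0 \<Longrightarrow> \<exists>d>0. \<forall>h. norm h < d \<longrightarrow> \<bar>a0 (x0 + h) - a0 x0 - m0 \<bullet> h - (X0 h \<bullet> h) / 2\<bar> \<le> e * (norm h)\<^sup>2"
      and a0: "a0 x0 = v0 \<zeta>0 - \<alpha> / 2 * (norm (x0 - \<zeta>0))\<^sup>2" "\<And>x z. z \<in> Z \<Longrightarrow> v0 z - \<alpha> / 2 * (norm (x - z))\<^sup>2 \<le> a0 x"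
      and \<zeta>0: "\<zeta>0 \<in> Z" and X0: "linear X0"
    for v0 a0 :: "'a \<Rightarrow> real" and m0 \<zeta>0 x0 X0 h
  proof -
    define k where "k = - m0 - \<alpha> *\<^sub>R (x0 - \<zeta>0)"
    have "- (X0 h \<bullet> h) / 2 - \<alpha> / 2 * (norm h)\<^sup>2 \<le> 0"
    proof (rule nonpos_of_second_order_bound[where l="\<lambda>h. k \<bullet> h" and q="\<lambda>h. - (X0 h \<bullet> h) / 2 - \<alpha> / 2 * (norm h)\<^sup>2"])
      show "linear (\<lambda>h. k \<bullet> h)" by (rule bounded_linear.linear[OF bounded_linear_inner_right])
      show "- (X0 (t *\<^sub>R h) \<bullet> (t *\<^sub>R h)) / 2 - \<alpha> / 2 * (norm (t *\<^sub>R h))\<^sup>2 = t\<^sup>2 * (- (X0 h \<bullet> h) / 2 - \<alpha> / 2 * (norm h)\<^sup>2)" for t h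
        by (simp add: linear_scale[OF X0] power_mult_distrib power2_eq_square algebra_simps)
      fix e :: real assume "e > 0"
      then obtain d where d: "d > 0" "\<And>h. norm h < d \<Longrightarrow> \<bar>a0 (x0 + h) - a0 x0 - m0 \<bullet> h - (X0 h \<bullet> h) / 2\<bar> \<le> e * (norm h)\<^sup>2"
        using ex by blast
      show "\<exists>d>0. \<forall>h. norm h < d \<longrightarrow> k \<bullet> h + (- (X0 h \<bullet> h) / 2 - \<alpha> / 2 * (norm h)\<^sup>2) \<le> e * (norm h)\<^sup>2"
      proof (intro exI[of _ d] conjI allI impI d(1))
        fix h :: 'a assume h: "norm h < d"
        have sq: "(norm (x0 + h - \<zeta>0))\<^sup>2 = (norm (x0 - \<zeta>0))\<^sup>2 + 2 * ((x0 - \<zeta>0) \<bullet> h) + (norm h)\<^sup>2"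
          using norm_add_scaleR_power2[of "x0 - \<zeta>0" 1 h] by (simp add: algebra_simps)
        have "a0 x0 - \<alpha> * ((x0 - \<zeta>0) \<bullet> h) - \<alpha> / 2 * (norm h)\<^sup>2 \<le> a0 (x0 + h)"
          using a0(2)[OF \<zeta>0, of "x0 + h"] unfolding a0(1) sq by (simp add: algebra_simps)
        moreover have "k \<bullet> h = - (m0 \<bullet> h) - \<alpha> * ((x0 - \<zeta>0) \<bullet> h)" by (simp add: k_def inner_diff_left)
        ultimately show "k \<bullet> h + (- (X0 h \<bullet> h) / 2 - \<alpha> / 2 * (norm h)\<^sup>2) \<le> e * (norm h)\<^sup>2"
          using d(2)[OF h] by linarith
      qed
    qed
    then show ?thesis by (simp add: field_simps)
  qed
  \<comment> \<open>The second-order condition at the maximum of a + b minus coupling and tilt. The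
    separate expansions of \<open>a\<close> and \<open>b\<close> are inserted, so no mixed block of
    \<open>B\<close> appears, and the first-order terms cancel.\<close>
  have upper: "X h \<bullet> h + X' h' \<bullet> h' \<le> \<alpha> * (norm (h - h'))\<^sup>2" for h h'
  proof -
    let ?q = "\<lambda>\<eta>. (X (fst \<eta>) \<bullet> fst \<eta> + X' (snd \<eta>) \<bullet> snd \<eta> - \<alpha> * (norm (fst \<eta> - snd \<eta>))\<^sup>2) / 2"
    have "?q (h, h') \<le> 0"
    proof (rule nonpos_of_second_order_bound[where l="\<lambda>\<eta>. 0" and q="?q"])
      show "linear (\<lambda>\<eta>::'a \<times> 'a. 0::real)" by (rule linear_zero)
      show "?q (t *\<^sub>R \<eta>) = t\<^sup>2 * ?q \<eta>" for t \<eta>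
      proof -
        have n: "(norm (fst (t *\<^sub>R \<eta>) - snd (t *\<^sub>R \<eta>)))\<^sup>2 = t\<^sup>2 * (norm (fst \<eta> - snd \<eta>))\<^sup>2"
          by (simp add: power_mult_distrib flip: scaleR_diff_right)
        show ?thesis unfolding n
          by (simp add: linear_scale[OF linX] linear_scale[OF linX'] power2_eq_square algebra_simps)
      qed
      fix e :: real assume e: "e > 0"
      obtain d where d: "d > 0" "\<And>h. norm h < d \<Longrightarrow> \<bar>a (x + h) - a x - m \<bullet> h - (X h \<bullet> h) / 2\<bar> \<le> e * (norm h)\<^sup>2"
        using expa[OF e] by blast
      obtain d' where d': "d' > 0" "\<And>h. norm h < d' \<Longrightarrow> \<bar>b (y + h) - b y - m' \<bullet> h - (X' h \<bullet> h) / 2\<bar> \<le> e * (norm h)\<^sup>2"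
        using expb[OF e] by blast
      show "\<exists>d>0. \<forall>\<eta>. norm \<eta> < d \<longrightarrow> 0 + ?q \<eta> \<le> e * (norm \<eta>)\<^sup>2"
      proof (intro exI[of _ "min d d'"] conjI allI impI)
        show "min d d' > 0" using d d' by simp
        fix \<eta> :: "'a \<times> 'a" assume \<eta>: "norm \<eta> < min d d'"
        obtain h h' where hh: "\<eta> = (h, h')" by (cases \<eta>)
        have n: "norm h < d" "norm h' < d'"
          using \<eta> norm_fst_le[of h h'] norm_snd_le[of h' h] unfolding hh by auto
        have max: "a (x + h) + b (y + h') - \<alpha> / 2 * (norm (x + h - (y + h')))\<^sup>2 - fst p \<bullet> h - snd p \<bullet> h'
          \<le> a x + b y - \<alpha> / 2 * (norm (x - y))\<^sup>2"
          using \<xi>[of "(x + h, y + h')"] by (simp add: \<xi>xy w_def inner_prod_def inner_add_right)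
        have sq: "(norm (x + h - (y + h')))\<^sup>2 = (norm (x - y))\<^sup>2 + 2 * ((x - y) \<bullet> (h - h')) + (norm (h - h'))\<^sup>2"
          using norm_add_scaleR_power2[of "x - y" 1 "h - h'"] by (simp add: algebra_simps)
        have mm: "m \<bullet> h + m' \<bullet> h' = fst p \<bullet> h + snd p \<bullet> h' + \<alpha> * ((x - y) \<bullet> (h - h'))"
          by (simp add: m_def m'_def inner_add_left inner_diff_left inner_diff_right algebra_simps)
        have "\<alpha> / 2 * (norm (x + h - (y + h')))\<^sup>2 = \<alpha> / 2 * (norm (x - y))\<^sup>2 + \<alpha> * ((x - y) \<bullet> (h - h')) + \<alpha> / 2 * (norm (h - h'))\<^sup>2"
          unfolding sq by (simp add: algebra_simps)
        then have "(X h \<bullet> h) / 2 + (X' h' \<bullet> h') / 2 - \<alpha> / 2 * (norm (h - h'))\<^sup>2 \<le> e * (norm h)\<^sup>2 + e * (norm h')\<^sup>2"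
          using max mm d(2)[OF n(1)] d'(2)[OF n(2)] by linarith
        then show "0 + ?q \<eta> \<le> e * (norm \<eta>)\<^sup>2" unfolding norm2 hh by (simp add: field_simps)
      qed
    qed
    then show ?thesis by simp
  qed
  show thesis
  proof (rule that[of z z' X X' m m'])
    show "z \<in> Z" "z' \<in> Z" using a(1) b(1) by (auto simp: z_def z'_def)
    fix e :: real assume e: "e > 0"
    show "\<exists>d>0. \<forall>h. norm h < d \<longrightarrow> z + h \<in> Z \<longrightarrow> v (z + h) \<le> v z + m \<bullet> h + (X h \<bullet> h) / 2 + e * (norm h)\<^sup>2"
      by (rule jet[OF expa[OF e] a(2)[of x, folded z_def] a(3)])
    show "\<exists>d>0. \<forall>h. norm h < d \<longrightarrow> z' + h \<in> Z \<longrightarrow> u (z' + h) \<le> u z' + m' \<bullet> h + (X' h \<bullet> h) / 2 + e * (norm h)\<^sup>2"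
      by (rule jet[OF expb[OF e] b(2)[of y, folded z'_def] b(3)])
  next
    fix h
    show "- \<alpha> * (norm h)\<^sup>2 \<le> X h \<bullet> h"
      by (rule low[OF expa a(2) a(3) a(1) linX])
    show "- \<alpha> * (norm h)\<^sup>2 \<le> X' h \<bullet> h"
      by (rule low[OF expb b(2) b(3) b(1) linX'])
  qed (use linX linX' near_max upper in auto)
qed

section \<open>Comparison\<close>

lemma symmetric_mat_inner:
  "symmetric_mat A \<Longrightarrow> x \<bullet> (A *v y) = y \<bullet> (A *v x)"
  unfolding symmetric_mat_def by (metis dot_lmul_matrix inner_commute transpose_matrix_vector)

lemma symmetric_mat_combine:
  assumes "symmetric_mat A"
  shows "symmetric_mat (A + c *\<^sub>R mat 1)" "symmetric_mat (- A)"
  using assms by (auto simp: symmetric_mat_def transpose_def mat_def vec_eq_iff)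

text \<open>The symmetric part of \<open>X\<close>, which carries the whole quadratic form.\<close>

definition quadratic_form_mat :: "(real^'n \<Rightarrow> real^'n) \<Rightarrow> real^'n^'n" where
  "quadratic_form_mat X = (1/2) *\<^sub>R (matrix X + transpose (matrix X))"

lemma symmetric_quadratic_form_mat: "symmetric_mat (quadratic_form_mat X)"
  by (auto simp: quadratic_form_mat_def symmetric_mat_def transpose_def vec_eq_iff add.commute)

lemma inner_quadratic_form_mat:
  assumes "linear X"
  shows "h \<bullet> (quadratic_form_mat X *v h) = X h \<bullet> h"
proof -
  have "h \<bullet> (transpose (matrix X) *v h) = h \<bullet> (matrix X *v h)"
    by (metis dot_lmul_matrix inner_commute transpose_matrix_vector)
  then show ?thesis
    by (simp add: quadratic_form_mat_def scaleR_matrix_vector_assoc[symmetric] matrix_vector_mult_add_rdistrib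
        inner_add_right fun_cong[OF matrix_vector_mul(2)[OF assms]] inner_commute)
qed

lemma sum_UNIV_Plus:
  fixes f :: "'a::finite + 'b::finite \<Rightarrow> 'c::comm_monoid_add"
  shows "sum f UNIV = (\<Sum>i\<in>UNIV. f (Inl i)) + (\<Sum>i\<in>UNIV. f (Inr i))"
  by (simp add: UNIV_Plus_UNIV[symmetric] sum.Plus del: UNIV_Plus_UNIV)

lemma inner_block_mat:
  fixes \<xi> :: "real^('n::finite + 'n)"
  defines "x \<equiv> \<chi> i. \<xi> $ Inl i" and "y \<equiv> \<chi> i. \<xi> $ Inr i"
  shows "\<xi> \<bullet> (block_mat A B C D *v \<xi>) = x \<bullet> (A *v x) + x \<bullet> (B *v y) + y \<bullet> (C *v x) + y \<bullet> (D *v y)"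
  unfolding inner_vec_def matrix_vector_mult_def x_def y_def block_mat_def
  by (simp add: sum_UNIV_Plus sum.distrib distrib_left)

lemma block_mat_diff: "block_mat A B C D - block_mat A' B' C' D' = block_mat (A - A') (B - B') (C - C') (D - D')"
  by (auto simp: block_mat_def vec_eq_iff split: sum.split)

lemma block_mat_scaleR: "c *\<^sub>R block_mat A B C D = block_mat (c *\<^sub>R A) (c *\<^sub>R B) (c *\<^sub>R C) (c *\<^sub>R D)"
  by (auto simp: block_mat_def vec_eq_iff split: sum.split)

lemma transpose_block_mat:
  "transpose (block_mat A B C D) = block_mat (transpose A) (transpose C) (transpose B) (transpose D)"
  by (auto simp: block_mat_def transpose_def vec_eq_iff split: sum.split)

lemma loewner_block_bounds:
  fixes X Y :: "real^'n::finite^'n"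
  assumes X: "symmetric_mat X" and Y: "symmetric_mat Y"
    and lowX: "\<And>h. - \<alpha> * (norm h)\<^sup>2 \<le> h \<bullet> (X *v h)" and lowY: "\<And>h. h \<bullet> (Y *v h) \<le> \<alpha> * (norm h)\<^sup>2"
    and up: "\<And>h k. h \<bullet> (X *v h) - k \<bullet> (Y *v k) \<le> \<alpha> * (norm (h - k))\<^sup>2"
  shows "(- \<alpha>) *\<^sub>R block_mat (mat 1) 0 0 (mat 1) \<preceq> block_mat X 0 0 (- Y)"
    and "block_mat X 0 0 (- Y) \<preceq> \<alpha> *\<^sub>R block_mat (mat 1) (- mat 1) (- mat 1) (mat 1)"
proof -
  have sym: "transpose X = X" "transpose Y = Y" using X Y by (simp_all add: symmetric_mat_def)
  have tr: "transpose (A - B) = transpose A - transpose B" "transpose (A + B) = transpose A + transpose B"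
    "transpose (c *\<^sub>R A) = c *\<^sub>R transpose A"
    "transpose (- A) = - transpose A" "transpose (0::real^'n^'n) = 0" for A B :: "real^'n^'n" and c
    by (auto simp: transpose_def vec_eq_iff)
  have mv: "(- A) *v x = - (A *v x)" "(0::real^'n^'n) *v x = 0" for A :: "real^'n^'n" and x
    by (auto simp: matrix_vector_mult_def vec_eq_iff sum_negf)
  show "(- \<alpha>) *\<^sub>R block_mat (mat 1) 0 0 (mat 1) \<preceq> block_mat X 0 0 (- Y)"
    unfolding loewner_le_def pos_semidef_def block_mat_scaleR block_mat_diff inner_block_mat
  proof (intro conjI allI)
    show "symmetric_mat (block_mat (X - (- \<alpha>) *\<^sub>R mat 1) (0 - (- \<alpha>) *\<^sub>R 0) (0 - (- \<alpha>) *\<^sub>R 0) (- Y - (- \<alpha>) *\<^sub>R mat 1))"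
      unfolding symmetric_mat_def transpose_block_mat by (simp add: tr sym transpose_mat)
    fix \<xi> :: "real^('n::finite + 'n)"
    let ?x = "\<chi> i. \<xi> $ Inl i" and ?y = "\<chi> i. \<xi> $ Inr i"
    show "0 \<le> ?x \<bullet> ((X - (- \<alpha>) *\<^sub>R mat 1) *v ?x) + ?x \<bullet> ((0 - (- \<alpha>) *\<^sub>R 0) *v ?y)
       + ?y \<bullet> ((0 - (- \<alpha>) *\<^sub>R 0) *v ?x) + ?y \<bullet> ((- Y - (- \<alpha>) *\<^sub>R mat 1) *v ?y)"
      using lowX[of ?x] lowY[of ?y]
      by (simp add: matrix_vector_mult_diff_rdistrib matrix_vector_mult_add_rdistrib scaleR_matrix_vector_assoc[symmetric] mv
          inner_add_right inner_diff_right power2_norm_eq_inner)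
  qed
  show "block_mat X 0 0 (- Y) \<preceq> \<alpha> *\<^sub>R block_mat (mat 1) (- mat 1) (- mat 1) (mat 1)"
    unfolding loewner_le_def pos_semidef_def block_mat_scaleR block_mat_diff inner_block_mat
  proof (intro conjI allI)
    show "symmetric_mat (block_mat (\<alpha> *\<^sub>R mat 1 - X) (\<alpha> *\<^sub>R - mat 1 - 0) (\<alpha> *\<^sub>R - mat 1 - 0) (\<alpha> *\<^sub>R mat 1 - - Y))"
      unfolding symmetric_mat_def transpose_block_mat by (simp only: tr sym transpose_mat)
    fix \<xi> :: "real^('n::finite + 'n)"
    let ?x = "\<chi> i. \<xi> $ Inl i" and ?y = "\<chi> i. \<xi> $ Inr i"
    have "(norm (?x - ?y))\<^sup>2 = ?x \<bullet> ?x - 2 * (?x \<bullet> ?y) + ?y \<bullet> ?y"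
      by (simp add: power2_norm_eq_inner inner_diff inner_commute)
    then have "?x \<bullet> (X *v ?x) - ?y \<bullet> (Y *v ?y) \<le> \<alpha> * (?x \<bullet> ?x - 2 * (?x \<bullet> ?y) + ?y \<bullet> ?y)"
      using up[of ?x ?y] by simp
    then show "0 \<le> ?x \<bullet> ((\<alpha> *\<^sub>R mat 1 - X) *v ?x) + ?x \<bullet> ((\<alpha> *\<^sub>R - mat 1 - 0) *v ?y)
       + ?y \<bullet> ((\<alpha> *\<^sub>R - mat 1 - 0) *v ?x) + ?y \<bullet> ((\<alpha> *\<^sub>R mat 1 - - Y) *v ?y)"
      by (simp add: matrix_vector_mult_diff_rdistrib matrix_vector_mult_add_rdistrib scaleR_matrix_vector_assoc[symmetric] mv
          inner_add_right inner_diff_right inner_commute[of ?y ?x] algebra_simps)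
  qed
qed

section \<open>Test functions and strict inequalities\<close>

lemma quadratic_test_function:
  fixes A :: "real^'n^'n" and z M :: "real^'n" and c :: real
  assumes A: "symmetric_mat A"
  defines "\<phi> \<equiv> \<lambda>y. c + M \<bullet> (y - z) + (y - z) \<bullet> (A *v (y - z)) / 2"
  shows "C2_near \<phi> z" "hessian \<phi> z = A"
proof -
  note bl = matrix_vector_mul_bounded_linear[of A]
  have d: "(\<phi> has_derivative (\<lambda>h. M \<bullet> h + (x - z) \<bullet> (A *v h))) (at x)" for x
  proof -
    have "(\<phi> has_derivative (\<lambda>h. M \<bullet> h + (h \<bullet> (A *v (x - z)) + (x - z) \<bullet> (A *v h)) / 2)) (at x)"
      unfolding \<phi>_def
      by (auto intro!: derivative_eq_intros bounded_linear.has_derivative[OF bl])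
    then show ?thesis by (simp add: symmetric_mat_inner[OF A, of _ "x - z"])
  qed
  have g: "gradient \<phi> = (\<lambda>x. M + A *v (x - z))"
  proof
    fix x
    have "frechet_derivative \<phi> (at x) = (\<lambda>h. M \<bullet> h + (x - z) \<bullet> (A *v h))"
      by (rule frechet_derivative_at[OF d, symmetric])
    then show "gradient \<phi> x = M + A *v (x - z)"
      by (simp add: gradient_def vec_eq_iff inner_axis symmetric_mat_inner[OF A, of "x - z"] inner_axis')
  qed
  have dg: "(gradient \<phi> has_derivative (\<lambda>h. A *v h)) (at x)" for x
    unfolding g by (auto intro!: derivative_eq_intros bounded_linear.has_derivative[OF bl])
  have h: "hessian \<phi> = (\<lambda>x. A)"
    unfolding hessian_def frechet_derivative_at[OF dg, symmetric] by (simp add: matrix_of_matrix_vector_mul)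
  show "hessian \<phi> z = A" by (simp add: h)
  show "C2_near \<phi> z" unfolding C2_near_def
    by (rule exI[of _ UNIV]) (use d dg h in \<open>auto simp: differentiable_def\<close>)
qed

text \<open>The filter in \<open>usc_on\<close> omits the point \<open>x\<close> itself, which the
  sequence may hit; there \<open>f x < c\<close> takes over.\<close>

lemma usc_on_eventually_sequentially:
  assumes f: "usc_on S f" and x: "x \<in> S" "f x < c" and y: "\<And>n. y n \<in> S" "y \<longlonglongrightarrow> x"
  shows "\<forall>\<^sub>F n in sequentially. f (y n) < c"
proof -
  have "\<forall>\<^sub>F y in at x within S. f y < c" using f x by (auto simp: usc_on_def)
  then obtain U where U: "open U" "x \<in> U" "\<forall>y\<in>U. y \<noteq> x \<longrightarrow> y \<in> S \<longrightarrow> f y < c"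
    unfolding eventually_at_topological by blast
  have "\<forall>\<^sub>F n in sequentially. y n \<in> U" using topological_tendstoD[OF y(2) U(1,2)] .
  then show ?thesis by eventually_elim (use U(3) x(2) y(1) in metis)
qed

text \<open>Converts the expansions into inequalities for \<open>F\<close>, with a margin
  independent of \<alpha>. They are conditional on \<open>z\<close> and \<open>z'\<close> being
  interior, which is only ensured later, for large \<alpha>.\<close>

lemma strict_jets:
  fixes \<Omega> :: "(real^'n) set" and F :: "real^'n^'n \<Rightarrow> real^'n \<Rightarrow> real" and C :: real
  assumes "open \<Omega>" "bounded \<Omega>" "\<Omega> \<noteq> {}" and \<eta>: "\<eta> > 0" and \<alpha>: "\<alpha> > 0" and \<epsilon>: "\<epsilon> > 0"
    and F: "\<forall>x\<in>\<Omega>. \<forall>\<tau>\<ge>0. \<forall>X. symmetric_mat X \<longrightarrow> l \<tau> \<le> F (X + \<tau> *\<^sub>R mat 1) x - F X x"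
    and v: "viscosity_subsolution \<Omega> F v" and u: "viscosity_supersolution \<Omega> F u"
  defines "V \<equiv> \<lambda>x. v x + \<eta> / 2 * ((norm x)\<^sup>2 - C)" and "U \<equiv> \<lambda>x. - u x + \<eta> / 2 * ((norm x)\<^sup>2 - C)"
  shows "\<exists>z z' X Y. z \<in> closure \<Omega> \<and> z' \<in> closure \<Omega> \<and> symmetric_mat X \<and> symmetric_mat Y \<and>
    (\<forall>s\<in>closure \<Omega>. \<forall>s'\<in>closure \<Omega>. V s + U s' - \<alpha> / 6 * (norm (s - s'))\<^sup>2 \<le> V z + U z' - \<alpha> / 6 * (norm (z - z'))\<^sup>2 + \<epsilon>) \<and>
    (- \<alpha>) *\<^sub>R block_mat (mat 1) 0 0 (mat 1) \<preceq> block_mat X 0 0 (- Y) \<and>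
    block_mat X 0 0 (- Y) \<preceq> \<alpha> *\<^sub>R block_mat (mat 1) (- mat 1) (- mat 1) (mat 1) \<and>
    (z \<in> \<Omega> \<longrightarrow> l (\<eta> / 2) \<le> F X z) \<and> (z' \<in> \<Omega> \<longrightarrow> F Y z' \<le> - l (\<eta> / 2))"
proof -
  let ?Z = "closure \<Omega>"
  have Z: "compact ?Z" "?Z \<noteq> {}" using assms by (auto simp: compact_closure)
  have cont: "continuous_on ?Z (\<lambda>x. \<eta> / 2 * ((norm x)\<^sup>2 - C))" by (intro continuous_intros)
  have uscV: "usc_on ?Z V" unfolding V_def
    using v by (intro usc_on_add_continuous cont) (simp add: viscosity_subsolution_def)
  have uscU: "usc_on ?Z U" unfolding U_def
    using u by (intro usc_on_add_continuous cont) (simp add: viscosity_supersolution_def usc_on_uminus_iff)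
  obtain z z' m m' X X' where zz: "z \<in> ?Z" "z' \<in> ?Z" and lin: "linear X" "linear X'"
    and near: "\<And>s s'. s \<in> ?Z \<Longrightarrow> s' \<in> ?Z \<Longrightarrow>
       V s + U s' - \<alpha> / 6 * (norm (s - s'))\<^sup>2 \<le> V z + U z' - \<alpha> / 6 * (norm (z - z'))\<^sup>2 + \<epsilon>"
    and jet: "\<And>e. e > 0 \<Longrightarrow> \<exists>d>0. \<forall>h. norm h < d \<longrightarrow> z + h \<in> ?Z \<longrightarrow> V (z + h) \<le> V z + m \<bullet> h + (X h \<bullet> h) / 2 + e * (norm h)\<^sup>2"
    and jet': "\<And>e. e > 0 \<Longrightarrow> \<exists>d>0. \<forall>h. norm h < d \<longrightarrow> z' + h \<in> ?Z \<longrightarrow> U (z' + h) \<le> U z' + m' \<bullet> h + (X' h \<bullet> h) / 2 + e * (norm h)\<^sup>2"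
    and bds: "\<And>h h'. X h \<bullet> h + X' h' \<bullet> h' \<le> \<alpha> * (norm (h - h'))\<^sup>2"
    "\<And>h. - \<alpha> * (norm h)\<^sup>2 \<le> X h \<bullet> h" "\<And>h. - \<alpha> * (norm h)\<^sup>2 \<le> X' h \<bullet> h"
  proof (rule theorem_on_sums[OF Z uscV uscU \<alpha> \<epsilon>], goal_cases)
    case (1 z z' X X' m m')
    show ?case by (rule 1(1)[OF 1(2-)])
  qed
  define P Q where "P = quadratic_form_mat X" and "Q = quadratic_form_mat X'"
  have sym: "symmetric_mat P" "symmetric_mat Q" by (simp_all add: P_def Q_def symmetric_quadratic_form_mat)
  have P: "h \<bullet> (P *v h) = X h \<bullet> h" and Q: "h \<bullet> (Q *v h) = X' h \<bullet> h" for h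
    by (simp_all add: P_def Q_def inner_quadratic_form_mat lin)
  have mvm: "(- A) *v h = - (A *v h)" for A :: "real^'n^'n" and h
    by (auto simp: matrix_vector_mult_def vec_eq_iff sum_negf)
  have mv1: "h \<bullet> ((A + c *\<^sub>R mat 1) *v h) = h \<bullet> (A *v h) + c * (norm h)\<^sup>2" for A :: "real^'n^'n" and c h
    by (simp add: matrix_vector_mult_add_rdistrib scaleR_matrix_vector_assoc[symmetric] inner_add_right power2_norm_eq_inner)
  have sq: "(norm (z + h))\<^sup>2 = (norm z)\<^sup>2 + 2 * (z \<bullet> h) + (norm h)\<^sup>2" for z h :: "real^'n"
    using norm_add_scaleR_power2[of z 1 h] by simp
  have \<Omega>Z: "x \<in> \<Omega> \<Longrightarrow> x \<in> ?Z" for x using closure_subset by blast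
  have sub: "l (\<eta> / 2) \<le> F P z" if z: "z \<in> \<Omega>"
  proof -
    \<comment> \<open>Removing the perturbation from \<open>V\<close> subtracts \<eta> I, and the
      remainder \<eta>/4 |h|^2 adds \<eta>/2 I. The hypothesis on \<open>F\<close> then turns the
      step from \<open>A\<close> to \<open>P\<close> into \<open>l (\<eta> / 2)\<close>.\<close>
    define A where "A = P + (- \<eta> / 2) *\<^sub>R mat 1"
    have symA: "symmetric_mat A" unfolding A_def by (rule symmetric_mat_combine[OF sym(1)])
    define \<phi> where "\<phi> y = v z + (m - \<eta> *\<^sub>R z) \<bullet> (y - z) + (y - z) \<bullet> (A *v (y - z)) / 2" for y
    note test = quadratic_test_function[OF symA, of "v z" "m - \<eta> *\<^sub>R z" z, folded \<phi>_def]
    obtain d where d: "d > 0" "\<And>h. norm h < d \<Longrightarrow> z + h \<in> ?Z \<Longrightarrow> V (z + h) \<le> V z + m \<bullet> h + (X h \<bullet> h) / 2 + \<eta> / 4 * (norm h)\<^sup>2"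
      using jet[of "\<eta> / 4"] \<eta> by auto
    have "\<forall>\<^sub>F y in nhds z. y \<in> \<Omega> \<inter> ball z d"
      by (rule eventually_nhds_in_open) (use assms z d in auto)
    then have "\<forall>\<^sub>F y in nhds z. v y \<le> \<phi> y"
    proof eventually_elim
      fix y assume y: "y \<in> \<Omega> \<inter> ball z d"
      define h where "h = y - z"
      have yz: "y = z + h" by (simp add: h_def)
      have "V (z + h) \<le> V z + m \<bullet> h + (X h \<bullet> h) / 2 + \<eta> / 4 * (norm h)\<^sup>2"
        using y \<Omega>Z by (intro d(2)) (auto simp: h_def dist_norm norm_minus_commute)
      then have "v y \<le> v z + (m \<bullet> h - \<eta> * (z \<bullet> h)) + ((X h \<bullet> h) / 2 - \<eta> / 4 * (norm h)\<^sup>2)"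
        unfolding V_def yz sq by (simp add: algebra_simps)
      also have "\<dots> = \<phi> y"
        unfolding \<phi>_def h_def[symmetric] A_def mv1 P by (simp add: inner_diff_left)
      finally show "v y \<le> \<phi> y" .
    qed
    then have "0 \<le> F A z"
      using v z test unfolding viscosity_subsolution_def by (metis \<phi>_def add.right_neutral diff_self div_0 inner_zero_left inner_zero_right)
    moreover have "A + (\<eta> / 2) *\<^sub>R mat 1 = P" by (simp add: A_def)
    ultimately show ?thesis using F z symA \<eta> by (smt (verit) divide_nonneg_nonneg)
  qed
  have super: "F (- Q) z' \<le> - l (\<eta> / 2)" if z': "z' \<in> \<Omega>"
  proof -
    \<comment> \<open>The mirror image: - Q + \<eta> I from the perturbation, minus \<eta>/2 I for
      the remainder.\<close>
    define A where "A = - Q + (\<eta> / 2) *\<^sub>R mat 1"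
    have symQ: "symmetric_mat (- Q)" by (rule symmetric_mat_combine[OF sym(2)])
    have symA: "symmetric_mat A" unfolding A_def by (rule symmetric_mat_combine[OF symQ])
    define \<phi> where "\<phi> y = u z' + (\<eta> *\<^sub>R z' - m') \<bullet> (y - z') + (y - z') \<bullet> (A *v (y - z')) / 2" for y
    note test = quadratic_test_function[OF symA, of "u z'" "\<eta> *\<^sub>R z' - m'" z', folded \<phi>_def]
    obtain d where d: "d > 0" "\<And>h. norm h < d \<Longrightarrow> z' + h \<in> ?Z \<Longrightarrow> U (z' + h) \<le> U z' + m' \<bullet> h + (X' h \<bullet> h) / 2 + \<eta> / 4 * (norm h)\<^sup>2"
      using jet'[of "\<eta> / 4"] \<eta> by auto
    have "\<forall>\<^sub>F y in nhds z'. y \<in> \<Omega> \<inter> ball z' d"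
      by (rule eventually_nhds_in_open) (use assms z' d in auto)
    then have "\<forall>\<^sub>F y in nhds z'. \<phi> y \<le> u y"
    proof eventually_elim
      fix y assume y: "y \<in> \<Omega> \<inter> ball z' d"
      define h where "h = y - z'"
      have yz: "y = z' + h" by (simp add: h_def)
      have "\<phi> y = u z' + (\<eta> * (z' \<bullet> h) - m' \<bullet> h) + (\<eta> / 4 * (norm h)\<^sup>2 - (X' h \<bullet> h) / 2)"
        unfolding \<phi>_def h_def[symmetric] A_def mv1 mvm inner_minus_right Q by (simp add: inner_diff_left)
      also have "U (z' + h) \<le> U z' + m' \<bullet> h + (X' h \<bullet> h) / 2 + \<eta> / 4 * (norm h)\<^sup>2"
        using y \<Omega>Z by (intro d(2)) (auto simp: h_def dist_norm norm_minus_commute)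
      then have "u z' + (\<eta> * (z' \<bullet> h) - m' \<bullet> h) + (\<eta> / 4 * (norm h)\<^sup>2 - (X' h \<bullet> h) / 2) \<le> u y"
        unfolding U_def yz sq by (simp add: algebra_simps)
      finally show "\<phi> y \<le> u y" .
    qed
    then have "F A z' \<le> 0"
      using u z' test unfolding viscosity_supersolution_def by (metis \<phi>_def add.right_neutral diff_self div_0 inner_zero_left inner_zero_right)
    moreover have "l (\<eta> / 2) \<le> F A z' - F (- Q) z'" unfolding A_def
      by (rule F[rule_format, OF z' _ symQ]) (use \<eta> in simp)
    ultimately show ?thesis by simp
  qed
  have "- \<alpha> * (norm h)\<^sup>2 \<le> h \<bullet> (P *v h)" "h \<bullet> ((- Q) *v h) \<le> \<alpha> * (norm h)\<^sup>2"
    "h \<bullet> (P *v h) - k \<bullet> ((- Q) *v k) \<le> \<alpha> * (norm (h - k))\<^sup>2" for h k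
    using bds(2)[of h] bds(3)[of h] bds(1)[of h k] by (simp_all add: P Q mvm)
  note blocks = loewner_block_bounds[OF sym(1) symmetric_mat_combine(2)[OF sym(2)] this]
  show ?thesis
    by (intro exI[of _ z] exI[of _ z'] exI[of _ P] exI[of _ "- Q"] conjI ballI impI zz sym(1)
        symmetric_mat_combine(2)[OF sym(2)] near blocks sub super)
qed

theorem proposition2p1:
  fixes \<Omega> :: "(real^'n) set"
    and F :: "real^'n^'n \<Rightarrow> real^'n \<Rightarrow> real"
    and l :: "real \<Rightarrow> real"
  assumes "open \<Omega>" and "bounded \<Omega>"
    and "elliptic_at_0 \<Omega> F"
    and "strict_mono_on {0..} l" and "\<forall>\<tau>\<ge>0. 0 \<le> l \<tau>"
    and "\<forall>x\<in>\<Omega>. \<forall>\<tau>\<ge>0. \<forall>X. symmetric_mat X \<longrightarrow> l \<tau> \<le> F (X + \<tau> *\<^sub>R mat 1) x - F X x"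
    and "\<forall>K. compact K \<and> K \<subseteq> \<Omega> \<longrightarrow> (\<exists>\<omega>. modulus_of_continuity \<omega> \<and>
           (\<forall>\<alpha>>0. \<forall>x\<in>K. \<forall>y\<in>K. \<forall>X Y. symmetric_mat X \<longrightarrow> symmetric_mat Y \<longrightarrow>
              (- \<alpha>) *\<^sub>R block_mat (mat 1) 0 0 (mat 1) \<preceq> block_mat X 0 0 (- Y) \<longrightarrow>
              block_mat X 0 0 (- Y) \<preceq> \<alpha> *\<^sub>R block_mat (mat 1) (- mat 1) (- mat 1) (mat 1) \<longrightarrow>
              F X x - F Y y \<le> \<omega> (\<alpha> * (norm (x - y))\<^sup>2 + norm (x - y))))"
  shows "comparison_principle \<Omega> F"
proof -
  note F = assms(6)
  show ?thesis
    unfolding comparison_principle_def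
  proof (intro allI impI ballI)
    fix v u x0
    assume v: "viscosity_subsolution \<Omega> F v" and u: "viscosity_supersolution \<Omega> F u"
      and bdry: "\<forall>x\<in>frontier \<Omega>. v x \<le> u x" and x0: "x0 \<in> \<Omega>"
    show "v x0 \<le> u x0"
    proof (rule ccontr)
      assume "\<not> v x0 \<le> u x0"
      then have gap: "v x0 - u x0 > 0" by simp
      let ?Z = "closure \<Omega>"
      have Z: "compact ?Z" "?Z \<noteq> {}" "x0 \<in> ?Z"
        using assms(2) x0 closure_subset by (auto simp: compact_closure)
      obtain R where R: "\<And>z. z \<in> ?Z \<Longrightarrow> norm z \<le> R" using compact_imp_bounded[OF Z(1)] by (auto simp: bounded_iff)
      \<comment> \<open>At \<open>x0\<close> the two perturbations together lower the gap by at most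
        \<eta> R^2; with this choice it stays positive.\<close>
      define \<eta> where "\<eta> = (v x0 - u x0) / (R\<^sup>2 + 1)"
      have \<eta>: "\<eta> > 0" using gap by (simp add: \<eta>_def add_nonneg_pos)
      have \<eta>R: "\<eta> * R\<^sup>2 < v x0 - u x0"
        using gap by (simp add: \<eta>_def pos_divide_less_eq add_nonneg_pos)
      define V U where "V x = v x + \<eta> / 2 * ((norm x)\<^sup>2 - R\<^sup>2)" and "U x = - u x + \<eta> / 2 * ((norm x)\<^sup>2 - R\<^sup>2)" for x
      have cont: "continuous_on ?Z (\<lambda>x. \<eta> / 2 * ((norm x)\<^sup>2 - R\<^sup>2))" by (intro continuous_intros)
      have uscV: "usc_on ?Z V" unfolding V_def
        using v by (intro usc_on_add_continuous cont) (simp add: viscosity_subsolution_def)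
      have uscU: "usc_on ?Z U" unfolding U_def
        using u by (intro usc_on_add_continuous cont) (simp add: viscosity_supersolution_def usc_on_uminus_iff)
      \<comment> \<open>Subtracting R^2 makes the perturbations nonpositive on the closure, so a
        positive value of V + U still excludes boundary points.\<close>
      have le: "V x + U x \<le> v x - u x" if "x \<in> ?Z" for x
      proof -
        have "(norm x)\<^sup>2 \<le> R\<^sup>2" using R[OF that] by (intro power_mono) auto
        then have "\<eta> / 2 * ((norm x)\<^sup>2 - R\<^sup>2) \<le> 0" using \<eta> by (simp add: mult_nonneg_nonpos)
        then show ?thesis by (simp add: V_def U_def)
      qed
      define M where "M = V x0 + U x0"
      have M: "M > 0"
      proof -
        have "M = v x0 - u x0 - \<eta> * R\<^sup>2 + \<eta> * (norm x0)\<^sup>2" by (simp add: M_def V_def U_def field_simps)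
        moreover have "0 \<le> \<eta> * (norm x0)\<^sup>2" using \<eta> by simp
        ultimately show ?thesis using \<eta>R by linarith
      qed
      define c where "c = l (\<eta> / 2)"
      have c: "c > 0"
      proof -
        have "l 0 < l (\<eta> / 2)" using assms(4) \<eta> by (auto simp: strict_mono_on_def)
        moreover have "0 \<le> l 0" using assms(5) by simp
        ultimately show ?thesis by (simp add: c_def)
      qed
      \<comment> \<open>The penalty tends to infinity; its inverse serves as the tolerance of the
        near maximum.\<close>
      define \<alpha> where "\<alpha> n = real (Suc n)" for n
      have \<alpha>: "\<alpha> n > 0" for n by (simp add: \<alpha>_def)
      have "\<Omega> \<noteq> {}" using x0 by auto
      note jets = strict_jets[OF assms(1,2) this \<eta> \<alpha> _ F v u, of "inverse (\<alpha> _)" "R\<^sup>2", folded V_def U_def c_def]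
      have "\<forall>n. \<exists>z z' X Y. z \<in> ?Z \<and> z' \<in> ?Z \<and> symmetric_mat X \<and> symmetric_mat Y \<and>
        (\<forall>s\<in>?Z. \<forall>s'\<in>?Z. V s + U s' - \<alpha> n / 6 * (norm (s - s'))\<^sup>2 \<le> V z + U z' - \<alpha> n / 6 * (norm (z - z'))\<^sup>2 + inverse (\<alpha> n)) \<and>
        (- \<alpha> n) *\<^sub>R block_mat (mat 1) 0 0 (mat 1) \<preceq> block_mat X 0 0 (- Y) \<and>
        block_mat X 0 0 (- Y) \<preceq> \<alpha> n *\<^sub>R block_mat (mat 1) (- mat 1) (- mat 1) (mat 1) \<and>
        (z \<in> \<Omega> \<longrightarrow> c \<le> F X z) \<and> (z' \<in> \<Omega> \<longrightarrow> F Y z' \<le> - c)"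
        using jets \<alpha> by simp
      then obtain z z' X Y where zz: "\<And>n. z n \<in> ?Z" "\<And>n. z' n \<in> ?Z"
        and sym: "\<And>n. symmetric_mat (X n)" "\<And>n. symmetric_mat (Y n)"
        and near: "\<And>n s s'. s \<in> ?Z \<Longrightarrow> s' \<in> ?Z \<Longrightarrow>
          V s + U s' - \<alpha> n / 6 * (norm (s - s'))\<^sup>2 \<le> V (z n) + U (z' n) - \<alpha> n / 6 * (norm (z n - z' n))\<^sup>2 + inverse (\<alpha> n)"
        and blocks: "\<And>n. (- \<alpha> n) *\<^sub>R block_mat (mat 1) 0 0 (mat 1) \<preceq> block_mat (X n) 0 0 (- Y n)"
          "\<And>n. block_mat (X n) 0 0 (- Y n) \<preceq> \<alpha> n *\<^sub>R block_mat (mat 1) (- mat 1) (- mat 1) (mat 1)"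
        and strict: "\<And>n. z n \<in> \<Omega> \<Longrightarrow> c \<le> F (X n) (z n)" "\<And>n. z' n \<in> \<Omega> \<Longrightarrow> F (Y n) (z' n) \<le> - c"
        by metis
      obtain zh r where zh: "zh \<in> ?Z" and r: "strict_mono r" and lim: "(z \<circ> r) \<longlonglongrightarrow> zh"
        using Z(1) zz(1) unfolding compact_def by blast
      define d where "d n = norm (z n - z' n)" for n
      obtain Vm where Vm: "\<And>x. x \<in> ?Z \<Longrightarrow> V x \<le> Vm" using usc_on_attains_sup[OF Z(1,2) uscV] by blast
      obtain Um where Um: "\<And>x. x \<in> ?Z \<Longrightarrow> U x \<le> Um" using usc_on_attains_sup[OF Z(1,2) uscU] by blast
      have inv0: "(\<lambda>n. inverse (\<alpha> n)) \<longlonglongrightarrow> 0" unfolding \<alpha>_def by (rule LIMSEQ_inverse_real_of_nat)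
      have near': "\<alpha> n / 6 * (d n)\<^sup>2 \<le> V (z n) + U (z' n) + inverse (\<alpha> n) - (V s + U s)" if "s \<in> ?Z" for s n
        using near[OF that that, of n] by (simp add: d_def)
      \<comment> \<open>The competitor is the pair \<open>x0\<close>, \<open>x0\<close>;
        \<open>V\<close> and \<open>U\<close> are bounded above, so the penalty stays
        bounded.\<close>
      have dsq: "(d n)\<^sup>2 \<le> 6 * (Vm + Um + 1 - M) * inverse (\<alpha> n)" for n
      proof -
        have "inverse (\<alpha> n) \<le> 1" by (simp add: \<alpha>_def field_simps)
        then have "\<alpha> n / 6 * (d n)\<^sup>2 \<le> Vm + Um + 1 - M"
          using near'[OF Z(3), of n] Vm[OF zz(1)[of n]] Um[OF zz(2)[of n]] by (simp add: M_def)
        then show ?thesis using \<alpha>[of n] by (simp add: field_simps)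
      qed
      have "(\<lambda>n. 6 * (Vm + Um + 1 - M) * inverse (\<alpha> n)) \<longlonglongrightarrow> 6 * (Vm + Um + 1 - M) * 0"
        by (intro tendsto_intros inv0)
      then have "(\<lambda>n. (d n)\<^sup>2) \<longlonglongrightarrow> 0"
        by (intro tendsto_sandwich[OF _ _ tendsto_const, of _ "\<lambda>n. (d n)\<^sup>2"]) (use dsq in auto)
      then have d0: "d \<longlonglongrightarrow> 0"
        using tendsto_real_sqrt[of "\<lambda>n. (d n)\<^sup>2" 0] by (simp add: d_def[abs_def])
      have dr0: "(\<lambda>n. d (r n)) \<longlonglongrightarrow> 0" using LIMSEQ_subseq_LIMSEQ[OF d0 r] by (simp add: o_def)
      have invr0: "(\<lambda>n. inverse (\<alpha> (r n))) \<longlonglongrightarrow> 0" using LIMSEQ_subseq_LIMSEQ[OF inv0 r] by (simp add: o_def)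
      have lim1: "(\<lambda>n. z (r n)) \<longlonglongrightarrow> zh" using lim by (simp add: o_def)
      have lim2: "(\<lambda>n. z' (r n)) \<longlonglongrightarrow> zh"
      proof -
        have "(\<lambda>n. z (r n) - z' (r n)) \<longlonglongrightarrow> 0" using dr0 unfolding d_def by (rule tendsto_norm_zero_cancel)
        from tendsto_diff[OF lim1 this] show ?thesis by simp
      qed
      have ev: "\<forall>\<^sub>F n in sequentially. V (z (r n)) + U (z' (r n)) + inverse (\<alpha> (r n)) < V zh + U zh + e" if e: "e > 0" for e
      proof -
        have "\<forall>\<^sub>F n in sequentially. V (z (r n)) < V zh + e / 3"
          by (rule usc_on_eventually_sequentially[OF uscV zh _ _ lim1]) (use zz e in auto)
        moreover have "\<forall>\<^sub>F n in sequentially. U (z' (r n)) < U zh + e / 3"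
          by (rule usc_on_eventually_sequentially[OF uscU zh _ _ lim2]) (use zz e in auto)
        moreover have "\<forall>\<^sub>F n in sequentially. inverse (\<alpha> (r n)) < e / 3"
          using order_tendstoD(2)[OF invr0, of "e / 3"] e by simp
        ultimately show ?thesis by eventually_elim simp
      qed
      \<comment> \<open>Upper semicontinuity passes the positive value to the common limit of both
        sequences, which is therefore an interior point.\<close>
      have "M \<le> V zh + U zh"
      proof (rule field_le_epsilon)
        fix e :: real assume "e > 0"
        from eventually_happens'[OF sequentially_bot ev[OF this]] obtain n
          where n: "V (z (r n)) + U (z' (r n)) + inverse (\<alpha> (r n)) < V zh + U zh + e" by blast
        have "0 \<le> \<alpha> (r n) / 6 * (d (r n))\<^sup>2" using \<alpha>[of "r n"] by simp
        then show "M \<le> V zh + U zh + e" using n near'[OF Z(3), of "r n"] unfolding M_def by linarith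
      qed
      then have "v zh > u zh" using M le[OF zh] by linarith
      then have zh\<Omega>: "zh \<in> \<Omega>" using bdry zh assms(1) by (force simp: frontier_def interior_open)
      then obtain \<rho> where \<rho>: "\<rho> > 0" "cball zh \<rho> \<subseteq> \<Omega>" using assms(1) open_contains_cball by blast
      obtain \<omega> where \<omega>: "modulus_of_continuity \<omega>"
        and struct: "\<And>\<alpha> x y X Y. \<alpha> > 0 \<Longrightarrow> x \<in> cball zh \<rho> \<Longrightarrow> y \<in> cball zh \<rho> \<Longrightarrow> symmetric_mat X \<Longrightarrow> symmetric_mat Y \<Longrightarrow>
              (- \<alpha>) *\<^sub>R block_mat (mat 1) 0 0 (mat 1) \<preceq> block_mat X 0 0 (- Y) \<Longrightarrow>
              block_mat X 0 0 (- Y) \<preceq> \<alpha> *\<^sub>R block_mat (mat 1) (- mat 1) (- mat 1) (mat 1) \<Longrightarrow>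
              F X x - F Y y \<le> \<omega> (\<alpha> * (norm (x - y))\<^sup>2 + norm (x - y))"
        using assms(7) \<rho>(2) compact_cball by metis
      obtain \<delta> where \<delta>: "\<delta> > 0" "\<And>s. 0 \<le> s \<Longrightarrow> s < \<delta> \<Longrightarrow> \<omega> s < c"
      proof -
        have "\<forall>\<^sub>F s in at_right 0. \<omega> s < c" using \<omega> c by (auto simp: modulus_of_continuity_def intro: order_tendstoD(2))
        then obtain b where "b > 0" "\<And>s. 0 < s \<Longrightarrow> s < b \<Longrightarrow> \<omega> s < c" unfolding eventually_at_right_field by auto
        \<comment> \<open>The limit from the right leaves out 0, the argument that occurs when the
          two points coincide.\<close>
        moreover have "\<omega> 0 < c" using \<omega> c by (simp add: modulus_of_continuity_def)
        ultimately show thesis using that[of b] by (metis less_eq_real_def)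
      qed
      have "\<forall>\<^sub>F n in sequentially. z (r n) \<in> cball zh \<rho>"
        using tendstoD[OF lim1 \<rho>(1)] by eventually_elim (simp add: dist_commute)
      moreover have "\<forall>\<^sub>F n in sequentially. z' (r n) \<in> cball zh \<rho>"
        using tendstoD[OF lim2 \<rho>(1)] by eventually_elim (simp add: dist_commute)
      moreover have "\<forall>\<^sub>F n in sequentially. d (r n) < \<delta> / 2"
        using order_tendstoD(2)[OF dr0, of "\<delta> / 2"] \<delta>(1) by simp
      moreover have "\<forall>\<^sub>F n in sequentially. V (z (r n)) + U (z' (r n)) + inverse (\<alpha> (r n)) < V zh + U zh + \<delta> / 12"
        using ev[of "\<delta> / 12"] \<delta>(1) by simp
      ultimately have "\<forall>\<^sub>F n in sequentially. False"
      proof eventually_elim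
        fix n
        let ?n = "r n"
        assume K: "z ?n \<in> cball zh \<rho>" "z' ?n \<in> cball zh \<rho>" and 1: "d ?n < \<delta> / 2"
          and 2: "V (z ?n) + U (z' ?n) + inverse (\<alpha> ?n) < V zh + U zh + \<delta> / 12"
        \<comment> \<open>The competitor is now the limit \<open>zh\<close> itself: \<alpha>/6 d^2
          is below \<delta>/12, so the penalty is not only bounded but tends to 0 along the
          subsequence.\<close>
        have "\<alpha> ?n * (d ?n)\<^sup>2 < \<delta> / 2" using near'[OF zh, of ?n] 2 by simp
        then have "\<omega> (\<alpha> ?n * (d ?n)\<^sup>2 + d ?n) < c" using 1 \<alpha>[of ?n] by (intro \<delta>(2)) (auto simp: d_def)
        moreover have "F (X ?n) (z ?n) - F (Y ?n) (z' ?n) \<le> \<omega> (\<alpha> ?n * (d ?n)\<^sup>2 + d ?n)"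
          unfolding d_def by (rule struct[OF \<alpha> K sym blocks])
        moreover have "c \<le> F (X ?n) (z ?n)" "F (Y ?n) (z' ?n) \<le> - c" using K \<rho>(2) strict by auto
        \<comment> \<open>The difference of the values of \<open>F\<close> is at least
          \<open>2 * c\<close> but below \<open>c\<close>.\<close>
        ultimately show False using c by linarith
      qed
      then show False by simp
    qed
  qed
qed

end
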